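(* Consider chains of $N\times N$ matrices $\mathbb A,B_1,B_2,\dots,B_j$ with the Poisson brackets of type (ii): $$\{\overset{1}{\mathbb A},\overset{2}{\mathbb A}\}=r_{12}\overset{1}{\mathbb A}\overset{2}{\mathbb A}-\overset{1}{\mathbb A}\overset{2}{\mathbb A}r_{12}+\overset{1}{\mathbb A}r_{12}^{t_1}\overset{2}{\mathbb A}-\overset{2}{\mathbb A}r_{12}^{t_1}\overset{1}{\mathbb A},\qquad \{\overset{1}{B_1},\overset{2}{\mathbb A}\}=-\overset{1}{B_1}r_{12}^{t_2}\overset{2}{\mathbb A}-\overset{1}{B_1}\overset{2}{\mathbb A}r_{12},$$ $$\{\overset{1}{B_k},\overset{2}{B_k}\}=r_{12}\overset{1}{B_k}\overset{2}{B_k}-\overset{1}{B_k}\overset{2}{B_k}r_{12}\ (1\le k\le j),\qquad \{\overset{1}{B_{k+1}},\overset{2}{B_k}\}=-\overset{1}{B_{k+1}}r_{12}^{t_2}\overset{2}{B_k}\ (1\le k\le j-1),$$ with all other brackets ($\mathbb A$ with $B_k$ for $k\ge2$, and $B_k$ with $B_l$ for $|k-l|>1$) equal to zero. The following are algebraically independent Casimir functions of these brackets: $\bullet$ for all $j$, the $\left[\frac N2\right]$ coefficients $Y_p$ of the $\lambda$-expansion $$\frac{\det(\lambda\mathbb A+\lambda^{-1}\mathbb A^{\mathrm T})}{\det\mathbb A}=(\lambda^N+\lambda^{-N})+\sum_{p=1}^{[N/2]}(\lambda^{N-2p}+\lambda^{2p-N})Y_p;$$ $\bullet$ for even $j$,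 the $\left[\frac{N+1}2\right]$ functions $$X_p=\frac{M_S^p\prod_{k=1}^jM_{B_k}^p}{M_S^{N-p}\prod_{k=1}^jM_{B_k}^{N-p}},\qquad p=0,1,\dots,\left[\tfrac{N+1}2\right]-1,$$ where $M_{B_k}^q$ are the $(q\times q)$ upper-right minors of $B_k$ and $M_S^q$ are the $(q\times q)$ upper-right minors of $S=\mathbb A^{\mathrm T}B_1^{-1}B_2^{\mathrm T}\cdots B_{j-1}^{-1}B_j^{\mathrm T}$; $\bullet$ for odd $j=2r+1$, the $\left[\frac N2\right]$ functions $$X_p:=\frac{M_S^pM_S^{N-p}\prod_{k=1}^r\left(M_{B_{2k}}^pM_{B_{2k}}^{N-p}\right)}{\prod_{k=1}^{r+1}\left(M_{B_{2k-1}}^pM_{B_{2k-1}}^{N-p}\right)}\cdot\frac{\prod_{k=1}^{r+1}[\det B_{2k-1}]^2}{\det\mathbb A\prod_{k=1}^r[\det B_{2k}]^2},\qquad p=1,\dots,[N/2],$$ where $M_{B_k}^q$ are the $(q\times q)$ upper-right minors of $B_k$ and $M_S^q$ are now the $(q\times q)$ principal (situated at the upper-left corner) minors of $S=\mathbb A^{\mathrm T}B_1^{-1}B_2^{\mathrm T}\cdots B_{j-1}^{\mathrm T}B_j^{-1}$. We therefore have $[\frac N2]+[\frac{N+1}2]=N$ Casimir functions for even $j$ and $2[\frac N2]$ Casimir functions for odd $j$.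
   Context: $\mathbb A$ is an $N\times N$ complex matrix (generic, in particular $\det\mathbb A\neq0$), $B_k\in GL_N(\mathbb C)$. $E_{i,j}$ are the $N\times N$ matrix units. For an $N\times N$ matrix $X$ write $\overset{1}{X}=X\otimes I$, $\overset{2}{X}=I\otimes X$. For $T\in \mathrm{Mat}_N\otimes\mathrm{Mat}_N$, $T^{t_1}$ and $T^{t_2}$ denote transposition in the first, respectively second, tensor factor. $\{\overset{1}{X},\overset{2}{Y}\}=\sum_{i,j,k,l}\{x_{i,j},y_{k,l}\}E_{i,j}\otimes E_{k,l}$. The classical $r$-matrix is $r_{12}=\sum_i E_{i,i}\otimes E_{i,i}+2\sum_{i>j}E_{i,j}\otimes E_{j,i}$. $[x]$ is the integer part of $x$. Casimir functions are (rational) functions that Poisson commute with all entries of $\mathbb A,B_1,\dots,B_j$. The upper-right $(q\times q)$-minor uses rows $1,\dots,q$ and columns $N-q+1,\dots,N$; minors of size $0$ equal $1$. *)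

theory Defs
  imports
    "HOL-Analysis.Derivative"
    "HOL-Library.Poly_Mapping"
    "Jordan_Normal_Form.Determinant"
    "Jordan_Normal_Form.Gauss_Jordan_Elimination"
begin

text \<open>All matrix indices are 0-based: the index \<open>i\<close> of the mathematical text is \<open>i - 1\<close> here.\<close>

section \<open>Polynomials and rational functions in several variables\<close>

text \<open>A polynomial is a finitely supported map from monomials (finitely supported
  exponent vectors) to coefficients.\<close>

type_synonym 'v cpoly = "('v \<Rightarrow>\<^sub>0 nat) \<Rightarrow>\<^sub>0 complex"

definition cpoly_vars :: "'v cpoly \<Rightarrow> 'v set" where
  "cpoly_vars p = (\<Union>m\<in>Poly_Mapping.keys p. Poly_Mapping.keys m)"

definition cpoly_eval :: "'v cpoly \<Rightarrow> ('v \<Rightarrow> complex) \<Rightarrow> complex" where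
  "cpoly_eval p x = (\<Sum>m\<in>Poly_Mapping.keys p. Poly_Mapping.lookup p m *
     (\<Prod>v\<in>Poly_Mapping.keys m. x v ^ Poly_Mapping.lookup m v))"

text \<open>Rational functions in the variables \<open>V\<close> are represented by total functions on points
  that may take arbitrary values where a denominator vanishes. Identities between them therefore
  have to be understood on the complement of the zero set of some non-zero polynomial.\<close>

definition generically :: "'v set \<Rightarrow> (('v \<Rightarrow> complex) \<Rightarrow> bool) \<Rightarrow> bool" where
  "generically V P \<longleftrightarrow>
     (\<exists>q. q \<noteq> 0 \<and> cpoly_vars q \<subseteq> V \<and> (\<forall>x. cpoly_eval q x \<noteq> 0 \<longrightarrow> P x))"

definition rational_function :: "'v set \<Rightarrow> (('v \<Rightarrow> complex) \<Rightarrow> complex) \<Rightarrow> bool" where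
  "rational_function V f \<longleftrightarrow>
     (\<exists>p q. q \<noteq> 0 \<and> cpoly_vars p \<subseteq> V \<and> cpoly_vars q \<subseteq> V \<and>
        (\<forall>x. cpoly_eval q x \<noteq> 0 \<longrightarrow> f x = cpoly_eval p x / cpoly_eval q x))"

definition algebraically_independent ::
    "'v set \<Rightarrow> 'i set \<Rightarrow> ('i \<Rightarrow> ('v \<Rightarrow> complex) \<Rightarrow> complex) \<Rightarrow> bool" where
  "algebraically_independent V I F \<longleftrightarrow>
     (\<forall>p. p \<noteq> 0 \<and> cpoly_vars p \<subseteq> I \<longrightarrow>
        \<not> generically V (\<lambda>x. cpoly_eval p (\<lambda>i. F i x) = 0))"

definition partial_deriv ::
    "'v \<Rightarrow> (('v \<Rightarrow> complex) \<Rightarrow> complex) \<Rightarrow> ('v \<Rightarrow> complex) \<Rightarrow> complex" where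
  "partial_deriv v f x = deriv (\<lambda>t. f (x(v := t))) (x v)"

section \<open>Chains of matrices\<close>

text \<open>The coordinate \<open>(k, a, b)\<close> is the \<open>(a, b)\<close> entry of the matrix number \<open>k\<close> of the chain:
  number \<open>0\<close> is \<open>\<bbbA>\<close>, and number \<open>k \<ge> 1\<close> is \<open>B\<^sub>k\<close>.\<close>

type_synonym coord = "nat \<times> nat \<times> nat"
type_synonym point = "coord \<Rightarrow> complex"

definition coords :: "nat \<Rightarrow> nat \<Rightarrow> coord set" where
  "coords N j = {0..j} \<times> {..<N} \<times> {..<N}"

definition chain_mat :: "nat \<Rightarrow> point \<Rightarrow> nat \<Rightarrow> complex mat" where
  "chain_mat N x k = mat N N (\<lambda>(a, b). x (k, a, b))"

section \<open>The Poisson brackets\<close>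

text \<open>\<open>T i j k l\<close> is the coefficient of \<open>E\<^sub>i\<^sub>,\<^sub>j \<otimes> E\<^sub>k\<^sub>,\<^sub>l\<close> in an element \<open>T\<close> of
  \<open>Mat\<^sub>N \<otimes> Mat\<^sub>N\<close>; in particular the bracket of the entries \<open>x\<^sub>i\<^sub>,\<^sub>j\<close> and \<open>y\<^sub>k\<^sub>,\<^sub>l\<close> is this
  coefficient of the tensor that gives the bracket of \<open>X \<otimes> I\<close> and \<open>I \<otimes> Y\<close>.\<close>

type_synonym tensor2 = "nat \<Rightarrow> nat \<Rightarrow> nat \<Rightarrow> nat \<Rightarrow> complex"

definition leg1 :: "complex mat \<Rightarrow> tensor2" where
  "leg1 X i j k l = (if k = l then X $$ (i, j) else 0)"

definition leg2 :: "complex mat \<Rightarrow> tensor2" where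
  "leg2 X i j k l = (if i = j then X $$ (k, l) else 0)"

definition transp1 :: "tensor2 \<Rightarrow> tensor2" where
  "transp1 T i j k l = T j i k l"

definition transp2 :: "tensor2 \<Rightarrow> tensor2" where
  "transp2 T i j k l = T i j l k"

definition r12 :: tensor2 where
  "r12 i j k l = (if i = j \<and> j = k \<and> k = l then 1 else 0)
     + 2 * (if i > j \<and> k = j \<and> l = i then 1 else 0)"

context
  fixes N :: nat
begin

definition tensor_mult :: "tensor2 \<Rightarrow> tensor2 \<Rightarrow> tensor2" (infixl \<open>\<star>\<close> 70) where
  "(S \<star> T) i j k l = (\<Sum>a<N. \<Sum>b<N. S i a k b * T a j b l)"

definition bracket_AA :: "complex mat \<Rightarrow> tensor2" where
  "bracket_AA A i j k l =
       (r12 \<star> leg1 A \<star> leg2 A) i j k l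
     - (leg1 A \<star> leg2 A \<star> r12) i j k l
     + (leg1 A \<star> transp1 r12 \<star> leg2 A) i j k l
     - (leg2 A \<star> transp1 r12 \<star> leg1 A) i j k l"

definition bracket_B1A :: "complex mat \<Rightarrow> complex mat \<Rightarrow> tensor2" where
  "bracket_B1A B A i j k l =
     - (leg1 B \<star> transp2 r12 \<star> leg2 A) i j k l
     - (leg1 B \<star> leg2 A \<star> r12) i j k l"

definition bracket_BB :: "complex mat \<Rightarrow> tensor2" where
  "bracket_BB B i j k l =
       (r12 \<star> leg1 B \<star> leg2 B) i j k l
     - (leg1 B \<star> leg2 B \<star> r12) i j k l"

text \<open>The bracket of \<open>B\<^sub>k\<^sub>+\<^sub>1\<close> (here \<open>C\<close>, in the first factor) and \<open>B\<^sub>k\<close> (here \<open>B\<close>).\<close>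

definition bracket_BsucB :: "complex mat \<Rightarrow> complex mat \<Rightarrow> tensor2" where
  "bracket_BsucB C B i j k l = - (leg1 C \<star> transp2 r12 \<star> leg2 B) i j k l"

text \<open>Brackets of all pairs of coordinate functions. Those with the factors in the order not
  listed explicitly are determined by skew-symmetry.\<close>

definition coord_bracket :: "point \<Rightarrow> coord \<Rightarrow> coord \<Rightarrow> complex" where
  "coord_bracket x u v =
     (case u of (k, a, b) \<Rightarrow> case v of (l, c, d) \<Rightarrow>
        let M = chain_mat N x in
        if k = 0 \<and> l = 0 then bracket_AA (M 0) a b c d
        else if k = l then bracket_BB (M k) a b c d
        else if k = 1 \<and> l = 0 then bracket_B1A (M 1) (M 0) a b c d
        else if k = 0 \<and> l = 1 then - bracket_B1A (M 1) (M 0) c d a b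
        else if k = l + 1 then bracket_BsucB (M k) (M l) a b c d
        else if l = k + 1 then - bracket_BsucB (M l) (M k) c d a b
        else 0)"

text \<open>The extension to rational functions by the Leibniz rule.\<close>

definition poisson_bracket ::
    "nat \<Rightarrow> (point \<Rightarrow> complex) \<Rightarrow> (point \<Rightarrow> complex) \<Rightarrow> point \<Rightarrow> complex" where
  "poisson_bracket j f g x =
     (\<Sum>u\<in>coords N j. \<Sum>v\<in>coords N j.
        partial_deriv u f x * partial_deriv v g x * coord_bracket x u v)"

definition casimir :: "nat \<Rightarrow> (point \<Rightarrow> complex) \<Rightarrow> bool" where
  "casimir j f \<longleftrightarrow> rational_function (coords N j) f \<and>
     (\<forall>v\<in>coords N j. generically (coords N j) (\<lambda>x. poisson_bracket j f (\<lambda>y. y v) x = 0))"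

end

section \<open>The functions \<open>Y\<^sub>p\<close> and \<open>X\<^sub>p\<close>\<close>

definition lambda_expansion :: "nat \<Rightarrow> complex mat \<Rightarrow> (nat \<Rightarrow> complex) \<Rightarrow> bool" where
  "lambda_expansion N A y \<longleftrightarrow>
     (\<forall>z. z \<noteq> 0 \<longrightarrow>
        det (z \<cdot>\<^sub>m A + inverse z \<cdot>\<^sub>m transpose_mat A) / det A =
        (z powi int N + z powi (- int N)) +
        (\<Sum>p=1..N div 2. (z powi (int N - 2 * int p) + z powi (2 * int p - int N)) * y p))"

definition Y_fun :: "nat \<Rightarrow> nat \<Rightarrow> point \<Rightarrow> complex" where
  "Y_fun N p x =
     (THE y. lambda_expansion N (chain_mat N x 0) y \<and> (\<forall>q. q \<notin> {1..N div 2} \<longrightarrow> y q = 0)) p"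

definition upper_right_minor :: "nat \<Rightarrow> complex mat \<Rightarrow> complex" where
  "upper_right_minor q X = det (mat q q (\<lambda>(a, b). X $$ (a, dim_col X - q + b)))"

definition upper_left_minor :: "nat \<Rightarrow> complex mat \<Rightarrow> complex" where
  "upper_left_minor q X = det (mat q q (\<lambda>(a, b). X $$ (a, b)))"

text \<open>\<open>S_chain N x j\<close> is \<open>\<bbbA>\<^sup>T B\<^sub>1\<^sup>-\<^sup>1 B\<^sub>2\<^sup>T \<dots>\<close> with \<open>j\<close> factors after \<open>\<bbbA>\<^sup>T\<close>, alternating
  between inverses (odd \<open>k\<close>) and transposes (even \<open>k\<close>).\<close>

fun S_chain :: "nat \<Rightarrow> point \<Rightarrow> nat \<Rightarrow> complex mat" where
  "S_chain N x 0 = transpose_mat (chain_mat N x 0)"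
| "S_chain N x (Suc k) = S_chain N x k *
     (if odd (Suc k) then the (mat_inverse (chain_mat N x (Suc k)))
      else transpose_mat (chain_mat N x (Suc k)))"

definition X_even :: "nat \<Rightarrow> nat \<Rightarrow> nat \<Rightarrow> point \<Rightarrow> complex" where
  "X_even N j p x = (let S = S_chain N x j; B = chain_mat N x in
     (upper_right_minor p S * (\<Prod>k=1..j. upper_right_minor p (B k))) /
     (upper_right_minor (N - p) S * (\<Prod>k=1..j. upper_right_minor (N - p) (B k))))"

definition X_odd :: "nat \<Rightarrow> nat \<Rightarrow> nat \<Rightarrow> point \<Rightarrow> complex" where
  "X_odd N j p x = (let S = S_chain N x j; A = chain_mat N x 0; B = chain_mat N x;
       r = (j - 1) div 2 in
     (upper_left_minor p S * upper_left_minor (N - p) S *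
        (\<Prod>k=1..r. upper_right_minor p (B (2 * k)) * upper_right_minor (N - p) (B (2 * k)))) /
     (\<Prod>k=1..r + 1. upper_right_minor p (B (2 * k - 1)) *
        upper_right_minor (N - p) (B (2 * k - 1))) *
     ((\<Prod>k=1..r + 1. (det (B (2 * k - 1)))\<^sup>2) /
      (det A * (\<Prod>k=1..r. (det (B (2 * k)))\<^sup>2))))"

end

theory Submission
  imports Defs "Jordan_Normal_Form.Char_Poly"
begin

text \<open>The Hamiltonian vector field of a matrix entry of the chain acts on each \<open>B\<^sub>k\<close> by
  \<open>\<delta>B\<^sub>k = X\<^sub>k B\<^sub>k + B\<^sub>k Y\<^sub>k\<close> with lower triangular \<open>X\<^sub>k\<close> and \<open>Y\<^sub>k\<close>, on \<open>\<bbbA>\<close> by an infinitesimal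
  congruence \<open>\<delta>\<bbbA> = W \<bbbA> + \<bbbA> W\<^sup>T\<close>, and on the telescoping product \<open>S\<close> by \<open>\<delta>S = U S + S V\<close> with
  lower triangular \<open>U\<close> and with \<open>V\<close> lower triangular for even \<open>j\<close> and upper triangular for odd
  \<open>j\<close>. Hence every minor that occurs is multiplied by a weight read off from the diagonals of these
  matrices, and the weights cancel in \<open>X\<^sub>p\<close>. The \<open>Y\<^sub>p\<close> are invariant because
  \<open>det (\<lambda>\<bbbA> + \<lambda>\<^sup>-\<^sup>1\<bbbA>\<^sup>T) / det \<bbbA>\<close> is invariant under congruence.

  For the algebraic independence, it is enough that the functions jointly take all tuples of nonzero
  values at points where they are smooth. They do so already on antidiagonal matrices: the
  ratios of opposite entries of \<open>\<bbbA>\<close> prescribe the \<open>Y\<^sub>p\<close>, by factoring the given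
  \<open>\<lambda>\<close>-expansion, and the remaining freedom prescribes the \<open>X\<^sub>p\<close>.\<close>

section \<open>Polynomial functions\<close>

text \<open>The bracket enters through one relation: r12 plus its flip is twice the permutation
  operator, that is, \<open>wt a b + wt b a = 2\<close>. Hence \<open>LP\<close> plus the transpose
  of \<open>LPt\<close> is 2P and \<open>LQ\<close> plus the transpose of \<open>LQt\<close> is 2Q,
  while P B = B Q for B = \<open>B l\<close>, both being B Z B. So an upper triangular multiplier on
  one side of B can be exchanged for a lower triangular one on the other. This makes the motion of S
  telescope along the chain, and it gives the motion of A two forms: the congruence, whose W need
  not be triangular, and a triangular one for the transpose of A. Two obstacles shape the rest.
  Functions are total, with default values where a denominator vanishes, so everything is computed
  at points where the matrices are invertible and the function is nonzero. And since derivatives are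
  tested along curves, a curve may be replaced by any other with the same point and velocity, which
  spares derivatives of inverses and of the coefficients of the expansion. Attaining all values
  suffices for independence because a generic relation extends by continuity to every smooth
  point.\<close>

definition monomial_eval :: "('v \<Rightarrow>\<^sub>0 nat) \<Rightarrow> ('v \<Rightarrow> complex) \<Rightarrow> complex" where
  "monomial_eval m x = (\<Prod>v\<in>Poly_Mapping.keys m. x v ^ Poly_Mapping.lookup m v)"

lemma monomial_eval_superset:
  assumes "finite W" "Poly_Mapping.keys m \<subseteq> W"
  shows "monomial_eval m x = (\<Prod>v\<in>W. x v ^ Poly_Mapping.lookup m v)"
  unfolding monomial_eval_def using assms
  by (intro prod.mono_neutral_left) (auto simp: in_keys_iff)

lemma monomial_eval_add:
  "monomial_eval (m + m') x = monomial_eval m x * monomial_eval m' x"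
proof -
  let ?W = "Poly_Mapping.keys m \<union> Poly_Mapping.keys m'"
  have "monomial_eval (m + m') x = (\<Prod>v\<in>?W. x v ^ Poly_Mapping.lookup (m + m') v)"
    by (rule monomial_eval_superset) (simp_all add: Poly_Mapping.keys_add)
  also have "\<dots> = (\<Prod>v\<in>?W. x v ^ Poly_Mapping.lookup m v)
      * (\<Prod>v\<in>?W. x v ^ Poly_Mapping.lookup m' v)"
    by (simp add: lookup_add power_add prod.distrib)
  finally show ?thesis
    using monomial_eval_superset[of ?W m x] monomial_eval_superset[of ?W m' x] by simp
qed

lemma cpoly_eval_superset:
  assumes "finite K" "Poly_Mapping.keys p \<subseteq> K"
  shows "cpoly_eval p x = (\<Sum>m\<in>K. Poly_Mapping.lookup p m * monomial_eval m x)"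
  unfolding cpoly_eval_def monomial_eval_def[symmetric] using assms
  by (intro sum.mono_neutral_left) (auto simp: in_keys_iff)

lemma cpoly_eval_0 [simp]: "cpoly_eval 0 x = 0"
  by (simp add: cpoly_eval_def)

lemma cpoly_eval_add: "cpoly_eval (p + q) x = cpoly_eval p x + cpoly_eval q x"
proof -
  let ?K = "Poly_Mapping.keys p \<union> Poly_Mapping.keys q"
  have "cpoly_eval (p + q) x
      = (\<Sum>m\<in>?K. Poly_Mapping.lookup (p + q) m * monomial_eval m x)"
    by (rule cpoly_eval_superset) (simp_all add: Poly_Mapping.keys_add)
  also have "\<dots> = (\<Sum>m\<in>?K. Poly_Mapping.lookup p m * monomial_eval m x)
      + (\<Sum>m\<in>?K. Poly_Mapping.lookup q m * monomial_eval m x)"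
    by (simp add: lookup_add distrib_right sum.distrib)
  finally show ?thesis
    using cpoly_eval_superset[of ?K p x] cpoly_eval_superset[of ?K q x] by simp
qed

lemma cpoly_eval_sum: "cpoly_eval (\<Sum>i\<in>I. f i) x = (\<Sum>i\<in>I. cpoly_eval (f i) x)"
  by (induction I rule: infinite_finite_induct) (simp_all add: cpoly_eval_add)

lemma cpoly_eval_single: "cpoly_eval (Poly_Mapping.single m c) x = c * monomial_eval m x"
  by (subst cpoly_eval_superset[of "{m}"]) auto

lemma cpoly_as_sum:
  "p = (\<Sum>m\<in>Poly_Mapping.keys p. Poly_Mapping.single m (Poly_Mapping.lookup p m))"
  by (rule poly_mapping_eqI)
     (auto simp: lookup_sum lookup_single when_def sum.delta in_keys_iff)

lemma cpoly_eval_mult: "cpoly_eval (p * q) x = cpoly_eval p x * cpoly_eval q x"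
proof -
  let ?s = "\<lambda>p m. Poly_Mapping.single m (Poly_Mapping.lookup p m) :: 'a cpoly"
  have "p * q = (\<Sum>m\<in>Poly_Mapping.keys p. ?s p m) * (\<Sum>m\<in>Poly_Mapping.keys q. ?s q m)"
    using cpoly_as_sum[of p] cpoly_as_sum[of q] by simp
  also have "cpoly_eval \<dots> x = (\<Sum>m\<in>Poly_Mapping.keys p. \<Sum>m'\<in>Poly_Mapping.keys q.
      (Poly_Mapping.lookup p m * monomial_eval m x) * (Poly_Mapping.lookup q m' * monomial_eval m' x))"
    by (simp add: sum_product mult_single cpoly_eval_sum cpoly_eval_single monomial_eval_add
        mult_ac)
  also have "\<dots> = cpoly_eval p x * cpoly_eval q x"
    by (simp add: sum_product cpoly_eval_superset[of "Poly_Mapping.keys p" p]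
        cpoly_eval_superset[of "Poly_Mapping.keys q" q])
  finally show ?thesis .
qed

lemma finite_cpoly_vars: "finite (cpoly_vars p)"
  by (simp add: cpoly_vars_def)

lemma cpoly_vars_single: "cpoly_vars (Poly_Mapping.single m c) \<subseteq> Poly_Mapping.keys m"
  by (auto simp: cpoly_vars_def)

lemma cpoly_vars_add: "cpoly_vars (p + q) \<subseteq> cpoly_vars p \<union> cpoly_vars q"
  unfolding cpoly_vars_def using Poly_Mapping.keys_add[of p q] by blast

lemma cpoly_vars_mult: "cpoly_vars (p * q) \<subseteq> cpoly_vars p \<union> cpoly_vars q"
proof
  fix v assume "v \<in> cpoly_vars (p * q)"
  then obtain m where m: "m \<in> Poly_Mapping.keys (p * q)" "v \<in> Poly_Mapping.keys m"
    by (auto simp: cpoly_vars_def)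
  from m(1) Poly_Mapping.keys_mult[of p q] obtain a b where
    "a \<in> Poly_Mapping.keys p" "b \<in> Poly_Mapping.keys q" "m = a + b" by blast
  with m(2) Poly_Mapping.keys_add[of a b] show "v \<in> cpoly_vars p \<union> cpoly_vars q"
    by (auto simp: cpoly_vars_def)
qed

lemma cpoly_eval_cong:
  assumes "\<And>v. v \<in> cpoly_vars p \<Longrightarrow> x v = y v"
  shows "cpoly_eval p x = cpoly_eval p y"
proof -
  have "(\<Prod>v\<in>Poly_Mapping.keys m. x v ^ Poly_Mapping.lookup m v)
      = (\<Prod>v\<in>Poly_Mapping.keys m. y v ^ Poly_Mapping.lookup m v)"
    if "m \<in> Poly_Mapping.keys p" for m
  proof (rule prod.cong)
    fix v assume "v \<in> Poly_Mapping.keys m"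
    then have "x v = y v" using that by (intro assms) (auto simp: cpoly_vars_def)
    then show "x v ^ Poly_Mapping.lookup m v = y v ^ Poly_Mapping.lookup m v" by simp
  qed simp
  then show ?thesis unfolding cpoly_eval_def by simp
qed

text \<open>Kronecker substitution: on a finite set of monomials a suitable substitution of powers of
  one variable for all variables separates the monomials.\<close>

lemma separating_weights:
  fixes K :: "('v \<Rightarrow> nat) set"
  assumes "finite V" "finite K"
  shows "\<exists>e. \<forall>m\<in>K. \<forall>m'\<in>K.
    (\<Sum>v\<in>V. m v * e v) = (\<Sum>v\<in>V. m' v * e v) \<longrightarrow> (\<forall>v\<in>V. m v = m' v)"
  using assms(1)
proof (induction V rule: finite_induct)
  case empty
  then show ?case by simp
next
  case (insert w V)
  then obtain e where e: "\<forall>m\<in>K. \<forall>m'\<in>K.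
    (\<Sum>v\<in>V. m v * e v) = (\<Sum>v\<in>V. m' v * e v) \<longrightarrow> (\<forall>v\<in>V. m v = m' v)" by blast
  \<comment> \<open>A weight for \<open>w\<close> larger than every sum attained on V: the total is
    then a two-digit number in base \<open>B\<close>, and quotient and remainder separate the two
    parts.\<close>
  define B where "B = Suc (\<Sum>m\<in>K. \<Sum>v\<in>V. m v * e v)"
  have B: "(\<Sum>v\<in>V. m v * e v) < B" if "m \<in> K" for m
    unfolding B_def less_Suc_eq_le by (rule member_le_sum) (use that assms in auto)
  define e' where "e' = e(w := B)"
  have s: "(\<Sum>v\<in>insert w V. m v * e' v) = m w * B + (\<Sum>v\<in>V. m v * e v)" for m
  proof -
    have "(\<Sum>v\<in>V. m v * e' v) = (\<Sum>v\<in>V. m v * e v)"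
      using insert.hyps by (intro sum.cong) (auto simp: e'_def)
    then show ?thesis using insert.hyps by (simp add: e'_def)
  qed
  show ?case
  proof (intro exI ballI impI)
    fix m m' v
    assume m: "m \<in> K" "m' \<in> K"
      and eq: "(\<Sum>v\<in>insert w V. m v * e' v) = (\<Sum>v\<in>insert w V. m' v * e' v)"
      and v: "v \<in> insert w V"
    from eq have eq': "m w * B + (\<Sum>v\<in>V. m v * e v) = m' w * B + (\<Sum>v\<in>V. m' v * e v)"
      by (simp only: s)
    from arg_cong[OF eq', of "\<lambda>n. n mod B"] have "(\<Sum>v\<in>V. m v * e v) = (\<Sum>v\<in>V. m' v * e v)"
      using B[OF m(1)] B[OF m(2)] by simp
    moreover from arg_cong[OF eq', of "\<lambda>n. n div B"] have "m w = m' w"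
      using B[OF m(1)] B[OF m(2)] by simp
    ultimately show "m v = m' v" using e m v by blast
  qed
qed

text \<open>Ties the formal condition \<open>q \<noteq> 0\<close> in \<open>generically\<close> to
  values: the separating substitution turns p into a nonzero polynomial in one variable, which has a
  non-root.\<close>

lemma cpoly_nonzero_point:
  assumes "p \<noteq> 0"
  shows "\<exists>x. cpoly_eval p x \<noteq> 0"
proof -
  let ?K = "Poly_Mapping.keys p" and ?V = "cpoly_vars p"
  obtain e where e: "\<forall>m\<in>Poly_Mapping.lookup ` ?K. \<forall>m'\<in>Poly_Mapping.lookup ` ?K.
    (\<Sum>v\<in>?V. m v * e v) = (\<Sum>v\<in>?V. m' v * e v) \<longrightarrow> (\<forall>v\<in>?V. m v = m' v)"
    using separating_weights[OF finite_cpoly_vars[of p] finite_imageI[OF finite_keys[of p]],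
        of Poly_Mapping.lookup] by (elim exE)
  define d where "d m = (\<Sum>v\<in>?V. Poly_Mapping.lookup m v * e v)" for m
  have keys: "Poly_Mapping.keys m \<subseteq> ?V" if "m \<in> ?K" for m
    using that by (auto simp: cpoly_vars_def)
  have inj: "inj_on d ?K"
  proof (rule inj_onI, rule poly_mapping_eqI)
    fix m m' v assume m: "m \<in> ?K" "m' \<in> ?K" "d m = d m'"
    then have "\<forall>v\<in>?V. Poly_Mapping.lookup m v = Poly_Mapping.lookup m' v"
      using e[rule_format, OF imageI[OF m(1)] imageI[OF m(2)]] m(3) unfolding d_def by blast
    then show "Poly_Mapping.lookup m v = Poly_Mapping.lookup m' v"
      using keys[OF m(1)] keys[OF m(2)] by (metis in_keys_iff subsetD)
  qed
  define g where "g = (\<Sum>m\<in>?K. monom (Poly_Mapping.lookup p m) (d m))"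
  obtain m0 where m0: "m0 \<in> ?K" using assms keys_eq_empty[of p] by blast
  have "coeff g (d m0) = (\<Sum>m\<in>?K. if m = m0 then Poly_Mapping.lookup p m else 0)"
    unfolding g_def coeff_sum coeff_monom
    by (intro sum.cong refl if_cong) (use inj_on_eq_iff[OF inj _ m0] in simp_all)
  then have "coeff g (d m0) \<noteq> 0" using m0 by (simp add: in_keys_iff)
  then have "g \<noteq> 0" by auto
  then obtain t where t: "poly g t \<noteq> 0" using poly_all_0_iff_0 by blast
  have "cpoly_eval p (\<lambda>v. t ^ e v) = poly g t"
    unfolding cpoly_eval_superset[OF finite_keys order_refl] g_def poly_sum poly_monom
  proof (intro sum.cong refl arg_cong2[of _ _ _ _ times])
    fix m assume "m \<in> ?K"
    then have "monomial_eval m (\<lambda>v. t ^ e v) = (\<Prod>v\<in>?V. (t ^ e v) ^ Poly_Mapping.lookup m v)"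
      by (intro monomial_eval_superset finite_cpoly_vars keys)
    also have "\<dots> = t ^ d m"
      unfolding d_def power_sum by (simp add: power_mult[symmetric] mult.commute)
    finally show "monomial_eval m (\<lambda>v. t ^ e v) = t ^ d m" .
  qed
  with t show ?thesis by metis
qed

lemma cpoly_eval_along_line:
  "\<exists>r. \<forall>t. cpoly_eval p (\<lambda>v. x v + t * z v) = poly r t"
proof (intro exI allI)
  fix t
  show "cpoly_eval p (\<lambda>v. x v + t * z v) =
    poly (\<Sum>m\<in>Poly_Mapping.keys p. [:Poly_Mapping.lookup p m:] *
      (\<Prod>v\<in>Poly_Mapping.keys m. [:x v, z v:] ^ Poly_Mapping.lookup m v)) t"
    by (simp add: cpoly_eval_def poly_sum poly_prod)
qed

text \<open>On the line from x to y, q becomes a nonzero polynomial in t with finitely many roots.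
  So every x, even one on the zero set of q, is approached by points off that set.\<close>

lemma cpoly_eventually_nonzero:
  assumes "cpoly_eval q y \<noteq> 0"
  shows "eventually (\<lambda>t. cpoly_eval q (\<lambda>v. x v + t * (y v - x v)) \<noteq> 0) (at 0)"
proof -
  obtain r where r: "cpoly_eval q (\<lambda>v. x v + t * (y v - x v)) = poly r t" for t
    using cpoly_eval_along_line[of q x "\<lambda>v. y v - x v"] by auto
  have "poly r 1 \<noteq> 0" using r[of 1] assms by simp
  then have "r \<noteq> 0" by auto
  then have "finite {t. poly r t = 0}" by (rule poly_roots_finite)
  then have "open (- ({t. poly r t = 0} - {0}))"
    by (intro open_Compl finite_imp_closed) auto
  then have "eventually (\<lambda>t. t \<in> - ({t. poly r t = 0} - {0})) (nhds 0)"
    by (rule eventually_nhds_in_open) auto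
  then show ?thesis unfolding eventually_at_filter r by (auto elim!: eventually_mono)
qed

text \<open>Restriction to the line joining a non-root of p to a non-root of q reduces the absence
  of zero divisors to one variable.\<close>

lemma cpoly_mult_nonzero:
  fixes p q :: "'v cpoly"
  assumes "p \<noteq> 0" "q \<noteq> 0"
  shows "p * q \<noteq> 0"
proof -
  obtain x y where x: "cpoly_eval p x \<noteq> 0" and y: "cpoly_eval q y \<noteq> 0"
    using assms cpoly_nonzero_point by metis
  obtain r s where
    r: "cpoly_eval p (\<lambda>v. x v + t * (y v - x v)) = poly r t" and
    s: "cpoly_eval q (\<lambda>v. x v + t * (y v - x v)) = poly s t" for t
    using cpoly_eval_along_line[of p x "\<lambda>v. y v - x v"]
      cpoly_eval_along_line[of q x "\<lambda>v. y v - x v"] by auto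
  have "poly r 0 \<noteq> 0" using r[of 0] x by simp
  moreover have "poly s 1 \<noteq> 0" using s[of 1] y by simp
  ultimately have "r * s \<noteq> 0" by auto
  then obtain t where "poly (r * s) t \<noteq> 0" using poly_all_0_iff_0 by blast
  then have "cpoly_eval (p * q) (\<lambda>v. x v + t * (y v - x v)) \<noteq> 0"
    by (simp add: cpoly_eval_mult r s)
  then show ?thesis by auto
qed

section \<open>Polynomial functions and generic validity\<close>

definition polyfun :: "'v set \<Rightarrow> (('v \<Rightarrow> complex) \<Rightarrow> complex) \<Rightarrow> bool" where
  "polyfun V f \<longleftrightarrow> (\<exists>p. cpoly_vars p \<subseteq> V \<and> f = cpoly_eval p)"

lemma polyfun_const: "polyfun V (\<lambda>x. c)"
  unfolding polyfun_def
proof (intro exI conjI)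
  show "cpoly_vars (Poly_Mapping.single 0 c :: 'a cpoly) \<subseteq> V"
    by (rule order_trans[OF cpoly_vars_single]) simp
  show "(\<lambda>x. c) = cpoly_eval (Poly_Mapping.single 0 c :: 'a cpoly)"
    by (rule ext) (simp add: cpoly_eval_single monomial_eval_def)
qed

lemma polyfun_coord:
  assumes "v \<in> V"
  shows "polyfun V (\<lambda>x. x v)"
  unfolding polyfun_def
proof (intro exI conjI)
  let ?p = "Poly_Mapping.single (Poly_Mapping.single v 1) 1 :: 'a cpoly"
  show "cpoly_vars ?p \<subseteq> V"
    by (rule order_trans[OF cpoly_vars_single]) (use assms in simp)
  show "(\<lambda>x. x v) = cpoly_eval ?p"
    by (rule ext) (simp add: cpoly_eval_single monomial_eval_def)
qed

lemma polyfun_add: "polyfun V f \<Longrightarrow> polyfun V g \<Longrightarrow> polyfun V (\<lambda>x. f x + g x)"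
  unfolding polyfun_def
proof clarify
  fix p q :: "'a cpoly" assume "cpoly_vars p \<subseteq> V" "cpoly_vars q \<subseteq> V"
  then show "\<exists>r. cpoly_vars r \<subseteq> V \<and> (\<lambda>x. cpoly_eval p x + cpoly_eval q x) = cpoly_eval r"
    using cpoly_vars_add[of p q] by (intro exI[of _ "p + q"]) (auto simp: cpoly_eval_add)
qed

lemma polyfun_mult: "polyfun V f \<Longrightarrow> polyfun V g \<Longrightarrow> polyfun V (\<lambda>x. f x * g x)"
  unfolding polyfun_def
proof clarify
  fix p q :: "'a cpoly" assume "cpoly_vars p \<subseteq> V" "cpoly_vars q \<subseteq> V"
  then show "\<exists>r. cpoly_vars r \<subseteq> V \<and> (\<lambda>x. cpoly_eval p x * cpoly_eval q x) = cpoly_eval r"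
    using cpoly_vars_mult[of p q] by (intro exI[of _ "p * q"]) (auto simp: cpoly_eval_mult)
qed

lemma generically_conj:
  assumes "generically V P" "generically V Q"
  shows "generically V (\<lambda>x. P x \<and> Q x)"
proof -
  obtain p q where pq: "p \<noteq> 0" "cpoly_vars p \<subseteq> V" "\<forall>x. cpoly_eval p x \<noteq> 0 \<longrightarrow> P x"
    "q \<noteq> 0" "cpoly_vars q \<subseteq> V" "\<forall>x. cpoly_eval q x \<noteq> 0 \<longrightarrow> Q x"
    using assms unfolding generically_def by auto
  then show ?thesis
    unfolding generically_def using cpoly_vars_mult[of p q]
    by (intro exI[of _ "p * q"]) (auto simp: cpoly_mult_nonzero cpoly_eval_mult)
qed

lemma generically_mono:
  "generically V P \<Longrightarrow> (\<And>x. P x \<Longrightarrow> Q x) \<Longrightarrow> generically V Q"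
  unfolding generically_def by blast

lemma generically_True: "generically V (\<lambda>x. True)"
proof -
  have "cpoly_vars (Poly_Mapping.single 0 1 :: 'a cpoly) \<subseteq> V"
    by (rule order_trans[OF cpoly_vars_single]) simp
  moreover have "(Poly_Mapping.single 0 1 :: 'a cpoly) \<noteq> 0" by simp
  ultimately show ?thesis unfolding generically_def by blast
qed

lemma generically_Ball:
  assumes "finite K" "\<And>k. k \<in> K \<Longrightarrow> generically V (P k)"
  shows "generically V (\<lambda>x. \<forall>k\<in>K. P k x)"
  using assms
  by (induction K rule: finite_induct) (auto simp: generically_True generically_conj)

lemma polyfun_generically_nonzero:
  assumes "polyfun V f" "f x \<noteq> 0"
  shows "generically V (\<lambda>x. f x \<noteq> 0)"
proof -
  obtain p where p: "cpoly_vars p \<subseteq> V" "f = cpoly_eval p"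
    using assms unfolding polyfun_def by blast
  then have "p \<noteq> 0" using assms(2) by auto
  with p show ?thesis unfolding generically_def by blast
qed

section \<open>The field operations on rational functions\<close>

lemma rational_function_iff_polyfun:
  "rational_function V f \<longleftrightarrow>
    (\<exists>p q. polyfun V p \<and> polyfun V q \<and> (\<exists>x. q x \<noteq> 0) \<and> (\<forall>x. q x \<noteq> 0 \<longrightarrow> f x = p x / q x))"
  (is "_ \<longleftrightarrow> ?R")
proof
  assume "rational_function V f"
  then obtain p q where pq: "q \<noteq> 0" "cpoly_vars p \<subseteq> V" "cpoly_vars q \<subseteq> V"
      "\<forall>x. cpoly_eval q x \<noteq> 0 \<longrightarrow> f x = cpoly_eval p x / cpoly_eval q x"
    unfolding rational_function_def by blast
  have "polyfun V (cpoly_eval p)" "polyfun V (cpoly_eval q)"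
    using pq unfolding polyfun_def by blast+
  with pq(4) cpoly_nonzero_point[OF pq(1)] show ?R by blast
next
  assume ?R
  then obtain p q x where pq: "polyfun V p" "polyfun V q" "q x \<noteq> 0"
      "\<forall>x. q x \<noteq> 0 \<longrightarrow> f x = p x / q x"
    by blast
  then obtain P Q where PQ: "cpoly_vars P \<subseteq> V" "cpoly_vars Q \<subseteq> V"
      "p = cpoly_eval P" "q = cpoly_eval Q"
    unfolding polyfun_def by blast
  from pq(3) PQ(4) have "Q \<noteq> 0" by auto
  with PQ pq(4) show "rational_function V f" unfolding rational_function_def by blast
qed

lemma rational_functionI:
  assumes "polyfun V p" "polyfun V q" "\<exists>x. q x \<noteq> 0" "\<And>x. q x \<noteq> 0 \<Longrightarrow> f x = p x / q x"
  shows "rational_function V f"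
  unfolding rational_function_iff_polyfun using assms by blast

lemma polyfun_mult_nonzero:
  assumes "polyfun V p" "polyfun V q" "p x \<noteq> 0" "q y \<noteq> 0"
  shows "\<exists>z. p z * q z \<noteq> 0"
proof -
  obtain P Q where PQ: "p = cpoly_eval P" "q = cpoly_eval Q"
    using assms unfolding polyfun_def by blast
  then have "P \<noteq> 0" "Q \<noteq> 0" using assms(3,4) by auto
  then have "P * Q \<noteq> 0" by (rule cpoly_mult_nonzero)
  from cpoly_nonzero_point[OF this] show ?thesis by (simp add: PQ cpoly_eval_mult)
qed

lemma rational_function_polyfun: "polyfun V f \<Longrightarrow> rational_function V f"
  by (rule rational_functionI[of V f "\<lambda>x. 1"]) (simp_all add: polyfun_const)

lemma rational_function_add:
  assumes "rational_function V f" "rational_function V g"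
  shows "rational_function V (\<lambda>x. f x + g x)"
proof -
  from assms(1) obtain p q x where
    p: "polyfun V p" "polyfun V q" "q x \<noteq> 0" "\<And>x. q x \<noteq> 0 \<Longrightarrow> f x = p x / q x"
    unfolding rational_function_iff_polyfun by blast
  from assms(2) obtain p' q' x' where
    p': "polyfun V p'" "polyfun V q'" "q' x' \<noteq> 0" "\<And>x. q' x \<noteq> 0 \<Longrightarrow> g x = p' x / q' x"
    unfolding rational_function_iff_polyfun by blast
  show ?thesis
  proof (rule rational_functionI[of V "(\<lambda>x. p x * q' x + p' x * q x)" "(\<lambda>x. q x * q' x)"])
    show "polyfun V (\<lambda>x. p x * q' x + p' x * q x)" "polyfun V (\<lambda>x. q x * q' x)"
      by (intro polyfun_add polyfun_mult p(1,2) p'(1,2))+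
    show "\<exists>x. (\<lambda>x. q x * q' x) x \<noteq> 0" 
      using polyfun_mult_nonzero[of V q q' x x'] p p' by simp
    show "f z + g z = (p z * q' z + p' z * q z) / (q z * q' z)" if "q z * q' z \<noteq> 0" for z
      using that p(4)[of z] p'(4)[of z] by (simp add: add_frac_eq)
  qed
qed

lemma rational_function_mult:
  assumes "rational_function V f" "rational_function V g"
  shows "rational_function V (\<lambda>x. f x * g x)"
proof -
  from assms(1) obtain p q x where
    p: "polyfun V p" "polyfun V q" "q x \<noteq> 0" "\<And>x. q x \<noteq> 0 \<Longrightarrow> f x = p x / q x"
    unfolding rational_function_iff_polyfun by blast
  from assms(2) obtain p' q' x' where
    p': "polyfun V p'" "polyfun V q'" "q' x' \<noteq> 0" "\<And>x. q' x \<noteq> 0 \<Longrightarrow> g x = p' x / q' x"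
    unfolding rational_function_iff_polyfun by blast
  show ?thesis
  proof (rule rational_functionI[of V "(\<lambda>x. p x * p' x)" "(\<lambda>x. q x * q' x)"])
    show "polyfun V (\<lambda>x. p x * p' x)" "polyfun V (\<lambda>x. q x * q' x)"
      by (intro polyfun_add polyfun_mult p(1,2) p'(1,2))+
    show "\<exists>x. (\<lambda>x. q x * q' x) x \<noteq> 0" 
      using polyfun_mult_nonzero[of V q q' x x'] p p' by simp
    show "f z * g z = (p z * p' z) / (q z * q' z)" if "q z * q' z \<noteq> 0" for z
      using that p(4)[of z] p'(4)[of z] by (simp add: add_frac_eq)
  qed
qed

lemma rational_function_cong:
  assumes "rational_function V f" "generically V (\<lambda>x. g x = f x)"
  shows "rational_function V g"
proof -
  from assms(1) obtain p q x where
    p: "polyfun V p" "polyfun V q" "q x \<noteq> 0" "\<And>x. q x \<noteq> 0 \<Longrightarrow> f x = p x / q x"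
    unfolding rational_function_iff_polyfun by blast
  from assms(2) obtain R where R: "R \<noteq> 0" "cpoly_vars R \<subseteq> V"
    "\<And>x. cpoly_eval R x \<noteq> 0 \<Longrightarrow> g x = f x"
    unfolding generically_def by blast
  obtain x' where x': "cpoly_eval R x' \<noteq> 0" using cpoly_nonzero_point[OF R(1)] ..
  have R': "polyfun V (cpoly_eval R)" using R(2) unfolding polyfun_def by blast
  show ?thesis
  proof (rule rational_functionI[of V "(\<lambda>x. p x * cpoly_eval R x)" "(\<lambda>x. q x * cpoly_eval R x)"])
    show "polyfun V (\<lambda>x. p x * cpoly_eval R x)" "polyfun V (\<lambda>x. q x * cpoly_eval R x)"
      by (intro polyfun_mult p(1,2) R')+
    show "\<exists>x. (\<lambda>x. q x * cpoly_eval R x) x \<noteq> 0" 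
      using polyfun_mult_nonzero[of V q "cpoly_eval R" x x'] p R' x' by simp
    show "g z = p z * cpoly_eval R z / (q z * cpoly_eval R z)"
      if "q z * cpoly_eval R z \<noteq> 0" for z
      using that p(4)[of z] R(3)[of z] by simp
  qed
qed

lemma rational_function_inverse:
  assumes "rational_function V f"
  shows "rational_function V (\<lambda>x. inverse (f x))"
proof -
  from assms obtain p q x where
    p: "polyfun V p" "polyfun V q" "q x \<noteq> 0" "\<And>x. q x \<noteq> 0 \<Longrightarrow> f x = p x / q x"
    unfolding rational_function_iff_polyfun by blast
  show ?thesis
  proof (cases "\<exists>y. p y \<noteq> 0")
    case True
    then obtain y where y: "p y \<noteq> 0" ..
    show ?thesis
    proof (rule rational_functionI[of V "(\<lambda>x. q x * q x)" "(\<lambda>x. p x * q x)"])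
      show "polyfun V (\<lambda>x. q x * q x)" "polyfun V (\<lambda>x. p x * q x)"
        by (intro polyfun_mult p(1,2))+
      show "\<exists>x. (\<lambda>x. p x * q x) x \<noteq> 0" 
        using polyfun_mult_nonzero[of V p q y x] p y by simp
      show "inverse (f z) = (q z * q z) / (p z * q z)" if "p z * q z \<noteq> 0" for z
        using that p(4)[of z] by simp
    qed
  next
    \<comment> \<open>Here p is identically zero, so f and its totalised inverse are both 0 wherever
      q is nonzero, and the fraction p/q represents either.\<close>
    case False
    with p show ?thesis
      by (intro rational_functionI[of V p q]) auto
  qed
qed

lemma rational_function_divide:
  "rational_function V f \<Longrightarrow> rational_function V g \<Longrightarrow> rational_function V (\<lambda>x. f x / g x)"
  unfolding divide_inverse by (intro rational_function_mult rational_function_inverse)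

section \<open>Algebras of functions\<close>

text \<open>Determinants, adjugates and matrix products use only sums and products. One closure
  argument therefore serves polynomial functions, rational functions, functions smooth at a point,
  and polynomial-valued functions with polynomial coefficients.\<close>

locale function_algebra =
  fixes C :: "('p \<Rightarrow> 'a::comm_ring_1) \<Rightarrow> bool"
  assumes const: "C (\<lambda>x. c)"
    and add: "C f \<Longrightarrow> C g \<Longrightarrow> C (\<lambda>x. f x + g x)"
    and mult: "C f \<Longrightarrow> C g \<Longrightarrow> C (\<lambda>x. f x * g x)"
begin

lemma sum: "(\<And>i. i \<in> I \<Longrightarrow> C (f i)) \<Longrightarrow> C (\<lambda>x. \<Sum>i\<in>I. f i x)"
  by (induction I rule: infinite_finite_induct) (simp_all add: const add)

lemma prod: "(\<And>i. i \<in> I \<Longrightarrow> C (f i)) \<Longrightarrow> C (\<lambda>x. \<Prod>i\<in>I. f i x)"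
  by (induction I rule: infinite_finite_induct) (simp_all add: const mult)

lemma power: "C f \<Longrightarrow> C (\<lambda>x. f x ^ n)"
  by (induction n) (simp_all add: const mult)

lemma det:
  assumes "\<And>a b. a < q \<Longrightarrow> b < q \<Longrightarrow> C (\<lambda>x. F x a b)"
  shows "C (\<lambda>x. det (mat q q (\<lambda>(a, b). F x a b)))"
proof -
  have eq: "det (mat q q (\<lambda>(a, b). F x a b)) = (\<Sum>p\<in>{p. p permutes {0..<q}}.
      signof p * (\<Prod>i=0..<q. F x i (p i)))" for x
  proof -
    have "(\<Prod>i=0..<q. mat q q (\<lambda>(a, b). F x a b) $$ (i, p i)) = (\<Prod>i=0..<q. F x i (p i))"
      if "p permutes {0..<q}" for p
      using permutes_in_image[OF that] by (intro prod.cong) auto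
    then show ?thesis by (simp add: det_def)
  qed
  show ?thesis unfolding eq
  proof (intro sum mult prod const)
    fix p i assume p: "p \<in> {p. p permutes {0..<q}}" and i: "i \<in> {0..<q}"
    then have "p i < q" using permutes_in_image[of p "{0..<q}" i] by simp
    then show "C (\<lambda>x. F x i (p i))" using i assms by simp
  qed
qed

lemma det_mat:
  assumes "\<And>x. F x \<in> carrier_mat q q"
    and "\<And>a b. a < q \<Longrightarrow> b < q \<Longrightarrow> C (\<lambda>x. F x $$ (a, b))"
  shows "C (\<lambda>x. det (F x))"
proof -
  have "F x = mat q q (\<lambda>(a, b). F x $$ (a, b))" for x
    using assms(1)[of x] by (intro eq_matI) auto
  then have "(\<lambda>x. det (F x)) = (\<lambda>x. det (mat q q (\<lambda>(a, b). F x $$ (a, b))))" by metis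
  with det[of q "\<lambda>x a b. F x $$ (a, b)"] assms(2) show ?thesis by simp
qed

lemma adj_mat:
  assumes "\<And>x. F x \<in> carrier_mat q q"
    and "\<And>a b. a < q \<Longrightarrow> b < q \<Longrightarrow> C (\<lambda>x. F x $$ (a, b))"
    and "a < q" "b < q"
  shows "C (\<lambda>x. adj_mat (F x) $$ (a, b))"
proof -
  have d: "dim_row (F x) = q" "dim_col (F x) = q" for x using assms(1)[of x] by auto
  have eq: "adj_mat (F x) $$ (a, b) = (-1) ^ (b + a) * det (mat (q - 1) (q - 1) (\<lambda>(i', j').
      F x $$ (if i' < b then i' else Suc i', if j' < a then j' else Suc j')))" for x
    using assms(3,4) by (simp add: adj_mat_def d cofactor_def mat_delete_def)
  show ?thesis unfolding eq
    by (intro mult const det assms(2)) (use assms(3,4) in auto)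
qed

lemma mult_mat:
  assumes "\<And>x. F x \<in> carrier_mat q q" "\<And>x. G x \<in> carrier_mat q q"
    and "\<And>a b. a < q \<Longrightarrow> b < q \<Longrightarrow> C (\<lambda>x. F x $$ (a, b))"
    and "\<And>a b. a < q \<Longrightarrow> b < q \<Longrightarrow> C (\<lambda>x. G x $$ (a, b))"
    and "a < q" "b < q"
  shows "C (\<lambda>x. (F x * G x) $$ (a, b))"
proof -
  have d: "dim_row (F x) = q" "dim_col (F x) = q" "dim_row (G x) = q" "dim_col (G x) = q" for x
    using assms(1,2)[of x] by auto
  have eq: "(F x * G x) $$ (a, b) = (\<Sum>e=0..<q. F x $$ (a, e) * G x $$ (e, b))" for x
    using assms(5,6) by (simp add: scalar_prod_def d)
  show ?thesis unfolding eq by (intro sum mult assms) (use assms(5,6) in auto)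
qed

end

interpretation polyfun: function_algebra "polyfun V"
  by unfold_locales (simp_all add: polyfun_const polyfun_add polyfun_mult)

interpretation rational: function_algebra "rational_function V"
  by unfold_locales
    (simp_all add: rational_function_polyfun polyfun_const rational_function_add rational_function_mult)

text \<open>Makes the coefficients of the determinant of a matrix of linear polynomials polynomial
  in the entries; this yields the numerators of the Y_p.\<close>

interpretation poly_coeff: function_algebra
  "\<lambda>F. \<forall>i. polyfun V (\<lambda>x. coeff (F x :: complex poly) i)"
proof unfold_locales
  fix f g :: "('a \<Rightarrow> complex) \<Rightarrow> complex poly"
  assume f: "\<forall>i. polyfun V (\<lambda>x. coeff (f x) i)" and g: "\<forall>i. polyfun V (\<lambda>x. coeff (g x) i)"
  show "\<forall>i. polyfun V (\<lambda>x. coeff (f x * g x) i)"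
    unfolding coeff_mult by (intro allI polyfun.sum polyfun.mult f[rule_format] g[rule_format])
qed (simp_all add: polyfun_const polyfun_add)

section \<open>Differentiability at a point\<close>

text \<open>Gradients are defined by their effect on curves (Hadamard derivatives), because the type of
  points is a function space without a norm. This also yields the chain rule for free.\<close>

definition has_gradient ::
    "'v set \<Rightarrow> (('v \<Rightarrow> complex) \<Rightarrow> complex) \<Rightarrow> ('v \<Rightarrow> complex) \<Rightarrow> ('v \<Rightarrow> complex) \<Rightarrow> bool" where
  "has_gradient V f x g \<longleftrightarrow> (\<forall>\<gamma> \<gamma>'. \<gamma> 0 = x \<longrightarrow>
     (\<forall>u. ((\<lambda>t. \<gamma> t u) has_field_derivative \<gamma>' u) (at 0)) \<longrightarrow>
     ((\<lambda>t. f (\<gamma> t)) has_field_derivative (\<Sum>u\<in>V. g u * \<gamma>' u)) (at 0))"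

definition smooth_pt :: "'v set \<Rightarrow> ('v \<Rightarrow> complex) \<Rightarrow> (('v \<Rightarrow> complex) \<Rightarrow> complex) \<Rightarrow> bool" where
  "smooth_pt V x f \<longleftrightarrow> (\<exists>g. has_gradient V f x g)"

lemma has_gradientD:
  "has_gradient V f x g \<Longrightarrow> \<gamma> 0 = x \<Longrightarrow>
   (\<And>u. ((\<lambda>t. \<gamma> t u) has_field_derivative \<gamma>' u) (at 0)) \<Longrightarrow>
   ((\<lambda>t. f (\<gamma> t)) has_field_derivative (\<Sum>u\<in>V. g u * \<gamma>' u)) (at 0)"
  unfolding has_gradient_def by blast

lemma has_gradient_const: "has_gradient V (\<lambda>x. c) x (\<lambda>u. 0)"
  unfolding has_gradient_def by simp

lemma has_gradient_coord:
  assumes "finite V" "v \<in> V"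
  shows "has_gradient V (\<lambda>x. x v) x (\<lambda>u. if u = v then 1 else 0)"
proof -
  have "(\<Sum>u\<in>V. (if u = v then 1 else 0) * \<gamma>' u) = \<gamma>' v" for \<gamma>' :: "'a \<Rightarrow> complex"
  proof -
    have "(\<Sum>u\<in>V. (if u = v then 1 else 0) * \<gamma>' u) = (\<Sum>u\<in>V. if u = v then \<gamma>' u else 0)"
      by (intro sum.cong) auto
    then show ?thesis using assms by simp
  qed
  then show ?thesis unfolding has_gradient_def by simp
qed

lemma has_gradient_add:
  assumes "has_gradient V f x g" "has_gradient V f' x g'"
  shows "has_gradient V (\<lambda>x. f x + f' x) x (\<lambda>u. g u + g' u)"
  unfolding has_gradient_def
proof (intro allI impI)
  fix \<gamma> \<gamma>' assume g: "\<gamma> 0 = x" "\<forall>u. ((\<lambda>t. \<gamma> t u) has_field_derivative \<gamma>' u) (at 0)"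
  show "((\<lambda>t. f (\<gamma> t) + f' (\<gamma> t)) has_field_derivative (\<Sum>u\<in>V. (g u + g' u) * \<gamma>' u)) (at 0)"
    using DERIV_add[OF has_gradientD[OF assms(1) g(1) g(2)[rule_format]]
        has_gradientD[OF assms(2) g(1) g(2)[rule_format]]]
    by (simp add: distrib_right sum.distrib)
qed

lemma has_gradient_mult:
  assumes "has_gradient V f x g" "has_gradient V f' x g'"
  shows "has_gradient V (\<lambda>x. f x * f' x) x (\<lambda>u. f' x * g u + f x * g' u)"
  unfolding has_gradient_def
proof (intro allI impI)
  fix \<gamma> \<gamma>' assume g: "\<gamma> 0 = x" "\<forall>u. ((\<lambda>t. \<gamma> t u) has_field_derivative \<gamma>' u) (at 0)"
  show "((\<lambda>t. f (\<gamma> t) * f' (\<gamma> t)) has_field_derivative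
      (\<Sum>u\<in>V. (f' x * g u + f x * g' u) * \<gamma>' u)) (at 0)"
    using DERIV_mult[OF has_gradientD[OF assms(1) g(1) g(2)[rule_format]]
        has_gradientD[OF assms(2) g(1) g(2)[rule_format]]]
    by (simp add: algebra_simps sum.distrib g(1) sum_distrib_left sum_distrib_right)
qed

lemma has_gradient_inverse:
  assumes "has_gradient V f x g" "f x \<noteq> 0"
  shows "has_gradient V (\<lambda>x. inverse (f x)) x (\<lambda>u. - (inverse (f x) * inverse (f x)) * g u)"
  unfolding has_gradient_def
proof (intro allI impI)
  fix \<gamma> \<gamma>' assume g: "\<gamma> 0 = x" "\<forall>u. ((\<lambda>t. \<gamma> t u) has_field_derivative \<gamma>' u) (at 0)"
  have "(\<Sum>u\<in>V. - (inverse (f x) * inverse (f x)) * g u * \<gamma>' u)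
      = - (inverse (f x) * (\<Sum>u\<in>V. g u * \<gamma>' u) * inverse (f x))"
    by (simp add: sum_distrib_left sum_distrib_right sum_negf mult_ac)
  moreover have "f (\<gamma> 0) \<noteq> 0" using assms(2) g(1) by simp
  note DERIV_inverse'[OF has_gradientD[OF assms(1) g(1) g(2)[rule_format]] this]
  ultimately show "((\<lambda>t. inverse (f (\<gamma> t))) has_field_derivative
      (\<Sum>u\<in>V. - (inverse (f x) * inverse (f x)) * g u * \<gamma>' u)) (at 0)"
    by (simp only: g(1))
qed

text \<open>Along each curve d is continuous, hence nonzero for small parameters, where h and f
  agree. In this way default values off the domain of d do not affect derivatives, without any
  topology on the space of points.\<close>

lemma has_gradient_cong:
  assumes "has_gradient V f x g" "has_gradient V d x g'" "d x \<noteq> 0"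
    and "\<And>y. d y \<noteq> 0 \<Longrightarrow> h y = f y"
  shows "has_gradient V h x g"
  unfolding has_gradient_def
proof (intro allI impI)
  fix \<gamma> \<gamma>' assume g: "\<gamma> 0 = x" "\<forall>u. ((\<lambda>t. \<gamma> t u) has_field_derivative \<gamma>' u) (at 0)"
  have "isCont (\<lambda>t. d (\<gamma> t)) 0"
    by (rule DERIV_isCont[OF has_gradientD[OF assms(2) g(1) g(2)[rule_format]]])
  then have "((\<lambda>t. d (\<gamma> t)) \<longlongrightarrow> d (\<gamma> 0)) (nhds 0)"
    unfolding isCont_def by (rule tendsto_at_iff_tendsto_nhds[of "\<lambda>t. d (\<gamma> t)", THEN iffD1])
  then have "eventually (\<lambda>t. d (\<gamma> t) \<noteq> 0) (nhds 0)"
    using assms(3) g(1) by (intro tendsto_imp_eventually_ne) auto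
  then have ev: "eventually (\<lambda>t. h (\<gamma> t) = f (\<gamma> t)) (nhds 0)"
    by (rule eventually_mono) (rule assms(4))
  show "((\<lambda>t. h (\<gamma> t)) has_field_derivative (\<Sum>u\<in>V. g u * \<gamma>' u)) (at 0)"
    using DERIV_cong_ev[OF refl ev refl] has_gradientD[OF assms(1) g(1) g(2)[rule_format]] by simp
qed

lemma smooth_ptI: "has_gradient V f x g \<Longrightarrow> smooth_pt V x f"
  unfolding smooth_pt_def by (rule exI)

lemma smooth_ptE:
  assumes "smooth_pt V x f"
  obtains g where "has_gradient V f x g"
  using assms unfolding smooth_pt_def by (rule exE)

lemma smooth_pt_coord: "finite V \<Longrightarrow> v \<in> V \<Longrightarrow> smooth_pt V x (\<lambda>x. x v)"
  by (rule smooth_ptI, rule has_gradient_coord)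

lemma smooth_pt_inverse:
  assumes "smooth_pt V x f" "f x \<noteq> 0"
  shows "smooth_pt V x (\<lambda>x. inverse (f x))"
proof -
  obtain g where g: "has_gradient V f x g" using assms(1) by (rule smooth_ptE)
  from has_gradient_inverse[OF this, OF assms(2)] show ?thesis by (rule smooth_ptI)
qed

lemma smooth_pt_cong:
  assumes "smooth_pt V x f" "smooth_pt V x d" "d x \<noteq> 0" "\<And>y. d y \<noteq> 0 \<Longrightarrow> h y = f y"
  shows "smooth_pt V x h"
proof -
  obtain g where g: "has_gradient V f x g" using assms(1) by (rule smooth_ptE)
  obtain g' where g': "has_gradient V d x g'" using assms(2) by (rule smooth_ptE)
  have "has_gradient V h x g"
    by (rule has_gradient_cong[OF g, OF g', OF assms(3)]) (rule assms(4))
  then show ?thesis by (rule smooth_ptI)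
qed

interpretation smooth: function_algebra "smooth_pt V x"
proof unfold_locales
  show "smooth_pt V x (\<lambda>x. c)" for c by (rule smooth_ptI, rule has_gradient_const)
  fix f g assume f: "smooth_pt V x f" and g: "smooth_pt V x g"
  obtain f' where f': "has_gradient V f x f'" using f by (rule smooth_ptE)
  obtain g' where g': "has_gradient V g x g'" using g by (rule smooth_ptE)
  show "smooth_pt V x (\<lambda>x. f x + g x)"
    by (rule smooth_ptI, rule has_gradient_add[OF f' g'])
  show "smooth_pt V x (\<lambda>x. f x * g x)"
    by (rule smooth_ptI, rule has_gradient_mult[OF f' g'])
qed

lemma smooth_pt_divide:
  assumes "smooth_pt V x f" "smooth_pt V x g" "g x \<noteq> 0"
  shows "smooth_pt V x (\<lambda>x. f x / g x)"
  using smooth.mult[OF assms(1) smooth_pt_inverse[OF assms(2), OF assms(3)]] by (simp add: divide_inverse)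

lemma smooth_pt_polyfun:
  assumes "finite V" "polyfun V f"
  shows "smooth_pt V x f"
proof -
  obtain Q where Q: "cpoly_vars Q \<subseteq> V" "f = cpoly_eval Q"
    using assms(2) unfolding polyfun_def by auto
  have "cpoly_eval Q = (\<lambda>x. \<Sum>m\<in>Poly_Mapping.keys Q. Poly_Mapping.lookup Q m *
      (\<Prod>v\<in>Poly_Mapping.keys m. x v ^ Poly_Mapping.lookup m v))"
    by (simp add: cpoly_eval_def fun_eq_iff)
  moreover have "smooth_pt V x \<dots>"
  proof (intro smooth.sum smooth.mult smooth.const smooth.prod smooth.power smooth_pt_coord assms(1))
    fix m v assume "m \<in> Poly_Mapping.keys Q" "v \<in> Poly_Mapping.keys m"
    then show "v \<in> V" using Q(1) by (auto simp: cpoly_vars_def)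
  qed
  ultimately show ?thesis using Q(2) by simp
qed

text \<open>The coordinate line is one of the admissible curves, so the curve-based gradient yields
  the partial derivatives that occur in the Poisson bracket.\<close>

lemma has_gradient_partial_deriv:
  assumes "finite V" "v \<in> V" "has_gradient V f x g"
  shows "partial_deriv v f x = g v"
proof -
  define \<gamma> where "\<gamma> t = x(v := x v + t)" for t
  have "((\<lambda>t. f (\<gamma> t)) has_field_derivative (\<Sum>u\<in>V. g u * (if u = v then 1 else 0))) (at 0)"
  proof (rule has_gradientD[OF assms(3)])
    show "\<gamma> 0 = x" by (simp add: \<gamma>_def)
    show "((\<lambda>t. \<gamma> t u) has_field_derivative (if u = v then 1 else 0)) (at 0)" for u
      by (auto simp: \<gamma>_def intro!: derivative_eq_intros)
  qed
  moreover have "(\<Sum>u\<in>V. g u * (if u = v then 1 else 0)) = (\<Sum>u\<in>V. if u = v then g u else 0)"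
    by (intro sum.cong) auto
  ultimately have "((\<lambda>t. f (x(v := t + x v))) has_field_derivative g v) (at 0)"
    using assms(1,2) by (simp add: \<gamma>_def add.commute)
  then have "((\<lambda>t. f (x(v := t))) has_field_derivative g v) (at (0 + x v))"
    by (subst DERIV_shift) simp
  then show ?thesis unfolding partial_deriv_def by (simp add: DERIV_imp_deriv)
qed

section \<open>Inverses and the matrices \<open>S\<close>\<close>

lemma mat_inverse_nonsingular:
  fixes A :: "complex mat"
  assumes "A \<in> carrier_mat n n" "det A \<noteq> 0"
  shows "the (mat_inverse A) = inverse (det A) \<cdot>\<^sub>m adj_mat A"
    and "the (mat_inverse A) \<in> carrier_mat n n"
    and "A * the (mat_inverse A) = 1\<^sub>m n"
    and "the (mat_inverse A) * A = 1\<^sub>m n"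
proof -
  obtain B where B: "mat_inverse A = Some B"
    using mat_inverse(1)[OF assms(1)] det_non_zero_imp_unit[OF assms] by fastforce
  from mat_inverse(2)[OF assms(1) B] have AB: "A * B = 1\<^sub>m n" "B * A = 1\<^sub>m n" "B \<in> carrier_mat n n"
    by auto
  then show "the (mat_inverse A) \<in> carrier_mat n n" "A * the (mat_inverse A) = 1\<^sub>m n"
    "the (mat_inverse A) * A = 1\<^sub>m n" by (simp_all add: B)
  note adj = adj_mat[OF assms(1)]
  have "B = B * (A * (inverse (det A) \<cdot>\<^sub>m adj_mat A))"
  proof -
    have "A * (inverse (det A) \<cdot>\<^sub>m adj_mat A) = 1\<^sub>m n"
      using assms(2) by (simp add: mult_smult_distrib[OF assms(1) adj(1)] adj(2))
        auto
    then show ?thesis using AB by simp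
  qed
  also have "\<dots> = (B * A) * (inverse (det A) \<cdot>\<^sub>m adj_mat A)"
    using assoc_mult_mat[OF AB(3) assms(1), of "inverse (det A) \<cdot>\<^sub>m adj_mat A" n] adj(1) by simp
  also have "\<dots> = inverse (det A) \<cdot>\<^sub>m adj_mat A"
    using adj AB by (simp add: left_mult_one_mat[of _ n n])
  finally show "the (mat_inverse A) = inverse (det A) \<cdot>\<^sub>m adj_mat A" by (simp add: B)
qed

lemma chain_mat_carrier [simp]: "chain_mat N x k \<in> carrier_mat N N"
  by (simp add: chain_mat_def)

lemma chain_mat_dim [simp]: "dim_row (chain_mat N x k) = N" "dim_col (chain_mat N x k) = N"
  by (simp_all add: chain_mat_def)

lemma chain_mat_index [simp]: "a < N \<Longrightarrow> b < N \<Longrightarrow> chain_mat N x k $$ (a, b) = x (k, a, b)"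
  by (simp add: chain_mat_def)

text \<open>\<open>S_chain\<close> with the inverses spelled out, so that its entries are visibly rational.\<close>

fun S_adj :: "nat \<Rightarrow> point \<Rightarrow> nat \<Rightarrow> complex mat" where
  "S_adj N x 0 = transpose_mat (chain_mat N x 0)"
| "S_adj N x (Suc k) = S_adj N x k *
     (if odd (Suc k) then inverse (det (chain_mat N x (Suc k))) \<cdot>\<^sub>m adj_mat (chain_mat N x (Suc k))
      else transpose_mat (chain_mat N x (Suc k)))"

lemma S_adj_carrier [simp]: "S_adj N x k \<in> carrier_mat N N"
  by (induction k) (auto intro!: mult_carrier_mat[of _ N N] smult_carrier_mat adj_mat(1)[OF chain_mat_carrier])

lemma S_chain_eq_S_adj:
  assumes "\<And>k. k \<in> {1..j} \<Longrightarrow> det (chain_mat N x k) \<noteq> 0"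
  shows "S_chain N x j = S_adj N x j"
  using assms
proof (induction j)
  case 0
  then show ?case by simp
next
  case (Suc j)
  have "S_chain N x j = S_adj N x j" by (rule Suc.IH) (rule Suc.prems, simp)
  moreover have "det (chain_mat N x (Suc j)) \<noteq> 0" by (rule Suc.prems) simp
  ultimately show ?case by (simp add: mat_inverse_nonsingular(1)[OF chain_mat_carrier])
qed

text \<open>The inverse determinants form a separate hypothesis because a function algebra need not
  be closed under inversion: rational functions always contain them, smooth functions only at
  nonsingular points.\<close>

lemma S_adj_entry_closed:
  assumes "function_algebra C"
    and "\<And>k a b. k \<le> j \<Longrightarrow> a < N \<Longrightarrow> b < N \<Longrightarrow> C (\<lambda>x. x (k, a, b))"
    and "\<And>k. k \<in> {1..j} \<Longrightarrow> C (\<lambda>x. inverse (det (chain_mat N x k)))"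
    and "a < N" "b < N"
  shows "C (\<lambda>x. S_adj N x j $$ (a, b))"
proof -
  interpret function_algebra C by (rule assms(1))
  show ?thesis
    using assms(2-)
  proof (induction j arbitrary: a b)
    case 0
    then show ?case by simp
  next
    case (Suc j)
    have ent: "C (\<lambda>x. chain_mat N x (Suc j) $$ (a, b))" if "a < N" "b < N" for a b
      using Suc.prems(1)[of "Suc j" a b] that by simp
    show ?case
    proof (cases "even j")
      case True
      have *: "C (\<lambda>x. (S_adj N x j * (inverse (det (chain_mat N x (Suc j)))
          \<cdot>\<^sub>m adj_mat (chain_mat N x (Suc j)))) $$ (a, b))"
      proof (rule mult_mat)
        fix c d assume cd: "c < N" "d < N"
        show "C (\<lambda>x. S_adj N x j $$ (c, d))"
          using Suc.IH[OF _ _ cd] Suc.prems by simp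
        have "C (\<lambda>x. inverse (det (chain_mat N x (Suc j)))
            * adj_mat (chain_mat N x (Suc j)) $$ (c, d))"
          using Suc.prems(2)[of "Suc j"]
          by (intro mult adj_mat[OF chain_mat_carrier] ent cd) simp
        then show "C (\<lambda>x. (inverse (det (chain_mat N x (Suc j)))
            \<cdot>\<^sub>m adj_mat (chain_mat N x (Suc j))) $$ (c, d))"
          using cd by (simp add: adj_mat_def)
      qed (use Suc.prems Determinant.adj_mat(1)[OF chain_mat_carrier] in auto)
      with True show ?thesis by simp
    next
      case False
      have *: "C (\<lambda>x. (S_adj N x j * transpose_mat (chain_mat N x (Suc j))) $$ (a, b))"
      proof (rule mult_mat)
        fix c d assume cd: "c < N" "d < N"
        show "C (\<lambda>x. S_adj N x j $$ (c, d))"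
          using Suc.IH[OF _ _ cd] Suc.prems by simp
        show "C (\<lambda>x. transpose_mat (chain_mat N x (Suc j)) $$ (c, d))"
          using ent[of d c] cd by simp
      qed (use Suc.prems in auto)
      with False show ?thesis by simp
    qed
  qed
qed

lemma det_chain_mat_closed:
  assumes "function_algebra C" "\<And>a b. a < N \<Longrightarrow> b < N \<Longrightarrow> C (\<lambda>x. x (k, a, b))"
  shows "C (\<lambda>x. det (chain_mat N x k))"
  by (rule function_algebra.det_mat[OF assms(1), of _ N]) (simp_all add: assms(2))

lemma upper_right_minor_closed:
  assumes "function_algebra C" "\<And>x. F x \<in> carrier_mat N N" "q \<le> N"
    and "\<And>a b. a < N \<Longrightarrow> b < N \<Longrightarrow> C (\<lambda>x. F x $$ (a, b))"
  shows "C (\<lambda>x. upper_right_minor q (F x))"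
proof -
  have d: "dim_col (F x) = N" for x using assms(2)[of x] by simp
  show ?thesis unfolding upper_right_minor_def d
    by (rule function_algebra.det[OF assms(1)]) (use assms in simp)
qed

lemma upper_left_minor_closed:
  assumes "function_algebra C" "q \<le> N"
    and "\<And>a b. a < N \<Longrightarrow> b < N \<Longrightarrow> C (\<lambda>x. F x $$ (a, b))"
  shows "C (\<lambda>x. upper_left_minor q (F x))"
  unfolding upper_left_minor_def
  by (rule function_algebra.det[OF assms(1)], rule assms(3)) (use assms(2) in simp_all)

section \<open>Rationality and smoothness of the entries of S\<close>

lemma finite_coords [simp]: "finite (coords N j)"
  by (simp add: coords_def)

lemma mem_coords [simp]: "(k, a, b) \<in> coords N j \<longleftrightarrow> k \<le> j \<and> a < N \<and> b < N"
  by (auto simp: coords_def)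

lemma generically_chain_nonsingular:
  "generically (coords N j) (\<lambda>x. \<forall>k\<in>{0..j}. det (chain_mat N x k) \<noteq> 0)"
proof (rule generically_Ball)
  fix k assume k: "k \<in> {0..j}"
  let ?x = "\<lambda>(k, a, b). if a = b then 1 else 0 :: complex"
  have "chain_mat N ?x k = 1\<^sub>m N"
    by (rule eq_matI) auto
  then have "det (chain_mat N ?x k) \<noteq> 0" by simp
  moreover have "polyfun (coords N j) (\<lambda>x. det (chain_mat N x k))"
    by (rule det_chain_mat_closed[OF polyfun.function_algebra_axioms])
       (use k in \<open>simp add: polyfun_coord\<close>)
  ultimately show "generically (coords N j) (\<lambda>x. det (chain_mat N x k) \<noteq> 0)"
    by (intro polyfun_generically_nonzero[of _ _ ?x])
qed simp

lemma rational_S_chain_entry: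
  assumes "a < N" "b < N"
  shows "rational_function (coords N j) (\<lambda>x. S_chain N x j $$ (a, b))"
proof (rule rational_function_cong)
  show "rational_function (coords N j) (\<lambda>x. S_adj N x j $$ (a, b))"
    by (intro S_adj_entry_closed[OF rational.function_algebra_axioms] rational_function_inverse
        det_chain_mat_closed[OF rational.function_algebra_axioms] assms)
       (simp_all add: rational_function_polyfun polyfun_coord)
  show "generically (coords N j) (\<lambda>x. S_chain N x j $$ (a, b) = S_adj N x j $$ (a, b))"
  proof (rule generically_mono[OF generically_chain_nonsingular])
    fix x assume "\<forall>k\<in>{0..j}. det (chain_mat N x k) \<noteq> 0"
    then have "S_chain N x j = S_adj N x j" by (intro S_chain_eq_S_adj) auto
    then show "S_chain N x j $$ (a, b) = S_adj N x j $$ (a, b)" by simp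
  qed
qed

lemma smooth_S_chain_entry:
  assumes "a < N" "b < N" and ns: "\<And>k. k \<in> {1..j} \<Longrightarrow> det (chain_mat N x k) \<noteq> 0"
  shows "smooth_pt (coords N j) x (\<lambda>x. S_chain N x j $$ (a, b))"
proof -
  define d where "d y = (\<Prod>k=1..j. det (chain_mat N y k))" for y
  have "smooth_pt (coords N j) x (\<lambda>x. det (chain_mat N x k))" if "k \<le> j" for k
    by (rule det_chain_mat_closed[OF smooth.function_algebra_axioms])
       (use that in \<open>simp add: smooth_pt_coord\<close>)
  note det = this
  have d: "smooth_pt (coords N j) x d"
    unfolding d_def by (rule smooth.prod) (simp add: det)
  have S: "smooth_pt (coords N j) x (\<lambda>x. S_adj N x j $$ (a, b))"
  proof (rule S_adj_entry_closed[OF smooth.function_algebra_axioms])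
    show "smooth_pt (coords N j) x (\<lambda>x. inverse (det (chain_mat N x k)))" if "k \<in> {1..j}" for k
      using smooth_pt_inverse[OF det[of k]] ns[OF that] that by simp
  qed (simp_all add: smooth_pt_coord assms(1,2))
  have dx: "d x \<noteq> 0" using ns by (simp add: d_def)
  have eq: "S_chain N y j $$ (a, b) = S_adj N y j $$ (a, b)" if y: "d y \<noteq> 0" for y
  proof -
    have "det (chain_mat N y k) \<noteq> 0" if k: "k \<in> {1..j}" for k
      using y k by (simp add: d_def)
    then have "S_chain N y j = S_adj N y j" by (rule S_chain_eq_S_adj)
    then show ?thesis by simp
  qed
  show ?thesis
    by (rule smooth_pt_cong[OF S, OF d, OF dx]) (rule eq)
qed

section \<open>Derivatives of minors\<close>

definition mat_deriv :: "nat \<Rightarrow> (complex \<Rightarrow> complex mat) \<Rightarrow> complex mat \<Rightarrow> bool" where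
  "mat_deriv n F D \<longleftrightarrow>
    (\<forall>a<n. \<forall>b<n. ((\<lambda>t. F t $$ (a, b)) has_field_derivative D $$ (a, b)) (at 0))"

lemma mat_derivD:
  "mat_deriv n F D \<Longrightarrow> a < n \<Longrightarrow> b < n \<Longrightarrow>
    ((\<lambda>t. F t $$ (a, b)) has_field_derivative D $$ (a, b)) (at 0)"
  by (simp add: mat_deriv_def)

definition lower_tri :: "nat \<Rightarrow> complex mat \<Rightarrow> bool" where
  "lower_tri n A \<longleftrightarrow> A \<in> carrier_mat n n \<and> (\<forall>a b. a < b \<longrightarrow> b < n \<longrightarrow> A $$ (a, b) = 0)"

definition upper_tri :: "nat \<Rightarrow> complex mat \<Rightarrow> bool" where
  "upper_tri n A \<longleftrightarrow> A \<in> carrier_mat n n \<and> (\<forall>a b. b < a \<longrightarrow> a < n \<longrightarrow> A $$ (a, b) = 0)"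

lemma upper_tri_iff: "upper_tri n A \<longleftrightarrow> lower_tri n (transpose_mat A)"
  by (auto simp: upper_tri_def lower_tri_def)

lemma det_lower_tri:
  assumes "lower_tri n A"
  shows "det A = (\<Prod>i<n. A $$ (i, i))"
proof -
  have A: "A \<in> carrier_mat n n" and l: "\<And>a b. a < b \<Longrightarrow> b < n \<Longrightarrow> A $$ (a, b) = 0"
    using assms by (auto simp: lower_tri_def)
  have "det A = prod_list (diag_mat A)" by (rule det_lower_triangular[OF l A])
  also have "\<dots> = (\<Prod>i<n. A $$ (i, i))"
    using A prod.list_conv_set_nth[of "diag_mat A"]
    by (simp add: diag_mat_def atLeast0LessThan)
  finally show ?thesis .
qed

lemma det_one_plus_lower_deriv:
  assumes "lower_tri n A"
  shows "((\<lambda>t. det (1\<^sub>m n + t \<cdot>\<^sub>m A)) has_field_derivative (\<Sum>i<n. A $$ (i, i))) (at 0)"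
proof -
  have A: "A \<in> carrier_mat n n" using assms by (simp add: lower_tri_def)
  have "lower_tri n (1\<^sub>m n + t \<cdot>\<^sub>m A)" for t
    using assms by (auto simp: lower_tri_def)
  then have eq: "(\<lambda>t. det (1\<^sub>m n + t \<cdot>\<^sub>m A)) = (\<lambda>t. \<Prod>i<n. 1 + t * A $$ (i, i))"
  proof (intro ext)
    fix t
    show "det (1\<^sub>m n + t \<cdot>\<^sub>m A) = (\<Prod>i<n. 1 + t * A $$ (i, i))"
      using det_lower_tri[of n "1\<^sub>m n + t \<cdot>\<^sub>m A"] \<open>\<And>t. lower_tri n (1\<^sub>m n + t \<cdot>\<^sub>m A)\<close> A by simp
  qed
  have "((\<lambda>t. \<Prod>i<m. 1 + t * A $$ (i, i)) has_field_derivative (\<Sum>i<m. A $$ (i, i))) (at 0)" for m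
  proof (induction m)
    case (Suc m)
    have "((\<lambda>t. 1 + t * A $$ (m, m)) has_field_derivative A $$ (m, m)) (at 0)"
      by (auto intro!: derivative_eq_intros)
    from DERIV_mult[OF Suc.IH this] show ?case by (simp add: add.commute)
  qed simp
  then show ?thesis unfolding eq .
qed

lemma det_one_plus_upper_deriv:
  assumes "upper_tri n A"
  shows "((\<lambda>t. det (1\<^sub>m n + t \<cdot>\<^sub>m A)) has_field_derivative (\<Sum>i<n. A $$ (i, i))) (at 0)"
proof -
  have A: "A \<in> carrier_mat n n" using assms by (simp add: upper_tri_def)
  have "det (1\<^sub>m n + t \<cdot>\<^sub>m transpose_mat A) = det (1\<^sub>m n + t \<cdot>\<^sub>m A)" for t
  proof -
    have "1\<^sub>m n + t \<cdot>\<^sub>m transpose_mat A = transpose_mat (1\<^sub>m n + t \<cdot>\<^sub>m A)"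
      using A by (intro eq_matI) auto
    then show ?thesis using det_transpose[of "1\<^sub>m n + t \<cdot>\<^sub>m A" n] A by simp
  qed
  moreover have "(\<Sum>i<n. transpose_mat A $$ (i, i)) = (\<Sum>i<n. A $$ (i, i))"
    using A by (intro sum.cong) auto
  ultimately show ?thesis
    using det_one_plus_lower_deriv[of n "transpose_mat A"] assms by (simp add: upper_tri_iff)
qed

text \<open>The determinant has a gradient as a function of the entries, so its derivative along a
  curve depends only on the point and the velocity; \<open>G\<close> is a convenient curve tangent
  to \<open>F\<close>.\<close>

lemma det_deriv_unique:
  fixes F G :: "complex \<Rightarrow> nat \<Rightarrow> nat \<Rightarrow> complex"
  assumes "\<And>a b. a < q \<Longrightarrow> b < q \<Longrightarrow> ((\<lambda>t. F t a b) has_field_derivative D a b) (at 0)"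
    and "\<And>a b. a < q \<Longrightarrow> b < q \<Longrightarrow> ((\<lambda>t. G t a b) has_field_derivative D a b) (at 0)"
    and "\<And>a b. a < q \<Longrightarrow> b < q \<Longrightarrow> F 0 a b = G 0 a b"
    and "((\<lambda>t. det (mat q q (\<lambda>(a, b). G t a b))) has_field_derivative d) (at 0)"
  shows "((\<lambda>t. det (mat q q (\<lambda>(a, b). F t a b))) has_field_derivative d) (at 0)"
proof -
  define V where "V = {..<q} \<times> {..<q}"
  define f where "f x = det (mat q q (\<lambda>(a, b). x (a, b)))" for x :: "nat \<times> nat \<Rightarrow> complex"
  define \<gamma> where "\<gamma> H t u = (case u of (a, b) \<Rightarrow> if a < q \<and> b < q then H t a b else 0)"
    for H :: "complex \<Rightarrow> nat \<Rightarrow> nat \<Rightarrow> complex" and t u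
  have "smooth_pt V (\<gamma> F 0) f"
    unfolding f_def
  proof (rule smooth.det)
    show "smooth_pt V (\<gamma> F 0) (\<lambda>x. x (a, b))" if "a < q" "b < q" for a b
      using that by (intro smooth_pt_coord) (auto simp: V_def)
  qed
  then obtain g where g: "has_gradient V f (\<gamma> F 0) g" by (rule smooth_ptE)
  have eq: "\<gamma> G 0 = \<gamma> F 0" using assms(3) by (auto simp: \<gamma>_def fun_eq_iff)
  define s where "s = (\<Sum>u\<in>V. g u * (case u of (a, b) \<Rightarrow> if a < q \<and> b < q then D a b else 0))"
  have det: "f (\<gamma> H t) = det (mat q q (\<lambda>(a, b). H t a b))" for H t
    unfolding f_def by (intro arg_cong[of _ _ det] eq_matI) (auto simp: \<gamma>_def)
  have "((\<lambda>t. f (\<gamma> H t)) has_field_derivative s) (at 0)"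
    if H: "\<And>a b. a < q \<Longrightarrow> b < q \<Longrightarrow> ((\<lambda>t. H t a b) has_field_derivative D a b) (at 0)"
      and H0: "\<gamma> H 0 = \<gamma> F 0" for H
    unfolding s_def
  proof (rule has_gradientD[OF g, of "\<gamma> H"])
    show "\<gamma> H 0 = \<gamma> F 0" by (rule H0)
    fix u :: "nat \<times> nat"
    obtain a b where u: "u = (a, b)" by (cases u)
    show "((\<lambda>t. \<gamma> H t u) has_field_derivative
        (case u of (a, b) \<Rightarrow> if a < q \<and> b < q then D a b else 0)) (at 0)"
      using H[of a b] by (cases "a < q \<and> b < q") (simp_all add: u \<gamma>_def if_not_P del: de_Morgan_conj)
  qed
  from this[OF assms(1) refl] this[OF assms(2) eq] assms(4) show ?thesis
    unfolding det using DERIV_unique by blast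
qed

text \<open>The tangent curve (1 + tT) M (1 + tR) has a determinant that factors, so the derivative
  is read off by the product rule, also when det M = 0.\<close>

lemma det_deriv_mult:
  fixes F :: "complex \<Rightarrow> nat \<Rightarrow> nat \<Rightarrow> complex"
  assumes M: "M \<in> carrier_mat q q" and T: "T \<in> carrier_mat q q" and R: "R \<in> carrier_mat q q"
    and "\<And>a b. a < q \<Longrightarrow> b < q \<Longrightarrow>
      ((\<lambda>t. F t a b) has_field_derivative (T * M + M * R) $$ (a, b)) (at 0)"
    and "\<And>a b. a < q \<Longrightarrow> b < q \<Longrightarrow> F 0 a b = M $$ (a, b)"
    and dT: "((\<lambda>t. det (1\<^sub>m q + t \<cdot>\<^sub>m T)) has_field_derivative \<tau>) (at 0)"
    and dR: "((\<lambda>t. det (1\<^sub>m q + t \<cdot>\<^sub>m R)) has_field_derivative \<rho>) (at 0)"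
  shows "((\<lambda>t. det (mat q q (\<lambda>(a, b). F t a b))) has_field_derivative (\<tau> + \<rho>) * det M) (at 0)"
proof -
  define G where "G t = (1\<^sub>m q + t \<cdot>\<^sub>m T) * M * (1\<^sub>m q + t \<cdot>\<^sub>m R)" for t
  have c: "1\<^sub>m q + t \<cdot>\<^sub>m T \<in> carrier_mat q q" "1\<^sub>m q + t \<cdot>\<^sub>m R \<in> carrier_mat q q"
      "(1\<^sub>m q + t \<cdot>\<^sub>m T) * M \<in> carrier_mat q q" "G t \<in> carrier_mat q q" for t
    using T R M by (auto simp: G_def)
  have G: "G t = M + t \<cdot>\<^sub>m (T * M + M * R) + (t * t) \<cdot>\<^sub>m (T * M * R)" for t
  proof -
    have TM: "T * M \<in> carrier_mat q q" using T M by simp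
    have regroup: "(A + t \<cdot>\<^sub>m B) + t \<cdot>\<^sub>m (C + t \<cdot>\<^sub>m D) = A + t \<cdot>\<^sub>m (B + C) + (t * t) \<cdot>\<^sub>m D"
      if "A \<in> carrier_mat q q" "B \<in> carrier_mat q q" "C \<in> carrier_mat q q" "D \<in> carrier_mat q q"
      for A B C D :: "complex mat"
      using that by (intro eq_matI) (auto simp: algebra_simps)
    have "(1\<^sub>m q + t \<cdot>\<^sub>m T) * M = M + t \<cdot>\<^sub>m (T * M)"
      using T M by (simp add: add_mult_distrib_mat[of _ q q _ _ q] mult_smult_assoc_mat[of _ q q _ q])
    then have "G t = (M + t \<cdot>\<^sub>m (T * M)) * (1\<^sub>m q + t \<cdot>\<^sub>m R)" by (simp add: G_def)
    also have "\<dots> = (M + t \<cdot>\<^sub>m (T * M)) + t \<cdot>\<^sub>m ((M + t \<cdot>\<^sub>m (T * M)) * R)"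
      using M TM R
      by (simp add: mult_add_distrib_mat[of _ q q _ q] mult_smult_distrib[of _ q q _ q])
    also have "(M + t \<cdot>\<^sub>m (T * M)) * R = M * R + t \<cdot>\<^sub>m (T * M * R)"
      using M TM R
      by (simp add: add_mult_distrib_mat[of _ q q _ _ q] mult_smult_assoc_mat[of _ q q _ q])
    also have "(M + t \<cdot>\<^sub>m (T * M)) + t \<cdot>\<^sub>m (M * R + t \<cdot>\<^sub>m (T * M * R))
        = M + t \<cdot>\<^sub>m (T * M + M * R) + (t * t) \<cdot>\<^sub>m (T * M * R)"
      using regroup[OF M TM mult_carrier_mat[OF M R] mult_carrier_mat[OF TM R]] .
    finally show ?thesis .
  qed
  have dG: "((\<lambda>t. G t $$ (a, b)) has_field_derivative (T * M + M * R) $$ (a, b)) (at 0)"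
    if ab: "a < q" "b < q" for a b
  proof -
    define d e where "d = (T * M + M * R) $$ (a, b)" and "e = (T * M * R) $$ (a, b)"
    have "G t $$ (a, b) = M $$ (a, b) + t * d + t * t * e" for t
      unfolding G d_def e_def using ab M T R by simp
    then have "(\<lambda>t. G t $$ (a, b)) = (\<lambda>t. M $$ (a, b) + t * d + t * t * e)" by auto
    then show ?thesis
      by (auto intro!: derivative_eq_intros simp: d_def[symmetric])
  qed
  have detG: "det (mat q q (\<lambda>(a, b). G t $$ (a, b)))
      = det (1\<^sub>m q + t \<cdot>\<^sub>m T) * det M * det (1\<^sub>m q + t \<cdot>\<^sub>m R)" for t
  proof -
    have "mat q q (\<lambda>(a, b). G t $$ (a, b)) = G t" using c(4)[of t] by (intro eq_matI) auto
    then show ?thesis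
      using det_mult[OF c(3)[of t] c(2)[of t]] det_mult[OF c(1)[of t] M] by (simp add: G_def)
  qed
  have one: "det (1\<^sub>m q + 0 \<cdot>\<^sub>m T) = 1" "det (1\<^sub>m q + 0 \<cdot>\<^sub>m R) = 1"
  proof -
    have "1\<^sub>m q + 0 \<cdot>\<^sub>m T = 1\<^sub>m q" "1\<^sub>m q + 0 \<cdot>\<^sub>m R = 1\<^sub>m q" using T R by auto
    then show "det (1\<^sub>m q + 0 \<cdot>\<^sub>m T) = 1" "det (1\<^sub>m q + 0 \<cdot>\<^sub>m R) = 1" by simp_all
  qed
  have "((\<lambda>t. det (1\<^sub>m q + t \<cdot>\<^sub>m T) * det M * det (1\<^sub>m q + t \<cdot>\<^sub>m R))
      has_field_derivative (\<tau> + \<rho>) * det M) (at 0)"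
    using DERIV_mult[OF DERIV_cmult_right[OF dT, of "det M"] dR] by (simp add: one algebra_simps)
  then have detG': "((\<lambda>t. det (mat q q (\<lambda>(a, b). G t $$ (a, b))))
      has_field_derivative (\<tau> + \<rho>) * det M) (at 0)"
    by (simp only: detG)
  have F0: "F 0 a b = G 0 $$ (a, b)" if "a < q" "b < q" for a b
    unfolding G using assms(5)[OF that] that M T R by simp
  show ?thesis
    by (rule det_deriv_unique[where G = "\<lambda>t a b. G t $$ (a, b)" and
          D = "\<lambda>a b. (T * M + M * R) $$ (a, b)"]) (fact assms(4) dG F0 detG')+
qed

lemma mult_mat_index:
  assumes "A \<in> carrier_mat n n" "B \<in> carrier_mat n n" "a < n" "b < n"
  shows "(A * B) $$ (a, b) = (\<Sum>e<n. A $$ (a, e) * B $$ (e, b))"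
  using assms by (simp add: scalar_prod_def atLeast0LessThan)

text \<open>Lower triangularity of X expresses the first q rows of X F through the first q rows of
  F, and lower triangularity of Y expresses the last q columns of F Y through the last q columns of
  F. The corner block thus evolves on its own as T M + M R, and its determinant scales by the traces
  of the diagonal blocks T and R.\<close>

lemma upper_right_minor_deriv:
  assumes F: "\<And>t. F t \<in> carrier_mat N N" and X: "lower_tri N X" and Y: "lower_tri N Y"
    and q: "q \<le> N" and d: "mat_deriv N F (X * F 0 + F 0 * Y)"
  shows "((\<lambda>t. upper_right_minor q (F t)) has_field_derivative
    ((\<Sum>i<q. X $$ (i, i)) + (\<Sum>i=N-q..<N. Y $$ (i, i))) * upper_right_minor q (F 0)) (at 0)"
proof -
  define M where "M = mat q q (\<lambda>(a, b). F 0 $$ (a, N - q + b))"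
  define T where "T = mat q q (\<lambda>(a, b). X $$ (a, b))"
  define R where "R = mat q q (\<lambda>(a, b). Y $$ (N - q + a, N - q + b))"
  have XY: "X \<in> carrier_mat N N" "Y \<in> carrier_mat N N"
      "\<And>a b. a < b \<Longrightarrow> b < N \<Longrightarrow> X $$ (a, b) = 0" "\<And>a b. a < b \<Longrightarrow> b < N \<Longrightarrow> Y $$ (a, b) = 0"
    using X Y by (auto simp: lower_tri_def)
  have dim: "dim_col (F t) = N" for t using F[of t] by auto
  have minor: "upper_right_minor q (F t) = det (mat q q (\<lambda>(a, b). F t $$ (a, N - q + b)))" for t
    by (simp add: upper_right_minor_def dim)
  have entry: "(X * F 0 + F 0 * Y) $$ (a, N - q + b) = (T * M + M * R) $$ (a, b)"
    if ab: "a < q" "b < q" for a b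
  proof -
    have "(X * F 0) $$ (a, N - q + b) = (\<Sum>e<N. X $$ (a, e) * F 0 $$ (e, N - q + b))"
      using ab q by (intro mult_mat_index XY F) auto
    also have "\<dots> = (\<Sum>e<q. X $$ (a, e) * F 0 $$ (e, N - q + b))"
      using ab q XY(3) by (intro sum.mono_neutral_right) auto
    also have "\<dots> = (T * M) $$ (a, b)"
      using ab by (simp add: scalar_prod_def atLeast0LessThan T_def M_def)
    finally have 1: "(X * F 0) $$ (a, N - q + b) = (T * M) $$ (a, b)" .
    have "(F 0 * Y) $$ (a, N - q + b) = (\<Sum>e<N. F 0 $$ (a, e) * Y $$ (e, N - q + b))"
      using ab q by (intro mult_mat_index XY F) auto
    also have "\<dots> = (\<Sum>e\<in>{N-q..<N}. F 0 $$ (a, e) * Y $$ (e, N - q + b))"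
      using ab q XY(4) by (intro sum.mono_neutral_right) auto
    also have "\<dots> = (\<Sum>e<q. F 0 $$ (a, N - q + e) * Y $$ (N - q + e, N - q + b))"
      using q by (intro sum.reindex_bij_witness[of _ "\<lambda>e. N - q + e" "\<lambda>e. e - (N - q)"]) auto
    also have "\<dots> = (M * R) $$ (a, b)"
      using ab by (simp add: scalar_prod_def atLeast0LessThan R_def M_def)
    finally have 2: "(F 0 * Y) $$ (a, N - q + b) = (M * R) $$ (a, b)" .
    show ?thesis using 1 2 ab q XY F[of 0] by (simp add: T_def R_def M_def)
  qed
  have "((\<lambda>t. det (mat q q (\<lambda>(a, b). F t $$ (a, N - q + b)))) has_field_derivative
      ((\<Sum>i<q. T $$ (i, i)) + (\<Sum>i<q. R $$ (i, i))) * det M) (at 0)"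
  proof (rule det_deriv_mult[where F = "\<lambda>t a b. F t $$ (a, N - q + b)" and M = M and T = T and R = R])
    show "M \<in> carrier_mat q q" "T \<in> carrier_mat q q" "R \<in> carrier_mat q q"
      by (simp_all add: M_def T_def R_def)
    show "((\<lambda>t. F t $$ (a, N - q + b)) has_field_derivative (T * M + M * R) $$ (a, b)) (at 0)"
      if "a < q" "b < q" for a b
    proof -
      have "a < N" "N - q + b < N" using that q by auto
      from mat_derivD[OF d, OF this] show ?thesis by (simp only: entry[OF that])
    qed
    show "F 0 $$ (a, N - q + b) = M $$ (a, b)" if "a < q" "b < q" for a b
      using that by (simp add: M_def)
    show "((\<lambda>t. det (1\<^sub>m q + t \<cdot>\<^sub>m T)) has_field_derivative (\<Sum>i<q. T $$ (i, i))) (at 0)"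
      "((\<lambda>t. det (1\<^sub>m q + t \<cdot>\<^sub>m R)) has_field_derivative (\<Sum>i<q. R $$ (i, i))) (at 0)"
      by (intro det_one_plus_lower_deriv; use q XY in \<open>auto simp: lower_tri_def T_def R_def\<close>)+
  qed
  moreover have "(\<Sum>i<q. R $$ (i, i)) = (\<Sum>i=N-q..<N. Y $$ (i, i))"
    using q by (intro sum.reindex_bij_witness[of _ "\<lambda>e. e - (N - q)" "\<lambda>e. N - q + e"])
      (auto simp: R_def)
  moreover have "(\<Sum>i<q. T $$ (i, i)) = (\<Sum>i<q. X $$ (i, i))" by (simp add: T_def)
  ultimately show ?thesis by (simp add: minor M_def)
qed

text \<open>An upper triangular Y closes up the first q columns instead of the last ones, which is
  why principal minors replace upper-right ones when j is odd.\<close>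

lemma upper_left_minor_deriv:
  assumes F: "\<And>t. F t \<in> carrier_mat N N" and X: "lower_tri N X" and Y: "upper_tri N Y"
    and q: "q \<le> N" and d: "mat_deriv N F (X * F 0 + F 0 * Y)"
  shows "((\<lambda>t. upper_left_minor q (F t)) has_field_derivative
    ((\<Sum>i<q. X $$ (i, i)) + (\<Sum>i<q. Y $$ (i, i))) * upper_left_minor q (F 0)) (at 0)"
proof -
  define M where "M = mat q q (\<lambda>(a, b). F 0 $$ (a, b))"
  define T where "T = mat q q (\<lambda>(a, b). X $$ (a, b))"
  define R where "R = mat q q (\<lambda>(a, b). Y $$ (a, b))"
  have XY: "X \<in> carrier_mat N N" "Y \<in> carrier_mat N N"
      "\<And>a b. a < b \<Longrightarrow> b < N \<Longrightarrow> X $$ (a, b) = 0" "\<And>a b. b < a \<Longrightarrow> a < N \<Longrightarrow> Y $$ (a, b) = 0"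
    using X Y by (auto simp: lower_tri_def upper_tri_def)
  have entry: "(X * F 0 + F 0 * Y) $$ (a, b) = (T * M + M * R) $$ (a, b)"
    if ab: "a < q" "b < q" for a b
  proof -
    have "(X * F 0) $$ (a, b) = (\<Sum>e<N. X $$ (a, e) * F 0 $$ (e, b))"
      using ab q by (intro mult_mat_index XY F) auto
    also have "\<dots> = (\<Sum>e<q. X $$ (a, e) * F 0 $$ (e, b))"
      using ab q XY(3) by (intro sum.mono_neutral_right) auto
    also have "\<dots> = (T * M) $$ (a, b)"
      using ab by (simp add: scalar_prod_def atLeast0LessThan T_def M_def)
    finally have 1: "(X * F 0) $$ (a, b) = (T * M) $$ (a, b)" .
    have "(F 0 * Y) $$ (a, b) = (\<Sum>e<N. F 0 $$ (a, e) * Y $$ (e, b))"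
      using ab q by (intro mult_mat_index XY F) auto
    also have "\<dots> = (\<Sum>e<q. F 0 $$ (a, e) * Y $$ (e, b))"
      using ab q XY(4) by (intro sum.mono_neutral_right) auto
    also have "\<dots> = (M * R) $$ (a, b)"
      using ab by (simp add: scalar_prod_def atLeast0LessThan R_def M_def)
    finally have 2: "(F 0 * Y) $$ (a, b) = (M * R) $$ (a, b)" .
    show ?thesis using 1 2 ab q XY F[of 0] by (simp add: T_def R_def M_def)
  qed
  have "((\<lambda>t. det (mat q q (\<lambda>(a, b). F t $$ (a, b)))) has_field_derivative
      ((\<Sum>i<q. T $$ (i, i)) + (\<Sum>i<q. R $$ (i, i))) * det M) (at 0)"
  proof (rule det_deriv_mult[where F = "\<lambda>t a b. F t $$ (a, b)" and M = M and T = T and R = R])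
    show "M \<in> carrier_mat q q" "T \<in> carrier_mat q q" "R \<in> carrier_mat q q"
      by (simp_all add: M_def T_def R_def)
    show "((\<lambda>t. F t $$ (a, b)) has_field_derivative (T * M + M * R) $$ (a, b)) (at 0)"
      if "a < q" "b < q" for a b
    proof -
      have "a < N" "b < N" using that q by auto
      from mat_derivD[OF d, OF this] show ?thesis by (simp only: entry[OF that])
    qed
    show "F 0 $$ (a, b) = M $$ (a, b)" if "a < q" "b < q" for a b
      using that by (simp add: M_def)
    show "((\<lambda>t. det (1\<^sub>m q + t \<cdot>\<^sub>m T)) has_field_derivative (\<Sum>i<q. T $$ (i, i))) (at 0)"
      by (intro det_one_plus_lower_deriv) (use q XY in \<open>auto simp: lower_tri_def T_def\<close>)
    show "((\<lambda>t. det (1\<^sub>m q + t \<cdot>\<^sub>m R)) has_field_derivative (\<Sum>i<q. R $$ (i, i))) (at 0)"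
      by (intro det_one_plus_upper_deriv) (use q XY in \<open>auto simp: upper_tri_def R_def\<close>)
  qed
  then show ?thesis by (simp add: upper_left_minor_def M_def T_def R_def)
qed

lemma upper_minor_full:
  assumes "A \<in> carrier_mat N N"
  shows "upper_right_minor N A = det A" "upper_left_minor N A = det A"
proof -
  have "mat N N (\<lambda>(a, b). A $$ (a, b)) = A" using assms by (intro eq_matI) auto
  then show "upper_right_minor N A = det A" "upper_left_minor N A = det A"
    using assms by (simp_all add: upper_right_minor_def upper_left_minor_def)
qed

section \<open>The brackets in coordinates\<close>

text \<open>The coefficient of E_ab \<otimes> E_ba in the r-matrix, which has no other
  terms.\<close>

definition wt :: "nat \<Rightarrow> nat \<Rightarrow> complex" where
  "wt a b = (if a = b then 1 else if a > b then 2 else 0)"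

lemma wt_refl [simp]: "wt a a = 1"
  by (simp add: wt_def)

lemma wt_less: "a < b \<Longrightarrow> wt a b = 0"
  by (simp add: wt_def)

text \<open>Coordinate form of r12 + r21 = 2P with the permutation operator P. It merges two
  weighted triangular parts into twice a full matrix.\<close>

lemma wt_swap: "wt b a = 2 - wt a b"
  by (auto simp: wt_def)

lemma r12_eq: "r12 i j k l = (if j = k \<and> l = i then wt i j else 0)"
proof (cases "j = k \<and> l = i")
  case True
  then have "k = j" "l = i" by simp_all
  then show ?thesis by (simp add: r12_def wt_def)
next
  case False
  then have "\<not> (i = j \<and> j = k \<and> k = l)" "\<not> (i > j \<and> k = j \<and> l = i)" by blast+
  with False show ?thesis unfolding r12_def by (simp only: if_False mult_zero_right add_0)
qed

lemma tensor_mult_leg1: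
  assumes "d < N"
  shows "tensor_mult N T (leg1 X) a b c d = (\<Sum>e<N. T a e c d * X $$ (e, b))"
proof -
  have "(\<Sum>f<N. T a e c f * leg1 X e b f d) = T a e c d * X $$ (e, b)" for e
  proof -
    have "(\<Sum>f<N. T a e c f * leg1 X e b f d) = (\<Sum>f<N. if f = d then T a e c f * X $$ (e, b) else 0)"
      by (intro sum.cong) (auto simp: leg1_def)
    then show ?thesis using assms by simp
  qed
  then show ?thesis by (simp add: tensor_mult_def)
qed

lemma tensor_mult_leg2:
  assumes "b < N"
  shows "tensor_mult N T (leg2 X) a b c d = (\<Sum>f<N. T a b c f * X $$ (f, d))"
proof -
  have "(\<Sum>e<N. T a e c f * leg2 X e b f d) = T a b c f * X $$ (f, d)" for f
  proof -
    have "(\<Sum>e<N. T a e c f * leg2 X e b f d) = (\<Sum>e<N. if e = b then T a e c f * X $$ (f, d) else 0)"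
      by (intro sum.cong) (auto simp: leg2_def)
    then show ?thesis using assms by simp
  qed
  moreover have "tensor_mult N T (leg2 X) a b c d = (\<Sum>f<N. \<Sum>e<N. T a e c f * leg2 X e b f d)"
    unfolding tensor_mult_def by (rule sum.swap)
  ultimately show ?thesis by simp
qed

lemma leg1_tensor_mult:
  assumes "c < N"
  shows "tensor_mult N (leg1 X) T a b c d = (\<Sum>e<N. X $$ (a, e) * T e b c d)"
proof -
  have "(\<Sum>f<N. leg1 X a e c f * T e b f d) = X $$ (a, e) * T e b c d" for e
  proof -
    have "(\<Sum>f<N. leg1 X a e c f * T e b f d) = (\<Sum>f<N. if f = c then X $$ (a, e) * T e b f d else 0)"
      by (intro sum.cong) (auto simp: leg1_def)
    then show ?thesis using assms by simp
  qed
  then show ?thesis by (simp add: tensor_mult_def)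
qed

lemma leg2_tensor_mult:
  assumes "a < N"
  shows "tensor_mult N (leg2 X) T a b c d = (\<Sum>f<N. X $$ (c, f) * T a b f d)"
proof -
  have "(\<Sum>e<N. leg2 X a e c f * T e b f d) = X $$ (c, f) * T a b f d" for f
  proof -
    have "(\<Sum>e<N. leg2 X a e c f * T e b f d) = (\<Sum>e<N. if e = a then X $$ (c, f) * T e b f d else 0)"
      by (intro sum.cong) (auto simp: leg2_def)
    then show ?thesis using assms by simp
  qed
  moreover have "tensor_mult N (leg2 X) T a b c d = (\<Sum>f<N. \<Sum>e<N. leg2 X a e c f * T e b f d)"
    unfolding tensor_mult_def by (rule sum.swap)
  ultimately show ?thesis by simp
qed

lemma tensor_mult_r12:
  assumes "b < N" "d < N"
  shows "tensor_mult N T r12 a b c d = T a d c b * wt d b"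
proof -
  have "(\<Sum>f<N. T a e c f * r12 e b f d) = (if e = d then T a d c b * wt d b else 0)" for e
  proof -
    have "(\<Sum>f<N. T a e c f * r12 e b f d)
        = (\<Sum>f<N. if f = b then (if e = d then T a d c b * wt d b else 0) else 0)"
      by (intro sum.cong) (auto simp: r12_eq)
    then show ?thesis using assms by simp
  qed
  then show ?thesis using assms by (simp add: tensor_mult_def)
qed

lemma leg1_leg2: "a < N \<Longrightarrow> b < N \<Longrightarrow> c < N \<Longrightarrow> d < N \<Longrightarrow>
    tensor_mult N (leg1 X) (leg2 Y) a b c d = X $$ (a, b) * Y $$ (c, d)"
  by (simp add: leg1_tensor_mult leg2_def if_distrib[of "\<lambda>z. _ * z"] cong: if_cong)

lemma r12_leg1_leg2:
  assumes "a < N" "b < N" "c < N" "d < N"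
  shows "tensor_mult N (tensor_mult N r12 (leg1 X)) (leg2 Y) a b c d
    = wt a c * X $$ (c, b) * Y $$ (a, d)"
proof -
  have "tensor_mult N r12 (leg1 X) a b c f = (if f = a then wt a c * X $$ (c, b) else 0)" if "f < N" for f
  proof -
    have "tensor_mult N r12 (leg1 X) a b c f
        = (\<Sum>e<N. if e = c then (if f = a then wt a c * X $$ (c, b) else 0) else 0)"
      unfolding tensor_mult_leg1[OF that] by (intro sum.cong) (auto simp: r12_eq)
    then show ?thesis using assms by simp
  qed
  then have "tensor_mult N (tensor_mult N r12 (leg1 X)) (leg2 Y) a b c d
      = (\<Sum>f<N. if f = a then wt a c * X $$ (c, b) * Y $$ (a, d) else 0)"
    unfolding tensor_mult_leg2[OF assms(2)] by (intro sum.cong) auto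
  then show ?thesis using assms by simp
qed

lemma leg1_transp1_leg2:
  assumes "a < N" "b < N" "c < N" "d < N"
  shows "tensor_mult N (tensor_mult N (leg1 X) (transp1 r12)) (leg2 Y) a b c d
    = wt b c * X $$ (a, c) * Y $$ (b, d)"
proof -
  have "tensor_mult N (leg1 X) (transp1 r12) a b c f = (if f = b then wt b c * X $$ (a, c) else 0)" for f
  proof -
    have "tensor_mult N (leg1 X) (transp1 r12) a b c f
        = (\<Sum>e<N. if e = c then (if f = b then wt b c * X $$ (a, c) else 0) else 0)"
      unfolding leg1_tensor_mult[OF assms(3)]
      by (intro sum.cong) (auto simp: transp1_def r12_eq)
    then show ?thesis using assms by simp
  qed
  then have "tensor_mult N (tensor_mult N (leg1 X) (transp1 r12)) (leg2 Y) a b c d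
      = (\<Sum>f<N. if f = b then wt b c * X $$ (a, c) * Y $$ (b, d) else 0)"
    unfolding tensor_mult_leg2[OF assms(2)] by (intro sum.cong) auto
  then show ?thesis using assms by simp
qed

lemma leg2_transp1_leg1:
  assumes "a < N" "b < N" "c < N" "d < N"
  shows "tensor_mult N (tensor_mult N (leg2 X) (transp1 r12)) (leg1 Y) a b c d
    = wt d a * X $$ (c, a) * Y $$ (d, b)"
proof -
  have "tensor_mult N (leg2 X) (transp1 r12) a e c d = (if e = d then wt d a * X $$ (c, a) else 0)" for e
  proof -
    have "tensor_mult N (leg2 X) (transp1 r12) a e c d
        = (\<Sum>f<N. if f = a then (if e = d then wt d a * X $$ (c, a) else 0) else 0)"
      unfolding leg2_tensor_mult[OF assms(1)]
      by (intro sum.cong) (auto simp: transp1_def r12_eq)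
    then show ?thesis using assms by simp
  qed
  then have "tensor_mult N (tensor_mult N (leg2 X) (transp1 r12)) (leg1 Y) a b c d
      = (\<Sum>e<N. if e = d then wt d a * X $$ (c, a) * Y $$ (d, b) else 0)"
    unfolding tensor_mult_leg1[OF assms(4)] by (intro sum.cong) auto
  then show ?thesis using assms by simp
qed

lemma leg1_transp2_leg2:
  assumes "a < N" "b < N" "c < N" "d < N"
  shows "tensor_mult N (tensor_mult N (leg1 X) (transp2 r12)) (leg2 Y) a b c d
    = wt c b * X $$ (a, c) * Y $$ (b, d)"
proof -
  have "tensor_mult N (leg1 X) (transp2 r12) a b c f = (if f = b then wt c b * X $$ (a, c) else 0)" for f
  proof -
    have "tensor_mult N (leg1 X) (transp2 r12) a b c f
        = (\<Sum>e<N. if e = c then (if f = b then wt c b * X $$ (a, c) else 0) else 0)"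
      unfolding leg1_tensor_mult[OF assms(3)]
      by (intro sum.cong) (auto simp: transp2_def r12_eq)
    then show ?thesis using assms by simp
  qed
  then have "tensor_mult N (tensor_mult N (leg1 X) (transp2 r12)) (leg2 Y) a b c d
      = (\<Sum>f<N. if f = b then wt c b * X $$ (a, c) * Y $$ (b, d) else 0)"
    unfolding tensor_mult_leg2[OF assms(2)] by (intro sum.cong) auto
  then show ?thesis using assms by simp
qed

lemma bracket_entries:
  assumes "a < N" "b < N" "c < N" "d < N"
  shows "bracket_AA N A a b c d = (wt a c - wt d b) * A $$ (a, d) * A $$ (c, b)
      + wt b c * A $$ (a, c) * A $$ (b, d) - wt d a * A $$ (c, a) * A $$ (d, b)"
    and "bracket_B1A N B A a b c d = - wt c b * B $$ (a, c) * A $$ (b, d) - wt d b * B $$ (a, d) * A $$ (c, b)"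
    and "bracket_BB N B a b c d = (wt a c - wt d b) * B $$ (a, d) * B $$ (c, b)"
    and "bracket_BsucB N C B a b c d = - wt c b * C $$ (a, c) * B $$ (b, d)"
  unfolding bracket_AA_def bracket_B1A_def bracket_BB_def bracket_BsucB_def
  using assms
  by (simp_all add: r12_leg1_leg2 tensor_mult_r12 leg1_leg2 leg1_transp1_leg2 leg2_transp1_leg1
      leg1_transp2_leg2 algebra_simps)

section \<open>Hamiltonian vector fields\<close>

declare S_adj.simps(2) [simp del]

definition colmat :: "nat \<Rightarrow> nat \<Rightarrow> (nat \<Rightarrow> complex) \<Rightarrow> complex mat" where
  "colmat N c f = mat N N (\<lambda>(a, b). if b = c then f a else 0)"

definition rowmat :: "nat \<Rightarrow> nat \<Rightarrow> (nat \<Rightarrow> complex) \<Rightarrow> complex mat" where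
  "rowmat N d g = mat N N (\<lambda>(a, b). if a = d then g b else 0)"

lemma colmat_carrier [simp]: "colmat N c f \<in> carrier_mat N N"
  by (simp add: colmat_def)

lemma rowmat_carrier [simp]: "rowmat N c f \<in> carrier_mat N N"
  by (simp add: rowmat_def)

lemma transpose_colmat: "transpose_mat (colmat N c f) = rowmat N c f"
  by (rule eq_matI) (auto simp: colmat_def rowmat_def)

lemma transpose_rowmat: "transpose_mat (rowmat N c f) = colmat N c f"
  by (rule eq_matI) (auto simp: colmat_def rowmat_def)

lemma colmat_mult:
  assumes "M \<in> carrier_mat N N" "c < N"
  shows "colmat N c f * M = mat N N (\<lambda>(a, b). f a * M $$ (c, b))"
proof (rule eq_matI)
  fix a b assume ab: "a < dim_row (mat N N (\<lambda>(a, b). f a * M $$ (c, b)))"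
    "b < dim_col (mat N N (\<lambda>(a, b). f a * M $$ (c, b)))"
  have "(colmat N c f * M) $$ (a, b) = (\<Sum>e<N. colmat N c f $$ (a, e) * M $$ (e, b))"
    using ab by (intro mult_mat_index assms) auto
  also have "\<dots> = (\<Sum>e<N. if e = c then f a * M $$ (c, b) else 0)"
    using ab by (intro sum.cong) (auto simp: colmat_def)
  finally show "(colmat N c f * M) $$ (a, b) = mat N N (\<lambda>(a, b). f a * M $$ (c, b)) $$ (a, b)"
    using ab assms by simp
qed (use assms in \<open>auto simp: colmat_def\<close>)

lemma mult_rowmat:
  assumes "M \<in> carrier_mat N N" "d < N"
  shows "M * rowmat N d g = mat N N (\<lambda>(a, b). M $$ (a, d) * g b)"
proof (rule eq_matI)
  fix a b assume ab: "a < dim_row (mat N N (\<lambda>(a, b). M $$ (a, d) * g b))"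
    "b < dim_col (mat N N (\<lambda>(a, b). M $$ (a, d) * g b))"
  have "(M * rowmat N d g) $$ (a, b) = (\<Sum>e<N. M $$ (a, e) * rowmat N d g $$ (e, b))"
    using ab by (intro mult_mat_index assms) auto
  also have "\<dots> = (\<Sum>e<N. if e = d then M $$ (a, d) * g b else 0)"
    using ab by (intro sum.cong) (auto simp: rowmat_def)
  finally show "(M * rowmat N d g) $$ (a, b) = mat N N (\<lambda>(a, b). M $$ (a, d) * g b) $$ (a, b)"
    using ab assms by simp
qed (use assms in \<open>auto simp: rowmat_def\<close>)

text \<open>The Hamiltonian vector field of the coordinate \<open>(l, c, d)\<close>, that is, the bracket of the
  matrices of the chain with this coordinate. It acts on every \<open>B\<^sub>k\<close> by infinitesimal
  multiplications with lower triangular matrices from both sides, on \<open>\<bbbA>\<close> by an infinitesimal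
  congruence and on \<open>S\<close> again by one-sided multiplications with triangular matrices. With
  \<open>Z = E\<^sub>d\<^sub>c\<close>, \<open>P = B\<^sub>l Z\<close> and \<open>Q = Z B\<^sub>l\<close>, the matrices \<open>LP\<close>, \<open>LQ\<close>, \<open>LPt\<close> and \<open>LQt\<close> below are the
  lower triangular parts of \<open>P\<close>, \<open>Q\<close>, \<open>P\<^sup>T\<close> and \<open>Q\<^sup>T\<close>, with the strictly lower part doubled.\<close>

locale hamiltonian_field =
  fixes N j l c d :: nat and x :: point
  assumes l_le: "l \<le> j" and c_less: "c < N" and d_less: "d < N"
    and nonsingular: "\<And>k. k \<le> j \<Longrightarrow> det (chain_mat N x k) \<noteq> 0"
begin

abbreviation B :: "nat \<Rightarrow> complex mat" where "B \<equiv> chain_mat N x"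
abbreviation S :: "nat \<Rightarrow> complex mat" where "S \<equiv> S_adj N x"

definition LP where "LP = colmat N c (\<lambda>a. wt a c * B l $$ (a, d))"
definition LQ where "LQ = rowmat N d (\<lambda>b. wt d b * B l $$ (c, b))"
definition LPt where "LPt = rowmat N c (\<lambda>b. wt c b * B l $$ (b, d))"
definition LQt where "LQt = colmat N d (\<lambda>a. wt a d * B l $$ (c, a))"

definition X :: "nat \<Rightarrow> complex mat" where
  "X k = (if k = l then LP else if Suc k = l then LQt else 0\<^sub>m N N)"

definition Y :: "nat \<Rightarrow> complex mat" where
  "Y k = (if k = l then - LQ else if k = Suc l then (if l = 0 then - LPt + - LQ else - LPt) else 0\<^sub>m N N)"

definition U :: "complex mat" where
  "U = (if l = 0 then LP + LQt else if l = 1 then LQt else 0\<^sub>m N N)"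

text \<open>The right multiplier in the motion of the partial product \<open>S k\<close>. For l > 0
  it is confined to k = l - 1 and k = l: it is created at l - 1, converted at l and cancelled by
  \<open>Y (Suc l)\<close>. The parity of l tells whether \<open>B l\<close> enters inverted or
  transposed, hence whether a transpose or a sign appears.\<close>

definition V :: "nat \<Rightarrow> complex mat" where
  "V k = (if l = 0 then (if k = 0 then - LPt + - LQ else 0\<^sub>m N N)
    else if Suc k = l then (if odd l then transpose_mat LQt else - LQt)
    else if k = l then (if odd l then transpose_mat LPt else - LPt)
    else 0\<^sub>m N N)"

definition field :: "coord \<Rightarrow> complex" where
  "field u = coord_bracket N x u (l, c, d)"

definition Xi :: "nat \<Rightarrow> complex mat" where
  "Xi k = mat N N (\<lambda>(a, b). field (k, a, b))"

definition flow :: "complex \<Rightarrow> point" where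
  "flow t u = x u + t * field u"

section \<open>Triangularity of the multipliers and their agreement with the brackets\<close>

lemma lower_tri_parts: "lower_tri N LP" "lower_tri N LQ" "lower_tri N LPt" "lower_tri N LQt"
  using c_less d_less
  by (auto simp: lower_tri_def LP_def LQ_def LPt_def LQt_def colmat_def rowmat_def wt_less)

lemma parts_carrier [simp]: "LP \<in> carrier_mat N N" "LQ \<in> carrier_mat N N"
    "LPt \<in> carrier_mat N N" "LQt \<in> carrier_mat N N"
  using lower_tri_parts by (auto simp: lower_tri_def)

lemma lower_tri_minus: "lower_tri N A \<Longrightarrow> lower_tri N (- A)"
  by (auto simp: lower_tri_def)

lemma lower_tri_add: "lower_tri N A \<Longrightarrow> lower_tri N A' \<Longrightarrow> lower_tri N (A + A')"
  by (auto simp: lower_tri_def)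

lemma lower_tri_zero: "lower_tri N (0\<^sub>m N N)"
  by (auto simp: lower_tri_def)

lemma lower_tri_if:
  "(b \<Longrightarrow> lower_tri N A) \<Longrightarrow> (\<not> b \<Longrightarrow> lower_tri N A') \<Longrightarrow> lower_tri N (if b then A else A')"
  by simp

lemma carrier_if:
  "A \<in> carrier_mat N N \<Longrightarrow> A' \<in> carrier_mat N N \<Longrightarrow> (if b then A else A') \<in> carrier_mat N N"
  by simp

lemma lower_tri_XYU: "lower_tri N (X k)" "lower_tri N (Y k)" "lower_tri N U"
  unfolding X_def Y_def U_def
  by (intro lower_tri_if lower_tri_parts lower_tri_minus lower_tri_add lower_tri_zero)+

lemma lower_tri_V:
  assumes "even j"
  shows "lower_tri N (V j)"
  unfolding V_def
  by (intro lower_tri_if lower_tri_parts lower_tri_minus lower_tri_add lower_tri_zero)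
     (use assms l_le in simp_all)

lemma upper_tri_V:
  assumes "odd j"
  shows "upper_tri N (V j)"
proof -
  have "V j = (if j = l then transpose_mat LPt else 0\<^sub>m N N)"
    unfolding V_def using assms l_le by (cases "l = 0"; cases "j = l") simp_all
  then show ?thesis by (simp add: upper_tri_iff lower_tri_parts lower_tri_zero)
qed

lemma XYUV_carrier [simp]: "X k \<in> carrier_mat N N" "Y k \<in> carrier_mat N N" "U \<in> carrier_mat N N"
    "V k \<in> carrier_mat N N" "Xi k \<in> carrier_mat N N"
  unfolding X_def Y_def U_def V_def Xi_def
  by (intro carrier_if add_carrier_mat uminus_carrier_mat transpose_carrier_mat zero_carrier_mat
      parts_carrier mat_carrier | simp)+

lemma parts_dim [simp]: "dim_row LP = N" "dim_col LP = N" "dim_row LQ = N" "dim_col LQ = N"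
    "dim_row LPt = N" "dim_col LPt = N" "dim_row LQt = N" "dim_col LQt = N"
  using parts_carrier by (auto simp del: parts_carrier)

lemma mult_carrier_square [simp]:
  "A \<in> carrier_mat N N \<Longrightarrow> A' \<in> carrier_mat N N \<Longrightarrow> A * A' \<in> carrier_mat N N"
  by (rule mult_carrier_mat)

lemma transpose_chain_carrier [simp]: "transpose_mat (B k) \<in> carrier_mat N N"
  by simp

text \<open>In each term of \<open>bracket_entries\<close> one factor keeps a row or column index of
  the entry of \<open>B k\<close>, and the other factor, with its \<open>wt\<close>, depends on the
  remaining index alone. So each term is a one-column matrix times \<open>B k\<close> or
  \<open>B k\<close> times a one-row matrix. The case k = 1, l = 0 stands apart because the bracket
  of B_1 with A has two terms.\<close>

lemma Xi_eq:
  assumes "k > 0"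
  shows "Xi k = X k * B k + B k * Y k"
proof -
  consider "k = l" | "Suc k = l" | "k = Suc l" "l = 0" | "k = Suc l" "l > 0"
    | "k \<noteq> l" "Suc k \<noteq> l" "k \<noteq> Suc l" by auto
  then show ?thesis
  proof cases
    case 1
    have "X k = LP" "Y k = - LQ" using 1 by (simp_all add: X_def Y_def)
    then have "X k * B k + B k * Y k = LP * B k + - (B k * LQ)" by simp
    also have "\<dots> = Xi k"
      unfolding LP_def LQ_def LPt_def LQt_def Xi_def field_def transpose_colmat transpose_rowmat
      colmat_mult[OF chain_mat_carrier c_less] mult_rowmat[OF chain_mat_carrier d_less]
      mult_rowmat[OF chain_mat_carrier c_less] colmat_mult[OF chain_mat_carrier d_less]
      colmat_mult[OF transpose_chain_carrier c_less] mult_rowmat[OF transpose_chain_carrier d_less]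
      mult_rowmat[OF transpose_chain_carrier c_less] colmat_mult[OF transpose_chain_carrier d_less]
      using 1 assms c_less d_less
      by (intro eq_matI) (simp_all add: coord_bracket_def bracket_entries algebra_simps)
    finally show ?thesis by simp
  next
    case 2
    have "X k = LQt" "Y k = 0\<^sub>m N N" using 2 by (auto simp: X_def Y_def)
    then have "X k * B k + B k * Y k = LQt * B k" by simp
    also have "\<dots> = Xi k"
      unfolding LP_def LQ_def LPt_def LQt_def Xi_def field_def transpose_colmat transpose_rowmat
      colmat_mult[OF chain_mat_carrier c_less] mult_rowmat[OF chain_mat_carrier d_less]
      mult_rowmat[OF chain_mat_carrier c_less] colmat_mult[OF chain_mat_carrier d_less]
      colmat_mult[OF transpose_chain_carrier c_less] mult_rowmat[OF transpose_chain_carrier d_less]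
      mult_rowmat[OF transpose_chain_carrier c_less] colmat_mult[OF transpose_chain_carrier d_less]
      using 2 assms c_less d_less
      by (intro eq_matI) (simp_all add: coord_bracket_def bracket_entries algebra_simps)
    finally show ?thesis by simp
  next
    case 3
    have XY: "X k = 0\<^sub>m N N" "Y k = - LPt + - LQ"
      unfolding X_def Y_def using 3 by simp_all
    have "X k * B k + B k * Y k = - (B k * LPt) + - (B k * LQ)"
      unfolding XY by (simp add: mult_add_distrib_mat[of _ N N _ N])
    also have "\<dots> = Xi k"
      unfolding LP_def LQ_def LPt_def LQt_def Xi_def field_def transpose_colmat transpose_rowmat
      colmat_mult[OF chain_mat_carrier c_less] mult_rowmat[OF chain_mat_carrier d_less]
      mult_rowmat[OF chain_mat_carrier c_less] colmat_mult[OF chain_mat_carrier d_less]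
      colmat_mult[OF transpose_chain_carrier c_less] mult_rowmat[OF transpose_chain_carrier d_less]
      mult_rowmat[OF transpose_chain_carrier c_less] colmat_mult[OF transpose_chain_carrier d_less]
      using 3 assms c_less d_less
      by (intro eq_matI) (simp_all add: coord_bracket_def bracket_entries algebra_simps)
    finally show ?thesis by simp
  next
    case 4
    have "X k = 0\<^sub>m N N" "Y k = - LPt"
      unfolding X_def Y_def using 4 by simp_all
    then have "X k * B k + B k * Y k = - (B k * LPt)" by simp
    also have "\<dots> = Xi k"
      unfolding LP_def LQ_def LPt_def LQt_def Xi_def field_def transpose_colmat transpose_rowmat
      colmat_mult[OF chain_mat_carrier c_less] mult_rowmat[OF chain_mat_carrier d_less]
      mult_rowmat[OF chain_mat_carrier c_less] colmat_mult[OF chain_mat_carrier d_less]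
      colmat_mult[OF transpose_chain_carrier c_less] mult_rowmat[OF transpose_chain_carrier d_less]
      mult_rowmat[OF transpose_chain_carrier c_less] colmat_mult[OF transpose_chain_carrier d_less]
      using 4 assms c_less d_less
      by (intro eq_matI) (simp_all add: coord_bracket_def bracket_entries algebra_simps)
    finally show ?thesis by simp
  next
    case 5
    have "X k = 0\<^sub>m N N" "Y k = 0\<^sub>m N N" using 5 by (auto simp: X_def Y_def)
    then have "X k * B k + B k * Y k = 0\<^sub>m N N" by simp
    also have "\<dots> = Xi k"
      using 5 assms by (intro eq_matI) (auto simp: Xi_def field_def coord_bracket_def Let_def)
    finally show ?thesis by simp
  qed
qed

text \<open>For l = 0 the four terms of the bracket pair up across r12 and its partial transpose:
  \<open>LP\<close> acts from the left in one and its transpose from the right in another, and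
  likewise for the transpose of \<open>LQ\<close> with a minus sign. For l = 1 the two terms of the
  bracket with B_1 form such a pair by themselves.\<close>

lemma Xi_0_congruence: "\<exists>W\<in>carrier_mat N N. Xi 0 = W * B 0 + B 0 * transpose_mat W"
proof -
  consider "l = 0" | "l = 1" | "l > 1" by linarith
  then show ?thesis
  proof cases
    case 1
    have t: "transpose_mat (LP + - transpose_mat LQ) = transpose_mat LP + - LQ"
      by (intro eq_matI) (auto simp: LP_def LQ_def colmat_def rowmat_def)
    have "(LP + - transpose_mat LQ) * B 0 + B 0 * transpose_mat (LP + - transpose_mat LQ)
      = (LP * B 0 + - (transpose_mat LQ * B 0)) + (B 0 * transpose_mat LP + - (B 0 * LQ))"
      unfolding t by (simp add: add_mult_distrib_mat[of _ N N _ _ N] mult_add_distrib_mat[of _ N N _ N])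
    also have "\<dots> = Xi 0"
      unfolding LP_def LQ_def LPt_def LQt_def Xi_def field_def transpose_colmat transpose_rowmat
      colmat_mult[OF chain_mat_carrier c_less] mult_rowmat[OF chain_mat_carrier d_less]
      mult_rowmat[OF chain_mat_carrier c_less] colmat_mult[OF chain_mat_carrier d_less]
      colmat_mult[OF transpose_chain_carrier c_less] mult_rowmat[OF transpose_chain_carrier d_less]
      mult_rowmat[OF transpose_chain_carrier c_less] colmat_mult[OF transpose_chain_carrier d_less]
      using 1 c_less d_less
      by (intro eq_matI) (simp_all add: coord_bracket_def bracket_entries algebra_simps)
    finally show ?thesis by (intro bexI[of _ "LP + - transpose_mat LQ"]) auto
  next
    case 2
    have "LQt * B 0 + B 0 * transpose_mat LQt = Xi 0"
      unfolding LP_def LQ_def LPt_def LQt_def Xi_def field_def transpose_colmat transpose_rowmat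
      colmat_mult[OF chain_mat_carrier c_less] mult_rowmat[OF chain_mat_carrier d_less]
      mult_rowmat[OF chain_mat_carrier c_less] colmat_mult[OF chain_mat_carrier d_less]
      colmat_mult[OF transpose_chain_carrier c_less] mult_rowmat[OF transpose_chain_carrier d_less]
      mult_rowmat[OF transpose_chain_carrier c_less] colmat_mult[OF transpose_chain_carrier d_less]
      using 2 c_less d_less
      by (intro eq_matI) (simp_all add: coord_bracket_def bracket_entries algebra_simps)
    then show ?thesis by (intro bexI[of _ LQt]) simp_all
  next
    case 3
    have "Xi 0 = 0\<^sub>m N N" using 3 by (intro eq_matI) (auto simp: Xi_def field_def coord_bracket_def Let_def)
    then show ?thesis by (intro bexI[of _ "0\<^sub>m N N"]) simp_all
  qed
qed

text \<open>For l = 0, with P = A Z and Q = Z A, the triangular form arises from the transposed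
  congruence by adding twice the transpose of Q to the left multiplier and subtracting twice the
  transpose of P from the right one. The two changes cancel because A Q = P A.\<close>

lemma transpose_Xi_0: "transpose_mat (Xi 0) = U * transpose_mat (B 0) + transpose_mat (B 0) * V 0"
proof -
  consider "l = 0" | "l = 1" | "l > 1" by linarith
  then show ?thesis
  proof cases
    case 1
    have UV: "U = LP + LQt" "V 0 = - LPt + - LQ" unfolding U_def V_def by (simp_all add: 1)
    have "U * transpose_mat (B 0) + transpose_mat (B 0) * V 0 =
        (LP * transpose_mat (B 0) + LQt * transpose_mat (B 0))
        + (- (transpose_mat (B 0) * LPt) + - (transpose_mat (B 0) * LQ))"
      unfolding UV by (simp add: add_mult_distrib_mat[of _ N N _ _ N]
          mult_add_distrib_mat[of _ N N _ N])
    also have "\<dots> = transpose_mat (Xi 0)"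
      unfolding LP_def LQ_def LPt_def LQt_def Xi_def field_def transpose_colmat transpose_rowmat
      colmat_mult[OF chain_mat_carrier c_less] mult_rowmat[OF chain_mat_carrier d_less]
      mult_rowmat[OF chain_mat_carrier c_less] colmat_mult[OF chain_mat_carrier d_less]
      colmat_mult[OF transpose_chain_carrier c_less] mult_rowmat[OF transpose_chain_carrier d_less]
      mult_rowmat[OF transpose_chain_carrier c_less] colmat_mult[OF transpose_chain_carrier d_less]
      using 1 c_less d_less
      by (intro eq_matI) (simp_all add: coord_bracket_def bracket_entries algebra_simps wt_swap[of _ c] wt_swap[of d])
    finally show ?thesis by simp
  next
    case 2
    have UV: "U = LQt" "V 0 = transpose_mat LQt" unfolding U_def V_def by (simp_all add: 2)
    have "LQt * transpose_mat (B 0) + transpose_mat (B 0) * transpose_mat LQt = transpose_mat (Xi 0)"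
      unfolding LP_def LQ_def LPt_def LQt_def Xi_def field_def transpose_colmat transpose_rowmat
      colmat_mult[OF chain_mat_carrier c_less] mult_rowmat[OF chain_mat_carrier d_less]
      mult_rowmat[OF chain_mat_carrier c_less] colmat_mult[OF chain_mat_carrier d_less]
      colmat_mult[OF transpose_chain_carrier c_less] mult_rowmat[OF transpose_chain_carrier d_less]
      mult_rowmat[OF transpose_chain_carrier c_less] colmat_mult[OF transpose_chain_carrier d_less]
      using 2 c_less d_less
      by (intro eq_matI) (simp_all add: coord_bracket_def bracket_entries algebra_simps)
    then show ?thesis unfolding UV by simp
  next
    case 3
    have "Xi 0 = 0\<^sub>m N N" using 3 by (intro eq_matI) (auto simp: Xi_def field_def coord_bracket_def Let_def)
    moreover have "U = 0\<^sub>m N N" "V 0 = 0\<^sub>m N N" using 3 by (simp_all add: U_def V_def)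
    ultimately show ?thesis by simp
  qed
qed

text \<open>This is what differentiating \<open>S (k - 1)\<close> = \<open>S k\<close> times
  \<open>B k\<close> requires if the right multipliers are to be \<open>V (k - 1)\<close> and
  \<open>V k\<close>. The essential case is k = l, where both sides equal 2 B Z B for B =
  \<open>B l\<close>.\<close>

lemma V_step_odd:
  assumes "odd k"
  shows "B k * (V (k - 1) - Y k) = (V k + X k) * B k"
proof -
  have k: "Suc (k - 1) = k" "k - 1 \<noteq> k" using assms by (auto elim: oddE)
  consider "k = l" | "Suc k = l" | "k = Suc l" | "k \<noteq> l" "Suc k \<noteq> l" "k \<noteq> Suc l" by auto
  then show ?thesis
  proof cases
    case 1
    have V: "V (k - 1) = transpose_mat LQt" "Y k = - LQ" "V k = transpose_mat LPt" "X k = LP"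
      unfolding V_def Y_def X_def using 1 assms k by auto
    have "B k * (transpose_mat LQt - - LQ) = B k * transpose_mat LQt + B k * LQ"
      by (simp add: mult_minus_distrib_mat[of _ N N _ N]) (intro eq_matI, auto)
    also have "\<dots> = transpose_mat LPt * B k + LP * B k"
      unfolding LP_def LQ_def LPt_def LQt_def transpose_colmat transpose_rowmat
      colmat_mult[OF chain_mat_carrier c_less] mult_rowmat[OF chain_mat_carrier d_less]
      mult_rowmat[OF chain_mat_carrier c_less] colmat_mult[OF chain_mat_carrier d_less]
      colmat_mult[OF transpose_chain_carrier c_less] mult_rowmat[OF transpose_chain_carrier d_less]
      mult_rowmat[OF transpose_chain_carrier c_less] colmat_mult[OF transpose_chain_carrier d_less]
      using 1 c_less d_less
      by (intro eq_matI) (simp_all add: wt_swap[of _ d] wt_swap[of _ c] algebra_simps)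
    also have "\<dots> = (transpose_mat LPt + LP) * B k"
      by (simp add: add_mult_distrib_mat[of _ N N _ _ N])
    finally show ?thesis unfolding V .
  next
    case 2
    have V: "V (k - 1) = 0\<^sub>m N N" "Y k = 0\<^sub>m N N" "V k = - LQt" "X k = LQt"
      unfolding V_def Y_def X_def using 2 assms k by auto
    have "- LQt + LQt = 0\<^sub>m N N" "0\<^sub>m N N - 0\<^sub>m N N = (0\<^sub>m N N :: complex mat)"
      by (intro eq_matI; simp)+
    note z = this
    show ?thesis unfolding V z by simp
  next
    case 3
    have V: "V (k - 1) = Y k" "V k = 0\<^sub>m N N" "X k = 0\<^sub>m N N"
      unfolding V_def Y_def X_def using 3 assms by auto
    have "Y k - Y k = 0\<^sub>m N N" by (rule minus_r_inv_mat) simp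
    note z = this
    show ?thesis unfolding V z by simp
  next
    case 4
    have V: "V (k - 1) = 0\<^sub>m N N" "Y k = 0\<^sub>m N N" "V k = 0\<^sub>m N N" "X k = 0\<^sub>m N N"
      unfolding V_def Y_def X_def using 4 assms k by auto
    have "0\<^sub>m N N - 0\<^sub>m N N = (0\<^sub>m N N :: complex mat)" by (intro eq_matI; simp)
    note z = this
    show ?thesis unfolding V z by simp
  qed
qed

text \<open>The analogous condition for \<open>S k\<close> = \<open>S (k - 1)\<close> times the
  transpose of \<open>B k\<close>. For k = l both sides equal minus twice the transpose of B Z B
  with B = \<open>B l\<close>.\<close>

lemma V_step_even:
  assumes "even k" "k > 0"
  shows "(V (k - 1) + transpose_mat (Y k)) * transpose_mat (B k)
    = transpose_mat (B k) * (V k - transpose_mat (X k))"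
proof -
  have k: "Suc (k - 1) = k" "k - 1 \<noteq> k" using assms by auto
  consider "k = l" | "Suc k = l" | "k = Suc l" | "k \<noteq> l" "Suc k \<noteq> l" "k \<noteq> Suc l" by auto
  then show ?thesis
  proof cases
    case 1
    have V: "V (k - 1) = - LQt" "Y k = - LQ" "V k = - LPt" "X k = LP"
      unfolding V_def Y_def X_def using 1 assms k by auto
    have "transpose_mat (- LQ) = - transpose_mat LQ" by (intro eq_matI) auto
    then have "(- LQt + transpose_mat (- LQ)) * transpose_mat (B k)
      = - (LQt * transpose_mat (B k)) + - (transpose_mat LQ * transpose_mat (B k))"
      by (simp add: add_mult_distrib_mat[of _ N N _ _ N])
    also have "\<dots> = - (transpose_mat (B k) * LPt) - transpose_mat (B k) * transpose_mat LP"
      unfolding LP_def LQ_def LPt_def LQt_def transpose_colmat transpose_rowmat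
      colmat_mult[OF chain_mat_carrier c_less] mult_rowmat[OF chain_mat_carrier d_less]
      mult_rowmat[OF chain_mat_carrier c_less] colmat_mult[OF chain_mat_carrier d_less]
      colmat_mult[OF transpose_chain_carrier c_less] mult_rowmat[OF transpose_chain_carrier d_less]
      mult_rowmat[OF transpose_chain_carrier c_less] colmat_mult[OF transpose_chain_carrier d_less]
      using 1 c_less d_less
      by (intro eq_matI) (simp_all add: wt_swap[of _ d] wt_swap[of _ c] algebra_simps)
    also have "\<dots> = transpose_mat (B k) * (- LPt - transpose_mat LP)"
      by (simp add: mult_minus_distrib_mat[of _ N N _ N])
    finally show ?thesis unfolding V .
  next
    case 2
    have V: "V (k - 1) = 0\<^sub>m N N" "Y k = 0\<^sub>m N N" "V k = transpose_mat LQt" "X k = LQt"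
      unfolding V_def Y_def X_def using 2 assms k by auto
    have "transpose_mat LQt - transpose_mat LQt = 0\<^sub>m N N" by (rule minus_r_inv_mat) simp
    note z = this
    show ?thesis unfolding V z by simp
  next
    case 3
    then have "odd l" using assms by simp
    then have V: "V (k - 1) = transpose_mat LPt" "Y k = - LPt" "V k = 0\<^sub>m N N" "X k = 0\<^sub>m N N"
      unfolding V_def Y_def X_def using 3 assms by (auto elim: oddE)
    have "transpose_mat LPt + transpose_mat (- LPt) = 0\<^sub>m N N"
      "0\<^sub>m N N - transpose_mat (0\<^sub>m N N) = (0\<^sub>m N N :: complex mat)"
      by (intro eq_matI; simp)+
    note z = this
    show ?thesis unfolding V z by simp
  next
    case 4
    have V: "V (k - 1) = 0\<^sub>m N N" "Y k = 0\<^sub>m N N" "V k = 0\<^sub>m N N" "X k = 0\<^sub>m N N"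
      unfolding V_def Y_def X_def using 4 assms k by auto
    have "0\<^sub>m N N - transpose_mat (0\<^sub>m N N) = (0\<^sub>m N N :: complex mat)" by (intro eq_matI; simp)
    note z = this
    show ?thesis unfolding V z by simp
  qed
qed

section \<open>Derivatives along the flow\<close>

lemma flow_0 [simp]: "flow 0 = x"
  by (rule ext) (simp add: flow_def)

lemma flow_deriv: "((\<lambda>t. flow t u) has_field_derivative field u) (at 0)"
  unfolding flow_def by (auto intro!: derivative_eq_intros)

lemma chain_mat_deriv: "mat_deriv N (\<lambda>t. chain_mat N (flow t) k) (Xi k)"
  unfolding mat_deriv_def using flow_deriv by (simp add: Xi_def)

text \<open>Supplies only the existence of the derivative; in the steps with an inverse its value is
  found afterwards from a linear equation.\<close>

lemma S_adj_differentiable: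
  assumes "k \<le> j"
  shows "\<exists>D\<in>carrier_mat N N. mat_deriv N (\<lambda>t. S_adj N (flow t) k) D"
proof -
  have "\<exists>D. ((\<lambda>t. S_adj N (flow t) k $$ (a, b)) has_field_derivative D) (at 0)" if "a < N" "b < N" for a b
  proof -
    have "smooth_pt (coords N j) x (\<lambda>x. S_adj N x k $$ (a, b))"
    proof (rule S_adj_entry_closed[OF smooth.function_algebra_axioms])
      show "smooth_pt (coords N j) x (\<lambda>x. x (i, a, b))" if "i \<le> k" "a < N" "b < N" for i a b
        using that assms by (intro smooth_pt_coord) auto
      fix i assume i: "i \<in> {1..k}"
      have "smooth_pt (coords N j) x (\<lambda>x. det (chain_mat N x i))"
        by (rule det_chain_mat_closed[OF smooth.function_algebra_axioms])
           (use i assms in \<open>simp add: smooth_pt_coord\<close>)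
      from smooth_pt_inverse[OF this] nonsingular i assms
      show "smooth_pt (coords N j) x (\<lambda>x. inverse (det (chain_mat N x i)))" by simp
    qed (use that in simp_all)
    then obtain g where g: "has_gradient (coords N j) (\<lambda>x. S_adj N x k $$ (a, b)) x g"
      by (rule smooth_ptE)
    have "((\<lambda>t. S_adj N (flow t) k $$ (a, b)) has_field_derivative (\<Sum>u\<in>coords N j. g u * field u)) (at 0)"
      by (rule has_gradientD[OF g, of flow field]) (simp_all add: flow_deriv)
    then show ?thesis by (rule exI)
  qed
  then obtain D where D: "((\<lambda>t. S_adj N (flow t) k $$ (a, b)) has_field_derivative D a b) (at 0)"
    if "a < N" "b < N" for a b by metis
  then have "mat_deriv N (\<lambda>t. S_adj N (flow t) k) (mat N N (\<lambda>(a, b). D a b))"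
    by (simp add: mat_deriv_def)
  then show ?thesis by (rule bexI) simp
qed

lemma mat_deriv_mult:
  assumes "\<And>t. F t \<in> carrier_mat N N" "\<And>t. G t \<in> carrier_mat N N"
    and "D \<in> carrier_mat N N" "D' \<in> carrier_mat N N"
    and "mat_deriv N F D" "mat_deriv N G D'"
  shows "mat_deriv N (\<lambda>t. F t * G t) (D * G 0 + F 0 * D')"
  unfolding mat_deriv_def
proof (intro allI impI)
  fix a b assume ab: "a < N" "b < N"
  have "((\<lambda>t. \<Sum>e<N. F t $$ (a, e) * G t $$ (e, b)) has_field_derivative
      (\<Sum>e<N. D $$ (a, e) * G 0 $$ (e, b) + D' $$ (e, b) * F 0 $$ (a, e))) (at 0)"
    using ab by (intro DERIV_sum DERIV_mult mat_derivD[OF assms(5)] mat_derivD[OF assms(6)]) auto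
  moreover have "(D * G 0 + F 0 * D') $$ (a, b) = (D * G 0) $$ (a, b) + (F 0 * D') $$ (a, b)"
    using assms(1,2)[of 0] assms(3,4) ab by auto
  then have "(D * G 0 + F 0 * D') $$ (a, b)
      = (\<Sum>e<N. D $$ (a, e) * G 0 $$ (e, b) + D' $$ (e, b) * F 0 $$ (a, e))"
    unfolding mult_mat_index[OF assms(3) assms(2) ab] mult_mat_index[OF assms(1) assms(4) ab]
    by (simp add: sum.distrib mult.commute)
  ultimately show "((\<lambda>t. (F t * G t) $$ (a, b)) has_field_derivative (D * G 0 + F 0 * D') $$ (a, b)) (at 0)"
    by (simp only: mult_mat_index[OF assms(1) assms(2) ab])
qed

lemma mat_deriv_transpose:
  assumes "\<And>t. F t \<in> carrier_mat N N" "D \<in> carrier_mat N N" "mat_deriv N F D"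
  shows "mat_deriv N (\<lambda>t. transpose_mat (F t)) (transpose_mat D)"
  unfolding mat_deriv_def
proof (intro allI impI)
  fix a b assume ab: "a < N" "b < N"
  have "transpose_mat (F t) $$ (a, b) = F t $$ (b, a)" for t
    using assms(1)[of t] ab by auto
  moreover have "transpose_mat D $$ (a, b) = D $$ (b, a)" using assms(2) ab by auto
  ultimately show "((\<lambda>t. transpose_mat (F t) $$ (a, b)) has_field_derivative transpose_mat D $$ (a, b)) (at 0)"
    using mat_derivD[OF assms(3) ab(2) ab(1)] by simp
qed

lemma mat_deriv_unique:
  assumes "mat_deriv N F D" "mat_deriv N G D'" "D \<in> carrier_mat N N" "D' \<in> carrier_mat N N"
    and "eventually (\<lambda>t. F t = G t) (nhds 0)"
  shows "D = D'"
proof (rule eq_matI)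
  fix a b assume "a < dim_row D'" "b < dim_col D'"
  then have ab: "a < N" "b < N" using assms(4) by auto
  have "eventually (\<lambda>t. F t $$ (a, b) = G t $$ (a, b)) (nhds 0)"
    using assms(5) by (rule eventually_mono) simp
  from DERIV_cong_ev[OF refl this refl] mat_derivD[OF assms(1) ab]
  have "((\<lambda>t. G t $$ (a, b)) has_field_derivative D $$ (a, b)) (at 0)" by simp
  from DERIV_unique[OF this mat_derivD[OF assms(2) ab]] show "D $$ (a, b) = D' $$ (a, b)" .
qed (use assms in auto)

lemma eventually_nonsingular:
  assumes "k \<le> j"
  shows "eventually (\<lambda>t. det (chain_mat N (flow t) k) \<noteq> 0) (nhds 0)"
proof -
  have "smooth_pt (coords N j) x (\<lambda>x. det (chain_mat N x k))"
    by (rule det_chain_mat_closed[OF smooth.function_algebra_axioms])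
       (use assms in \<open>simp add: smooth_pt_coord\<close>)
  then obtain g where g: "has_gradient (coords N j) (\<lambda>x. det (chain_mat N x k)) x g"
    by (rule smooth_ptE)
  have "isCont (\<lambda>t. det (chain_mat N (flow t) k)) 0"
    by (rule DERIV_isCont[OF has_gradientD[OF g, of flow field]]) (simp_all add: flow_deriv)
  then have "((\<lambda>t. det (chain_mat N (flow t) k)) \<longlongrightarrow> det (chain_mat N (flow 0) k)) (nhds 0)"
    unfolding isCont_def
    by (rule tendsto_at_iff_tendsto_nhds[of "\<lambda>t. det (chain_mat N (flow t) k)", THEN iffD1])
  then show ?thesis
    by (rule tendsto_imp_eventually_ne) (use nonsingular assms in simp)
qed

lemma S_adj_Suc_mult:
  assumes "even k" "det (chain_mat N y (Suc k)) \<noteq> 0"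
  shows "S_adj N y (Suc k) * chain_mat N y (Suc k) = S_adj N y k"
proof -
  let ?C = "chain_mat N y (Suc k)"
  have "S_adj N y (Suc k) = S_adj N y k * the (mat_inverse ?C)"
    using assms by (simp add: S_adj.simps(2) mat_inverse_nonsingular(1)[OF chain_mat_carrier])
  then have "S_adj N y (Suc k) * ?C = S_adj N y k * (the (mat_inverse ?C) * ?C)"
    using assoc_mult_mat[OF S_adj_carrier mat_inverse_nonsingular(2)[OF chain_mat_carrier assms(2)]
        chain_mat_carrier] by simp
  then show ?thesis
    using mat_inverse_nonsingular(4)[OF chain_mat_carrier assms(2)]
    by (simp add: right_mult_one_mat[of _ N N])
qed

lemma S_deriv:
  assumes "k \<le> j"
  shows "mat_deriv N (\<lambda>t. S_adj N (flow t) k) (U * S k + S k * V k)"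
  using assms
proof (induction k)
  case 0
  have "mat_deriv N (\<lambda>t. transpose_mat (chain_mat N (flow t) 0)) (transpose_mat (Xi 0))"
    by (rule mat_deriv_transpose[OF chain_mat_carrier _ chain_mat_deriv]) simp
  then show ?case by (simp add: transpose_Xi_0)
next
  case (Suc k)
  let ?C = "B (Suc k)"
  have IH: "mat_deriv N (\<lambda>t. S_adj N (flow t) k) (U * S k + S k * V k)"
    using Suc by simp
  have Xi: "Xi (Suc k) = X (Suc k) * ?C + ?C * Y (Suc k)" by (rule Xi_eq) simp
  show ?case
  proof (cases "even k")
    case True
    let ?I = "the (mat_inverse ?C)"
    have ns: "det ?C \<noteq> 0" by (rule nonsingular) (use Suc in simp)
    obtain D where D: "D \<in> carrier_mat N N" "mat_deriv N (\<lambda>t. S_adj N (flow t) (Suc k)) D"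
      using S_adj_differentiable[of "Suc k"] Suc.prems by auto
    have ev: "eventually (\<lambda>t. S_adj N (flow t) (Suc k) * chain_mat N (flow t) (Suc k)
        = S_adj N (flow t) k) (nhds 0)"
      by (rule eventually_mono[OF eventually_nonsingular[OF Suc.prems]])
         (rule S_adj_Suc_mult[OF True])
    \<comment> \<open>The product rule for \<open>S (Suc k)\<close> times \<open>B (Suc k)\<close>,
      which near 0 equals \<open>S k\<close>. Solving for \<open>D\<close> replaces differentiating
      the inverse matrix.\<close>
    have "D * chain_mat N (flow 0) (Suc k) + S_adj N (flow 0) (Suc k) * Xi (Suc k)
        = U * S k + S k * V k"
      by (rule mat_deriv_unique[OF mat_deriv_mult[OF S_adj_carrier chain_mat_carrier D(1) XYUV_carrier(5)
            D(2) chain_mat_deriv] IH _ _ ev])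
         (simp_all add: D(1) add_carrier_mat[of _ N N])
    then have e1: "D * ?C + S (Suc k) * Xi (Suc k) = U * S k + S k * V k" by (simp only: flow_0)
    have Sk: "S k = S (Suc k) * ?C" using S_adj_Suc_mult[OF True ns] by simp
    have e2: "D * ?C + (S (Suc k) * (X (Suc k) * ?C) + S (Suc k) * (?C * Y (Suc k)))
        = U * S (Suc k) * ?C + S (Suc k) * (?C * V k)"
      using e1 D(1) unfolding Xi Sk
      by (simp add: mult_add_distrib_mat[of _ N N _ N] assoc_mult_mat[of _ N N _ N _ N])
    have "S (Suc k) * (?C * (V k - Y (Suc k))) = S (Suc k) * ((V (Suc k) + X (Suc k)) * ?C)"
      using V_step_odd[of "Suc k"] True by simp
    then have e3: "S (Suc k) * (?C * V k) - S (Suc k) * (?C * Y (Suc k))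
        = S (Suc k) * V (Suc k) * ?C + S (Suc k) * (X (Suc k) * ?C)"
      by (simp add: mult_add_distrib_mat[of _ N N _ N] add_mult_distrib_mat[of _ N N _ _ N]
          mult_minus_distrib_mat[of _ N N _ N] assoc_mult_mat[of _ N N _ N _ N])
    have cancel: "p = s + z" if "p + (q + r) = s + w" "w - r = z + q"
      "p \<in> carrier_mat N N" "q \<in> carrier_mat N N" "r \<in> carrier_mat N N" "s \<in> carrier_mat N N"
      "w \<in> carrier_mat N N" "z \<in> carrier_mat N N" for p q r s w z :: "complex mat"
    proof (rule eq_matI)
      fix a b assume "a < dim_row (s + z)" "b < dim_col (s + z)"
      then have ab: "a < N" "b < N" using that by auto
      have "(p + (q + r)) $$ (a, b) = (s + w) $$ (a, b)" "(w - r) $$ (a, b) = (z + q) $$ (a, b)"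
        using that(1,2) by simp_all
      then have "p $$ (a, b) + (q $$ (a, b) + r $$ (a, b)) = s $$ (a, b) + w $$ (a, b)"
        "w $$ (a, b) - r $$ (a, b) = z $$ (a, b) + q $$ (a, b)"
        using ab that(3-) by simp_all
      then have "p $$ (a, b) = s $$ (a, b) + z $$ (a, b)" by (simp add: algebra_simps)
      then show "p $$ (a, b) = (s + z) $$ (a, b)" using ab that(3-) by simp
    qed (use that in auto)
    have "D * ?C = U * S (Suc k) * ?C + S (Suc k) * V (Suc k) * ?C"
      by (rule cancel[OF e2 e3]) (simp_all add: D(1))
    also have "\<dots> = (U * S (Suc k) + S (Suc k) * V (Suc k)) * ?C"
      by (simp add: add_mult_distrib_mat[of _ N N _ _ N])
    finally have "D * ?C * ?I = (U * S (Suc k) + S (Suc k) * V (Suc k)) * ?C * ?I" by simp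
    moreover have "G * ?C * ?I = G" if "G \<in> carrier_mat N N" for G
      using assoc_mult_mat[OF that chain_mat_carrier mat_inverse_nonsingular(2)[OF chain_mat_carrier ns]]
        mat_inverse_nonsingular(3)[OF chain_mat_carrier ns] that by simp
    ultimately have "D = U * S (Suc k) + S (Suc k) * V (Suc k)"
      using D(1) by (simp add: add_carrier_mat[of _ N N])
    with D(2) show ?thesis by simp
  next
    case False
    have S: "S_adj N y (Suc k) = S_adj N y k * transpose_mat (chain_mat N y (Suc k))" for y
      using False by (simp add: S_adj.simps(2))
    have "mat_deriv N (\<lambda>t. S_adj N (flow t) k * transpose_mat (chain_mat N (flow t) (Suc k)))
        ((U * S k + S k * V k) * transpose_mat (chain_mat N (flow 0) (Suc k))
          + S_adj N (flow 0) k * transpose_mat (Xi (Suc k)))"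
      by (rule mat_deriv_mult[OF S_adj_carrier _ _ _ IH mat_deriv_transpose[OF chain_mat_carrier _ chain_mat_deriv]])
         (simp_all add: add_carrier_mat[of _ N N])
    then have D: "mat_deriv N (\<lambda>t. S_adj N (flow t) (Suc k))
        ((U * S k + S k * V k) * transpose_mat ?C + S k * transpose_mat (Xi (Suc k)))"
      by (simp only: S flow_0)
    let ?T = "transpose_mat ?C"
    have tXi: "transpose_mat (Xi (Suc k)) = ?T * transpose_mat (X (Suc k)) + transpose_mat (Y (Suc k)) * ?T"
      unfolding Xi by (simp add: transpose_add[of _ N N] transpose_mult[of _ N N _ N])
    have "S k * ((V k + transpose_mat (Y (Suc k))) * ?T)
        = S k * (?T * (V (Suc k) - transpose_mat (X (Suc k))))"
      using V_step_even[of "Suc k"] False by simp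
    then have e: "S k * (V k * ?T) + S k * (transpose_mat (Y (Suc k)) * ?T)
        = S k * (?T * V (Suc k)) - S k * (?T * transpose_mat (X (Suc k)))"
      by (simp add: mult_add_distrib_mat[of _ N N _ N] add_mult_distrib_mat[of _ N N _ _ N]
          mult_minus_distrib_mat[of _ N N _ N])
    have cancel: "p + q + (r + s) = p + w" if "q + s = w - r"
      "p \<in> carrier_mat N N" "q \<in> carrier_mat N N" "r \<in> carrier_mat N N" "s \<in> carrier_mat N N"
      "w \<in> carrier_mat N N" for p q r s w :: "complex mat"
    proof (rule eq_matI)
      fix a b assume "a < dim_row (p + w)" "b < dim_col (p + w)"
      then have ab: "a < N" "b < N" using that by auto
      have "(q + s) $$ (a, b) = (w - r) $$ (a, b)" using that(1) by simp
      then have "q $$ (a, b) + s $$ (a, b) = w $$ (a, b) - r $$ (a, b)"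
        using ab that(2-) by simp
      then show "(p + q + (r + s)) $$ (a, b) = (p + w) $$ (a, b)"
        using ab that(2-) by (simp add: algebra_simps)
    qed (use that in auto)
    have "(U * S k + S k * V k) * ?T + S k * transpose_mat (Xi (Suc k))
        = U * S k * ?T + S k * (V k * ?T)
          + (S k * (?T * transpose_mat (X (Suc k))) + S k * (transpose_mat (Y (Suc k)) * ?T))"
      unfolding tXi
      by (simp add: mult_add_distrib_mat[of _ N N _ N] add_mult_distrib_mat[of _ N N _ _ N]
          assoc_mult_mat[of _ N N _ N _ N])
    also have "\<dots> = U * S k * ?T + S k * (?T * V (Suc k))"
      by (rule cancel[OF e]) simp_all
    also have "\<dots> = U * S (Suc k) + S (Suc k) * V (Suc k)"
      unfolding S by (simp add: assoc_mult_mat[of _ N N _ N _ N])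
    finally show ?thesis using D by simp
  qed
qed

end

section \<open>Casimir functions\<close>

lemma poisson_bracket_coord:
  assumes "v \<in> coords N j" "has_gradient (coords N j) f x g"
  shows "poisson_bracket N j f (\<lambda>y. y v) x = (\<Sum>u\<in>coords N j. g u * coord_bracket N x u v)"
  unfolding poisson_bracket_def
proof (intro sum.cong refl)
  fix u assume u: "u \<in> coords N j"
  have f: "partial_deriv u f x = g u"
    by (rule has_gradient_partial_deriv[OF finite_coords u assms(2)])
  have "(\<Sum>w\<in>coords N j. partial_deriv u f x * partial_deriv w (\<lambda>y. y v) x * coord_bracket N x u w)
      = (\<Sum>w\<in>coords N j. if w = v then g u * coord_bracket N x u v else 0)"
  proof (intro sum.cong refl)
    fix w assume w: "w \<in> coords N j"
    have "partial_deriv w (\<lambda>y. y v) x = (if w = v then 1 else 0)"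
      by (rule has_gradient_partial_deriv[OF finite_coords w has_gradient_coord[OF finite_coords assms(1)]])
    then show "partial_deriv u f x * partial_deriv w (\<lambda>y. y v) x * coord_bracket N x u w
        = (if w = v then g u * coord_bracket N x u v else 0)"
      by (simp add: f)
  qed
  then show "(\<Sum>w\<in>coords N j. partial_deriv u f x * partial_deriv w (\<lambda>y. y v) x * coord_bracket N x u w)
      = g u * coord_bracket N x u v"
    using assms(1) by simp
qed

text \<open>It suffices to consider points where \<open>f\<close> does not vanish: otherwise \<open>f\<close> is
  generically zero and there is nothing to show. For the functions \<open>X\<^sub>p\<close> this makes all minors that
  occur nonzero, as division by zero gives zero.\<close>

lemma casimirI:
  assumes rat: "rational_function (coords N j) f"
    and smooth: "\<And>x. (\<And>k. k \<le> j \<Longrightarrow> det (chain_mat N x k) \<noteq> 0) \<Longrightarrow> f x \<noteq> 0 \<Longrightarrow>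
      smooth_pt (coords N j) x f"
    and inv: "\<And>x l c d. hamiltonian_field N j l c d x \<Longrightarrow> f x \<noteq> 0 \<Longrightarrow>
      ((\<lambda>t. f (hamiltonian_field.flow N l c d x t)) has_field_derivative 0) (at 0)"
  shows "casimir N j f"
  unfolding casimir_def
proof (intro conjI ballI rat)
  fix v assume v: "v \<in> coords N j"
  obtain l c d where lcd: "v = (l, c, d)" by (cases v)
  from rat obtain p q x0 where
    p: "polyfun (coords N j) p" "polyfun (coords N j) q" "q x0 \<noteq> 0" "\<And>x. q x \<noteq> 0 \<Longrightarrow> f x = p x / q x"
    unfolding rational_function_iff_polyfun by blast
  have q: "generically (coords N j) (\<lambda>x. q x \<noteq> 0)"
    by (rule polyfun_generically_nonzero[of _ q x0]) (use p in auto)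
  show "generically (coords N j) (\<lambda>x. poisson_bracket N j f (\<lambda>y. y v) x = 0)"
  proof (cases "\<exists>y. p y \<noteq> 0")
    case False
    have "poisson_bracket N j f (\<lambda>y. y v) x = 0" if x: "q x \<noteq> 0" for x
    proof -
      have "smooth_pt (coords N j) x q" by (rule smooth_pt_polyfun[OF finite_coords p(2)])
      then obtain g' where g': "has_gradient (coords N j) q x g'" by (rule smooth_ptE)
      have "has_gradient (coords N j) f x (\<lambda>u. 0)"
        by (rule has_gradient_cong[OF has_gradient_const[of _ 0], OF g', OF x])
           (use p(4) False in auto)
      from poisson_bracket_coord[OF v this] show ?thesis by simp
    qed
    with q show ?thesis by (rule generically_mono)
  next
    case True
    then obtain y0 where "p y0 \<noteq> 0" ..
    then have "generically (coords N j) (\<lambda>x. p x \<noteq> 0)"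
      using polyfun_generically_nonzero[of "coords N j" p y0] p(1) by simp
    from generically_conj[OF generically_conj[OF this q] generically_chain_nonsingular[of N j]]
    show ?thesis
    proof (rule generically_mono)
      fix x assume x: "(p x \<noteq> 0 \<and> q x \<noteq> 0) \<and> (\<forall>k\<in>{0..j}. det (chain_mat N x k) \<noteq> 0)"
      have fx: "f x \<noteq> 0" using x p(4)[of x] by simp
      have ns: "det (chain_mat N x k) \<noteq> 0" if "k \<le> j" for k using x that by simp
      interpret hamiltonian_field N j l c d x
        by unfold_locales (use v lcd ns in auto)
      obtain g where g: "has_gradient (coords N j) f x g"
        using smooth[OF ns fx] by (rule smooth_ptE)
      have "((\<lambda>t. f (flow t)) has_field_derivative (\<Sum>u\<in>coords N j. g u * field u)) (at 0)"
        by (rule has_gradientD[OF g, of flow field]) (simp_all add: flow_deriv)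
      moreover have "((\<lambda>t. f (flow t)) has_field_derivative 0) (at 0)"
        by (rule inv[OF hamiltonian_field_axioms fx])
      ultimately have "(\<Sum>u\<in>coords N j. g u * field u) = 0" by (rule DERIV_unique)
      then show "poisson_bracket N j f (\<lambda>y. y v) x = 0"
        using poisson_bracket_coord[OF v g] by (simp add: field_def lcd)
    qed
  qed
qed

text \<open>The weight m is the logarithmic derivative at 0, stated without division so that it
  makes sense when F vanishes there. A weight 0 means a vanishing derivative.\<close>

definition log_deriv :: "(complex \<Rightarrow> complex) \<Rightarrow> complex \<Rightarrow> bool" where
  "log_deriv F m \<longleftrightarrow> (F has_field_derivative m * F 0) (at 0)"

lemma log_deriv_mult:
  assumes "log_deriv F m" "log_deriv G n"
  shows "log_deriv (\<lambda>t. F t * G t) (m + n)"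
  using DERIV_mult[OF assms[unfolded log_deriv_def]] by (simp add: log_deriv_def algebra_simps)

lemma log_deriv_inverse:
  assumes "log_deriv F m" "F 0 \<noteq> 0"
  shows "log_deriv (\<lambda>t. inverse (F t)) (- m)"
  using DERIV_inverse'[OF assms(1)[unfolded log_deriv_def], OF assms(2)] assms(2)
  by (simp add: log_deriv_def algebra_simps)

lemma log_deriv_divide:
  assumes "log_deriv F m" "log_deriv G n" "G 0 \<noteq> 0"
  shows "log_deriv (\<lambda>t. F t / G t) (m - n)"
  using log_deriv_mult[OF assms(1) log_deriv_inverse[OF assms(2), OF assms(3)]]
  by (simp add: divide_inverse)

lemma log_deriv_prod:
  assumes "\<And>k. k \<in> K \<Longrightarrow> log_deriv (F k) (m k)"
  shows "log_deriv (\<lambda>t. \<Prod>k\<in>K. F k t) (\<Sum>k\<in>K. m k)"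
  using assms
proof (induction K rule: infinite_finite_induct)
  case (insert k K)
  have "log_deriv (\<lambda>t. F k t * (\<Prod>k\<in>K. F k t)) (m k + (\<Sum>k\<in>K. m k))"
    by (rule log_deriv_mult) (use insert in auto)
  with insert.hyps show ?case by simp
qed (simp_all add: log_deriv_def)

lemma log_deriv_power2: "log_deriv F m \<Longrightarrow> log_deriv (\<lambda>t. (F t)\<^sup>2) (2 * m)"
  using log_deriv_mult[of F m F m] by (simp add: power2_eq_square)

lemma log_deriv_cong:
  assumes "log_deriv F m" "eventually (\<lambda>t. G t = F t) (nhds 0)"
  shows "log_deriv G m"
proof -
  have "G 0 = F 0" using eventually_nhds_x_imp_x[OF assms(2)] .
  with assms(1) DERIV_cong_ev[OF refl assms(2) refl, of "m * F 0"] show ?thesis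
    by (simp add: log_deriv_def)
qed

section \<open>Weights of the minors along the flow\<close>

context hamiltonian_field
begin

definition left_weight :: "nat \<Rightarrow> nat \<Rightarrow> complex" where
  "left_weight k i = X k $$ (i, i)"

definition right_weight :: "nat \<Rightarrow> nat \<Rightarrow> complex" where
  "right_weight k i = Y k $$ (i, i)"

lemma minor_B_log_deriv:
  assumes "k > 0" "q \<le> N"
  shows "log_deriv (\<lambda>t. upper_right_minor q (chain_mat N (flow t) k))
    ((\<Sum>i<q. left_weight k i) + (\<Sum>i=N-q..<N. right_weight k i))"
  unfolding log_deriv_def left_weight_def right_weight_def
  by (rule upper_right_minor_deriv[OF chain_mat_carrier lower_tri_XYU(1) lower_tri_XYU(2) assms(2)])
     (use chain_mat_deriv[of k] Xi_eq[OF assms(1)] in simp)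

lemma eventually_S_chain:
  "eventually (\<lambda>t. S_chain N (flow t) j = S_adj N (flow t) j) (nhds 0)"
proof -
  have "eventually (\<lambda>t. \<forall>k\<in>{1..j}. det (chain_mat N (flow t) k) \<noteq> 0) (nhds 0)"
    by (rule eventually_ball_finite) (simp_all add: eventually_nonsingular)
  then show ?thesis
  proof (rule eventually_mono)
    fix t assume "\<forall>k\<in>{1..j}. det (chain_mat N (flow t) k) \<noteq> 0"
    then show "S_chain N (flow t) j = S_adj N (flow t) j" by (intro S_chain_eq_S_adj) blast
  qed
qed

lemma minor_S_even_log_deriv:
  assumes "even j" "q \<le> N"
  shows "log_deriv (\<lambda>t. upper_right_minor q (S_chain N (flow t) j))
    ((\<Sum>i<q. U $$ (i, i)) + (\<Sum>i=N-q..<N. V j $$ (i, i)))"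
proof (rule log_deriv_cong)
  show "log_deriv (\<lambda>t. upper_right_minor q (S_adj N (flow t) j))
    ((\<Sum>i<q. U $$ (i, i)) + (\<Sum>i=N-q..<N. V j $$ (i, i)))"
    unfolding log_deriv_def
    by (rule upper_right_minor_deriv[OF S_adj_carrier lower_tri_XYU(3) lower_tri_V[OF assms(1)] assms(2)])
       (use S_deriv[of j] in simp)
  show "eventually (\<lambda>t. upper_right_minor q (S_chain N (flow t) j)
      = upper_right_minor q (S_adj N (flow t) j)) (nhds 0)"
    by (rule eventually_mono[OF eventually_S_chain]) simp
qed

lemma minor_S_odd_log_deriv:
  assumes "odd j" "q \<le> N"
  shows "log_deriv (\<lambda>t. upper_left_minor q (S_chain N (flow t) j))
    ((\<Sum>i<q. U $$ (i, i)) + (\<Sum>i<q. V j $$ (i, i)))"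
proof (rule log_deriv_cong)
  show "log_deriv (\<lambda>t. upper_left_minor q (S_adj N (flow t) j))
    ((\<Sum>i<q. U $$ (i, i)) + (\<Sum>i<q. V j $$ (i, i)))"
    unfolding log_deriv_def
    by (rule upper_left_minor_deriv[OF S_adj_carrier lower_tri_XYU(3) upper_tri_V[OF assms(1)] assms(2)])
       (use S_deriv[of j] in simp)
  show "eventually (\<lambda>t. upper_left_minor q (S_chain N (flow t) j)
      = upper_left_minor q (S_adj N (flow t) j)) (nhds 0)"
    by (rule eventually_mono[OF eventually_S_chain]) simp
qed

lemma det_B_log_deriv:
  assumes "k > 0"
  shows "log_deriv (\<lambda>t. det (chain_mat N (flow t) k))
    ((\<Sum>i<N. left_weight k i) + (\<Sum>i<N. right_weight k i))"
  using minor_B_log_deriv[OF assms, of N]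
  by (simp add: upper_minor_full[OF chain_mat_carrier] atLeast0LessThan)

text \<open>The determinant is the minor of full size of \<open>S_adj\<close> at stage 0, where
  upper-right and upper-left minors coincide. So it can be treated with either kind of minor,
  according to whether \<open>V 0\<close> is upper triangular (l = 1) or lower triangular.\<close>

lemma det_A_log_deriv:
  "log_deriv (\<lambda>t. det (chain_mat N (flow t) 0)) (\<Sum>i<N. U $$ (i, i) + V 0 $$ (i, i))"
proof -
  have eq: "det (chain_mat N (flow t) 0) = det (S_adj N (flow t) 0)" for t
    by (simp add: det_transpose[OF chain_mat_carrier])
  have d: "mat_deriv N (\<lambda>t. S_adj N (flow t) 0) (U * S_adj N (flow 0) 0 + S_adj N (flow 0) 0 * V 0)"
    using S_deriv[of 0] by simp
  have "lower_tri N (V 0) \<or> upper_tri N (V 0)"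
  proof (cases "l = 1")
    case True
    then have "V 0 = transpose_mat LQt" unfolding V_def by simp
    then show ?thesis by (simp add: upper_tri_iff lower_tri_parts)
  next
    case False
    then have "V 0 = (if l = 0 then - LPt + - LQ else 0\<^sub>m N N)" unfolding V_def by auto
    then show ?thesis
      using lower_tri_parts lower_tri_minus lower_tri_add lower_tri_zero by (cases "l = 0") auto
  qed
  then have "log_deriv (\<lambda>t. det (S_adj N (flow t) 0)) ((\<Sum>i<N. U $$ (i, i)) + (\<Sum>i<N. V 0 $$ (i, i)))"
  proof
    assume l: "lower_tri N (V 0)"
    show ?thesis
      using upper_right_minor_deriv[OF S_adj_carrier lower_tri_XYU(3) l order_refl d]
      unfolding log_deriv_def upper_minor_full[OF S_adj_carrier] by (simp add: atLeast0LessThan)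
  next
    assume l: "upper_tri N (V 0)"
    show ?thesis
      using upper_left_minor_deriv[OF S_adj_carrier lower_tri_XYU(3) l order_refl d]
      unfolding log_deriv_def upper_minor_full[OF S_adj_carrier] .
  qed
  then show ?thesis by (simp add: eq sum.distrib)
qed

text \<open>Each triangular part is a single row or column, hence has at most one nonzero diagonal
  entry. Its value is always the Hamiltonian coordinate itself, placed at c for the parts of P and
  its transpose and at d for those of Q and its transpose.\<close>

definition beta :: complex where "beta = B l $$ (c, d)"
definition ec :: "nat \<Rightarrow> complex" where "ec i = (if i = c then beta else 0)"
definition ed :: "nat \<Rightarrow> complex" where "ed i = (if i = d then beta else 0)"

lemma part_diag:
  assumes "i < N"
  shows "LP $$ (i, i) = ec i" "LQ $$ (i, i) = ed i" "LPt $$ (i, i) = ec i" "LQt $$ (i, i) = ed i"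
  using assms by (simp_all add: LP_def LQ_def LPt_def LQt_def colmat_def rowmat_def ec_def ed_def beta_def)

lemma left_weight_eq:
  assumes "i < N"
  shows "left_weight k i = (if k = l then ec i else 0) + (if Suc k = l then ed i else 0)"
proof -
  consider "k = l" "Suc k \<noteq> l" | "k \<noteq> l" "Suc k = l" | "k \<noteq> l" "Suc k \<noteq> l" by linarith
  then show ?thesis
    by cases (simp_all add: left_weight_def X_def part_diag assms)
qed

lemma right_weight_eq:
  assumes "i < N"
  shows "right_weight k i = - ((if k = l then ed i else 0) + (if k = Suc l then ec i else 0)
    + (if l = 0 \<and> k = 1 then ed i else 0))"
proof -
  have s: "(- LPt + - LQ) $$ (i, i) = - ec i - ed i" "(- LPt) $$ (i, i) = - ec i" "(- LQ) $$ (i, i) = - ed i"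
    using assms by (simp_all add: part_diag)
  have z: "(0\<^sub>m N N :: complex mat) $$ (i, i) = 0" using assms by simp
  consider "k = l" | "k = Suc l" "l = 0" | "k = Suc l" "l \<noteq> 0" | "k \<noteq> l" "k \<noteq> Suc l" by auto
  then show ?thesis
  proof cases
    case 1
    then have "Y k = - LQ" unfolding Y_def by simp
    then have "right_weight k i = - ed i" unfolding right_weight_def by (simp only: s)
    then show ?thesis using 1 by auto
  next
    case 2
    then have "Y k = - LPt + - LQ" unfolding Y_def by simp
    then have "right_weight k i = - ec i - ed i" unfolding right_weight_def by (simp only: s)
    then show ?thesis using 2 by simp
  next
    case 3
    then have "Y k = - LPt" unfolding Y_def by simp
    then have "right_weight k i = - ec i" unfolding right_weight_def by (simp only: s)
    then show ?thesis using 3 by simp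
  next
    case 4
    then have "Y k = 0\<^sub>m N N" unfolding Y_def by simp
    then have "right_weight k i = 0" unfolding right_weight_def by (simp only: z)
    then show ?thesis using 4 by auto
  qed
qed

lemma U_diag:
  assumes "i < N"
  shows "U $$ (i, i) = (if l = 0 then ec i + ed i else 0) + (if l = 1 then ed i else 0)"
proof -
  have s: "(LP + LQt) $$ (i, i) = ec i + ed i" using assms by (simp add: part_diag)
  have z: "(0\<^sub>m N N :: complex mat) $$ (i, i) = 0" using assms by simp
  consider "l = 0" | "l = 1" | "l \<noteq> 0" "l \<noteq> 1" by auto
  then show ?thesis
  proof cases
    case 1
    then have "U = LP + LQt" unfolding U_def by simp
    then have "U $$ (i, i) = ec i + ed i" by (simp only: s)
    then show ?thesis using 1 by simp
  next
    case 2
    then have "U = LQt" unfolding U_def by simp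
    then have "U $$ (i, i) = ed i" by (simp only: part_diag[OF assms])
    then show ?thesis using 2 by simp
  next
    case 3
    then have "U = 0\<^sub>m N N" unfolding U_def by simp
    then have "U $$ (i, i) = 0" by (simp only: z)
    then show ?thesis using 3 by simp
  qed
qed

lemma V_diag:
  assumes "i < N"
  shows "even j \<Longrightarrow> V j $$ (i, i) = - ((if l = j then ec i else 0) + (if l = j \<and> j = 0 then ed i else 0))"
    and "odd j \<Longrightarrow> V j $$ (i, i) = (if l = j then ec i else 0)"
    and "V 0 $$ (i, i) = (if l = 0 then - ec i - ed i else if l = 1 then ed i else 0)"
proof -
  have s: "(- LPt + - LQ) $$ (i, i) = - ec i - ed i" "(- LPt) $$ (i, i) = - ec i"
    "transpose_mat LPt $$ (i, i) = ec i" "transpose_mat LQt $$ (i, i) = ed i"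
    using assms by (simp_all add: part_diag)
  have z: "(0\<^sub>m N N :: complex mat) $$ (i, i) = 0" using assms by simp
  have n: "Suc j \<noteq> l" using l_le by simp
  show "V j $$ (i, i) = - ((if l = j then ec i else 0) + (if l = j \<and> j = 0 then ed i else 0))"
    if even: "even j"
  proof -
    consider "l = 0" "j = 0" | "l = 0" "j \<noteq> 0" | "l \<noteq> 0" "l = j" | "l \<noteq> 0" "l \<noteq> j" by blast
    then show ?thesis
    proof cases
      case 1
      then have "V j = - LPt + - LQ" unfolding V_def by simp
      then have "V j $$ (i, i) = - ec i - ed i" by (simp only: s)
      then show ?thesis using 1 by simp
    next
      case 2
      then have "V j = 0\<^sub>m N N" unfolding V_def by simp
      then have "V j $$ (i, i) = 0" by (simp only: z)
      then show ?thesis using 2 by simp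
    next
      case 3
      then have "V j = - LPt" unfolding V_def using even by simp
      then have "V j $$ (i, i) = - ec i" by (simp only: s)
      then show ?thesis using 3 by simp
    next
      case 4
      then have "V j = 0\<^sub>m N N" unfolding V_def using n by simp
      then have "V j $$ (i, i) = 0" by (simp only: z)
      then show ?thesis using 4 by simp
    qed
  qed
  show "V j $$ (i, i) = (if l = j then ec i else 0)" if odd: "odd j"
  proof (cases "l = j")
    case True
    then have "V j = transpose_mat LPt" unfolding V_def using odd by auto
    then have "V j $$ (i, i) = ec i" by (simp only: s)
    then show ?thesis using True by simp
  next
    case False
    have "j \<noteq> 0" using odd by (cases j) auto
    then have "V j = 0\<^sub>m N N" unfolding V_def using n False by auto
    then have "V j $$ (i, i) = 0" by (simp only: z)
    then show ?thesis using False by simp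
  qed
  consider "l = 0" | "l = 1" | "l \<noteq> 0" "l \<noteq> 1" by blast
  then show "V 0 $$ (i, i) = (if l = 0 then - ec i - ed i else if l = 1 then ed i else 0)"
  proof cases
    case 1
    then have "V 0 = - LPt + - LQ" unfolding V_def by simp
    then have "V 0 $$ (i, i) = - ec i - ed i" by (simp only: s)
    then show ?thesis using 1 by simp
  next
    case 2
    then have "V 0 = transpose_mat LQt" unfolding V_def by simp
    then have "V 0 $$ (i, i) = ed i" by (simp only: s)
    then show ?thesis using 2 by simp
  next
    case 3
    then have "V 0 = 0\<^sub>m N N" unfolding V_def by auto
    then have "V 0 $$ (i, i) = 0" by (simp only: z)
    then show ?thesis using 3 by simp
  qed
qed

lemma sum_indicator:
  fixes a :: complex
  shows "(\<Sum>k=1..j. if k = m then a else 0) = (if 1 \<le> m \<and> m \<le> j then a else 0)"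
  by simp

lemma sum_left_weight:
  assumes "i < N"
  shows "(\<Sum>k=1..j. s k * left_weight k i)
    = (if 1 \<le> l then s l * ec i else 0) + (if 2 \<le> l then s (l - 1) * ed i else 0)"
proof -
  have "(\<Sum>k=1..j. s k * left_weight k i)
      = (\<Sum>k=1..j. if k = l then s l * ec i else 0) + (\<Sum>k=1..j. if k = l - 1 then (if 1 \<le> l then s (l - 1) * ed i else 0) else 0)"
    unfolding sum.distrib[symmetric]
    by (intro sum.cong refl) (auto simp: left_weight_eq[OF assms] algebra_simps)
  then show ?thesis unfolding sum_indicator using l_le by auto
qed

lemma sum_right_weight:
  assumes "i < N"
  shows "(\<Sum>k=1..j. s k * right_weight k i)
    = - ((if 1 \<le> l then s l * ed i else 0) + (if l < j then s (Suc l) * ec i else 0)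
      + (if l = 0 \<and> 1 \<le> j then s 1 * ed i else 0))"
proof -
  have "(\<Sum>k=1..j. s k * right_weight k i)
      = (\<Sum>k=1..j. if k = l then - s l * ed i else 0) + (\<Sum>k=1..j. if k = Suc l then - s (Suc l) * ec i else 0)
        + (\<Sum>k=1..j. if k = 1 then (if l = 0 then - s 1 * ed i else 0) else 0)"
    unfolding sum.distrib[symmetric]
    by (intro sum.cong refl) (auto simp: right_weight_eq[OF assms] algebra_simps)
  then show ?thesis unfolding sum_indicator using l_le by auto
qed

text \<open>The position l of the Hamiltonian drops out: S and the matrices next to position l
  always collect one \<open>ec\<close> and one \<open>ed\<close> on the left, and their negatives on
  the right.\<close>

lemma even_total_weights:
  assumes "even j" "i < N"
  shows "U $$ (i, i) + (\<Sum>k=1..j. left_weight k i) = ec i + ed i"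
    and "V j $$ (i, i) + (\<Sum>k=1..j. right_weight k i) = - (ec i + ed i)"
proof -
  show "U $$ (i, i) + (\<Sum>k=1..j. left_weight k i) = ec i + ed i"
    using sum_left_weight[OF assms(2), of "\<lambda>k. 1"] U_diag[OF assms(2)] by (cases "l = 0"; cases "l = 1") simp_all
  show "V j $$ (i, i) + (\<Sum>k=1..j. right_weight k i) = - (ec i + ed i)"
    using sum_right_weight[OF assms(2), of "\<lambda>k. 1"] V_diag(1)[OF assms(2,1)] l_le
    by (cases "l = 0"; cases "l = j") simp_all
qed

lemma sum_ec_ed: "(\<Sum>i<N. ec i) = beta" "(\<Sum>i<N. ed i) = beta"
  using c_less d_less by (simp_all add: ec_def ed_def)

text \<open>The sign \<open>(-1) ^ k\<close> records that the minors of B_k stand in the numerator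
  for even k and in the denominator for odd k. The first identity holds for each index; the second
  only in sum, since its summand is a multiple of \<open>ec i - ed i\<close> and both
  \<open>ec\<close> and \<open>ed\<close> have total \<open>beta\<close>.\<close>

lemma odd_total_weights:
  assumes "odd j"
  shows "i < N \<Longrightarrow> U $$ (i, i) + V j $$ (i, i) + (\<Sum>k=1..j. (-1) ^ k * left_weight k i)
      = (\<Sum>k=1..j. (-1) ^ k * right_weight k i)"
    and "(\<Sum>i<N. 2 * (U $$ (i, i) + V j $$ (i, i)) - 2 * (\<Sum>k=1..j. (-1) ^ k * right_weight k i)
      - (U $$ (i, i) + V 0 $$ (i, i))) = 0"
proof -
  have j: "1 \<le> j" "j \<noteq> 0" using assms by (cases j; simp)+
  consider "l = 0" | "l = 1" "l = j" | "l = 1" "l < j" | "2 \<le> l" "l = j" | "2 \<le> l" "l < j"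
    using l_le by linarith
  note cases = this
  have pm: "(-1 :: complex) ^ (m - Suc 0) = - ((-1) ^ m)" if "1 \<le> m" for m
    using that by (cases m) simp_all
  have sgn: "(-1 :: complex) ^ j = -1" using assms by simp
  note sums = sum_left_weight[of _ "\<lambda>k. (-1) ^ k"] sum_right_weight[of _ "\<lambda>k. (-1) ^ k"]
  show "U $$ (i, i) + V j $$ (i, i) + (\<Sum>k=1..j. (-1) ^ k * left_weight k i)
      = (\<Sum>k=1..j. (-1) ^ k * right_weight k i)" if i: "i < N"
    unfolding sums[OF i] U_diag[OF i] V_diag(2)[OF i assms]
    using cases by cases (use j sgn in \<open>simp_all add: pm\<close>)
  have "\<exists>m. \<forall>i<N. 2 * (U $$ (i, i) + V j $$ (i, i)) - 2 * (\<Sum>k=1..j. (-1) ^ k * right_weight k i)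
      - (U $$ (i, i) + V 0 $$ (i, i)) = m * (ec i - ed i)"
  \<comment> \<open>For l > 0 the multiplier is \<open>- 2 * (-1) ^ l\<close> throughout; it is
    written as 2 for the odd values l = 1 and l = j.\<close>
  proof (rule exI[of _ "if l = 0 then 0 else if l = 1 \<or> l = j then 2 else - 2 * (-1) ^ l"], intro allI impI)
    fix i assume i: "i < N"
    show "2 * (U $$ (i, i) + V j $$ (i, i)) - 2 * (\<Sum>k=1..j. (-1) ^ k * right_weight k i)
      - (U $$ (i, i) + V 0 $$ (i, i))
      = (if l = 0 then 0 else if l = 1 \<or> l = j then 2 else - 2 * (-1) ^ l) * (ec i - ed i)"
      unfolding sums[OF i] U_diag[OF i] V_diag(2)[OF i assms] V_diag(3)[OF i]
      using cases by cases (use j sgn in \<open>simp_all add: pm algebra_simps\<close>)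
  qed
  then obtain m where m: "\<And>i. i < N \<Longrightarrow> 2 * (U $$ (i, i) + V j $$ (i, i))
      - 2 * (\<Sum>k=1..j. (-1) ^ k * right_weight k i) - (U $$ (i, i) + V 0 $$ (i, i)) = m * (ec i - ed i)"
    by auto
  have "(\<Sum>i<N. 2 * (U $$ (i, i) + V j $$ (i, i)) - 2 * (\<Sum>k=1..j. (-1) ^ k * right_weight k i)
      - (U $$ (i, i) + V 0 $$ (i, i))) = (\<Sum>i<N. m * (ec i - ed i))"
    by (rule sum.cong[OF refl], rule m) simp
  also have "\<dots> = m * ((\<Sum>i<N. ec i) - (\<Sum>i<N. ed i))"
    by (simp only: sum_distrib_left[symmetric] sum_subtractf)
  also have "\<dots> = 0" by (simp add: sum_ec_ed)
  finally show "(\<Sum>i<N. 2 * (U $$ (i, i) + V j $$ (i, i)) - 2 * (\<Sum>k=1..j. (-1) ^ k * right_weight k i)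
      - (U $$ (i, i) + V 0 $$ (i, i))) = 0" .
qed

end

text \<open>An initial segment of length p is completed by the final segment of length N - p, and
  vice versa. This is the reason for pairing minors of sizes p and N - p.\<close>

lemma sum_complementary_tails:
  fixes h :: "nat \<Rightarrow> complex"
  assumes "p \<le> N"
  shows "(\<Sum>i<p. h i) + (\<Sum>i=p..<N. h i) = (\<Sum>i<N. h i)"
    and "(\<Sum>i<N - p. h i) + (\<Sum>i=N-p..<N. h i) = (\<Sum>i<N. h i)"
  using sum.atLeastLessThan_concat[of 0 p N h] sum.atLeastLessThan_concat[of 0 "N - p" N h] assms
  by (simp_all add: atLeast0LessThan)

context hamiltonian_field
begin

text \<open>The product of all minors of size q has as weight the sum of \<open>ec + ed\<close> over
  the first q indices minus the sum over the last q. By complementary tails this is the same for q =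
  p and q = N - p, so the quotient has weight 0.\<close>

lemma X_even_flow:
  assumes "even j" "p \<le> N" "X_even N j p x \<noteq> 0"
  shows "((\<lambda>t. X_even N j p (flow t)) has_field_derivative 0) (at 0)"
proof -
  define num where "num q t = upper_right_minor q (S_chain N (flow t) j)
    * (\<Prod>k=1..j. upper_right_minor q (chain_mat N (flow t) k))" for q t
  define w where "w q = ((\<Sum>i<q. U $$ (i, i)) + (\<Sum>i=N-q..<N. V j $$ (i, i)))
    + (\<Sum>k=1..j. (\<Sum>i<q. left_weight k i) + (\<Sum>i=N-q..<N. right_weight k i))" for q
  have eq: "X_even N j p (flow t) = num p t / num (N - p) t" for t
    by (simp add: X_even_def num_def Let_def)
  have num: "log_deriv (num q) (w q)" if "q \<le> N" for q
    unfolding num_def w_def using that assms(1)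
    by (intro log_deriv_mult log_deriv_prod minor_B_log_deriv minor_S_even_log_deriv) auto
  have w: "w q = (\<Sum>i<q. ec i + ed i) - (\<Sum>i=N-q..<N. ec i + ed i)" if "q \<le> N" for q
  proof -
    have "w q = (\<Sum>i<q. U $$ (i, i) + (\<Sum>k=1..j. left_weight k i))
        + (\<Sum>i=N-q..<N. V j $$ (i, i) + (\<Sum>k=1..j. right_weight k i))"
    proof -
      have sL: "(\<Sum>k=1..j. \<Sum>i<q. left_weight k i) = (\<Sum>i<q. \<Sum>k=1..j. left_weight k i)"
        by (rule sum.swap)
      have sR: "(\<Sum>k=1..j. \<Sum>i=N-q..<N. right_weight k i) = (\<Sum>i=N-q..<N. \<Sum>k=1..j. right_weight k i)"
        by (rule sum.swap)
      show ?thesis unfolding w_def sum.distrib sL sR by (simp only: ac_simps)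
    qed
    also have "(\<Sum>i<q. U $$ (i, i) + (\<Sum>k=1..j. left_weight k i)) = (\<Sum>i<q. ec i + ed i)"
      by (intro sum.cong even_total_weights(1)[OF assms(1)]) (use that in auto)
    also have "(\<Sum>i=N-q..<N. V j $$ (i, i) + (\<Sum>k=1..j. right_weight k i))
        = (\<Sum>i=N-q..<N. - (ec i + ed i))"
      by (intro sum.cong even_total_weights(2)[OF assms(1)]) auto
    finally show ?thesis by (simp only: sum_negf add_uminus_conv_diff)
  qed
  have "w p = w (N - p)"
    using sum_complementary_tails[OF assms(2), of "\<lambda>i. ec i + ed i"] assms(2)
    unfolding w[OF assms(2)] w[OF diff_le_self] by (simp add: algebra_simps)
  moreover have "num (N - p) 0 \<noteq> 0" using assms(3) eq[of 0] by auto
  ultimately have "log_deriv (\<lambda>t. num p t / num (N - p) t) 0"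
    using log_deriv_divide[OF num[OF assms(2)] num[of "N - p"]] by simp
  then show ?thesis by (simp add: eq log_deriv_def)
qed

text \<open>The weights for p and N - p now add, and their segments fill up two full sums of
  \<open>b\<close>. The squared determinants of the B_k cancel these; what remains, together with
  the weight of det A, is the second identity of \<open>odd_total_weights\<close>.\<close>

lemma X_odd_flow:
  assumes "odd j" "p \<le> N" "X_odd N j p x \<noteq> 0"
  shows "((\<lambda>t. X_odd N j p (flow t)) has_field_derivative 0) (at 0)"
proof -
  define r where "r = (j - 1) div 2"
  have j: "j = 2 * r + 1" using assms(1) by (auto simp: r_def elim: oddE)
  define w where "w k q = (\<Sum>i<q. left_weight k i) + (\<Sum>i=N-q..<N. right_weight k i)" for k q
  define wS where "wS q = (\<Sum>i<q. U $$ (i, i)) + (\<Sum>i<q. V j $$ (i, i))" for q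
  define dw where "dw k = (\<Sum>i<N. left_weight k i) + (\<Sum>i<N. right_weight k i)" for k
  define dA where "dA = (\<Sum>i<N. U $$ (i, i) + V 0 $$ (i, i))"
  define n1 where "n1 t = upper_left_minor p (S_chain N (flow t) j) * upper_left_minor (N - p) (S_chain N (flow t) j)
    * (\<Prod>k=1..r. upper_right_minor p (chain_mat N (flow t) (2 * k)) * upper_right_minor (N - p) (chain_mat N (flow t) (2 * k)))" for t
  define n2 where "n2 t = (\<Prod>k=1..r+1. upper_right_minor p (chain_mat N (flow t) (2 * k - 1))
    * upper_right_minor (N - p) (chain_mat N (flow t) (2 * k - 1)))" for t
  define n3 where "n3 t = (\<Prod>k=1..r+1. (det (chain_mat N (flow t) (2 * k - 1)))\<^sup>2)" for t
  define n4 where "n4 t = det (chain_mat N (flow t) 0) * (\<Prod>k=1..r. (det (chain_mat N (flow t) (2 * k)))\<^sup>2)" for t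
  have eq: "X_odd N j p (flow t) = n1 t / n2 t * (n3 t / n4 t)" for t
    by (simp add: X_odd_def n1_def n2_def n3_def n4_def Let_def r_def)
  have n1: "log_deriv n1 (wS p + wS (N - p) + (\<Sum>k=1..r. w (2 * k) p + w (2 * k) (N - p)))"
    unfolding n1_def wS_def w_def using assms(1,2)
    by (intro log_deriv_mult log_deriv_prod minor_B_log_deriv minor_S_odd_log_deriv) auto
  have n2: "log_deriv n2 (\<Sum>k=1..r+1. w (2 * k - 1) p + w (2 * k - 1) (N - p))"
    unfolding n2_def w_def using assms(2)
    by (intro log_deriv_mult log_deriv_prod minor_B_log_deriv) auto
  have n3: "log_deriv n3 (\<Sum>k=1..r+1. 2 * dw (2 * k - 1))"
    unfolding n3_def dw_def by (intro log_deriv_prod log_deriv_power2 det_B_log_deriv) auto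
  have n4: "log_deriv n4 (dA + (\<Sum>k=1..r. 2 * dw (2 * k)))"
    unfolding n4_def dw_def dA_def
    by (intro log_deriv_mult log_deriv_prod log_deriv_power2 det_B_log_deriv det_A_log_deriv) auto
  have nz: "n2 0 \<noteq> 0" "n4 0 \<noteq> 0" using assms(3) eq[of 0] by auto
  have alternate: "(\<Sum>k=1..2*r+1. (-1) ^ k * g k) = (\<Sum>k=1..r. g (2 * k)) - (\<Sum>k=1..r+1. g (2 * k - 1))"
    for g :: "nat \<Rightarrow> complex"
    by (induction r) (simp_all add: algebra_simps)
  define a where "a i = U $$ (i, i) + V j $$ (i, i)" for i
  define b where "b i = (\<Sum>k=1..j. (-1) ^ k * right_weight k i)" for i
  define c' where "c' i = (\<Sum>k=1..j. (-1) ^ k * left_weight k i)" for i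
  have ab: "a i + c' i = b i" if "i < N" for i
    using odd_total_weights(1)[OF assms(1) that] by (simp add: a_def b_def c'_def)
  have swap: "(\<Sum>k=1..j. (-1) ^ k * ((\<Sum>i\<in>I. left_weight k i) + (\<Sum>i\<in>I'. right_weight k i)))
      = (\<Sum>i\<in>I. c' i) + (\<Sum>i\<in>I'. b i)" for I I'
  proof -
    have sL: "(\<Sum>k=1..j. \<Sum>i\<in>I. (-1) ^ k * left_weight k i) = (\<Sum>i\<in>I. c' i)"
      unfolding c'_def by (rule sum.swap)
    have sR: "(\<Sum>k=1..j. \<Sum>i\<in>I'. (-1) ^ k * right_weight k i) = (\<Sum>i\<in>I'. b i)"
      unfolding b_def by (rule sum.swap)
    show ?thesis unfolding distrib_left sum.distrib sum_distrib_left sL sR ..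
  qed
  have sw: "(\<Sum>k=1..j. (-1) ^ k * w k q) = (\<Sum>i<q. c' i) + (\<Sum>i=N-q..<N. b i)" for q
    unfolding w_def by (rule swap)
  have sd: "(\<Sum>k=1..j. (-1) ^ k * dw k) = (\<Sum>i<N. c' i) + (\<Sum>i<N. b i)"
    unfolding dw_def by (rule swap)
  have wS: "wS q = (\<Sum>i<q. a i)" for q by (simp add: wS_def a_def sum.distrib)
  have "(wS p + wS (N - p) + (\<Sum>k=1..r. w (2 * k) p + w (2 * k) (N - p)))
      - (\<Sum>k=1..r+1. w (2 * k - 1) p + w (2 * k - 1) (N - p))
      + ((\<Sum>k=1..r+1. 2 * dw (2 * k - 1)) - (dA + (\<Sum>k=1..r. 2 * dw (2 * k))))
    = wS p + wS (N - p) + (\<Sum>k=1..j. (-1) ^ k * w k p) + (\<Sum>k=1..j. (-1) ^ k * w k (N - p))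
      - 2 * (\<Sum>k=1..j. (-1) ^ k * dw k) - dA"
    unfolding j alternate by (simp add: sum.distrib sum_distrib_left[symmetric] algebra_simps del: sum.cl_ivl_Suc)
  also have "\<dots> = ((\<Sum>i<p. a i + c' i) + (\<Sum>i=p..<N. b i))
      + ((\<Sum>i<N - p. a i + c' i) + (\<Sum>i=N-p..<N. b i))
      - 2 * ((\<Sum>i<N. c' i) + (\<Sum>i<N. b i)) - dA"
    unfolding sw sd wS using assms(2) by (simp add: sum.distrib)
  also have "(\<Sum>i<p. a i + c' i) = (\<Sum>i<p. b i)"
    by (intro sum.cong ab) (use assms(2) in auto)
  also have "(\<Sum>i<N - p. a i + c' i) = (\<Sum>i<N - p. b i)"
    by (intro sum.cong ab) auto
  also have "(\<Sum>i<p. b i) + (\<Sum>i=p..<N. b i) + ((\<Sum>i<N - p. b i) + (\<Sum>i=N-p..<N. b i))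
      - 2 * ((\<Sum>i<N. c' i) + (\<Sum>i<N. b i)) - dA = - 2 * (\<Sum>i<N. c' i) - dA"
    using sum_complementary_tails[OF assms(2), of b] by simp
  also have "(\<Sum>i<N. c' i) = (\<Sum>i<N. b i - a i)"
    by (intro sum.cong refl) (use ab in \<open>auto simp: algebra_simps\<close>)
  also have "- 2 * (\<Sum>i<N. b i - a i) - dA = (\<Sum>i<N. 2 * a i - 2 * b i - (U $$ (i, i) + V 0 $$ (i, i)))"
    unfolding dA_def sum_distrib_left sum_subtractf[symmetric]
    by (intro sum.cong refl) (simp add: algebra_simps)
  also have "\<dots> = 0"
    using odd_total_weights(2)[OF assms(1)] unfolding a_def b_def .
  finally have total: "wS p + wS (N - p) + (\<Sum>k=1..r. w (2 * k) p + w (2 * k) (N - p))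
      - (\<Sum>k=1..r+1. w (2 * k - 1) p + w (2 * k - 1) (N - p))
      + ((\<Sum>k=1..r+1. 2 * dw (2 * k - 1)) - (dA + (\<Sum>k=1..r. 2 * dw (2 * k)))) = 0" .
  have "log_deriv (\<lambda>t. n1 t / n2 t * (n3 t / n4 t)) 0"
    using log_deriv_mult[OF log_deriv_divide[OF n1 n2 nz(1)] log_deriv_divide[OF n3 n4 nz(2)]]
    unfolding total .
  then show ?thesis by (simp add: eq log_deriv_def)
qed

end

section \<open>Rationality and smoothness of the X_p\<close>

lemma rational_upper_right_minor:
  assumes "k \<le> j" "q \<le> N"
  shows "rational_function (coords N j) (\<lambda>x. upper_right_minor q (chain_mat N x k))"
  by (rule upper_right_minor_closed[OF rational.function_algebra_axioms chain_mat_carrier assms(2)])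
     (use assms in \<open>simp add: rational_function_polyfun polyfun_coord\<close>)

lemma smooth_upper_right_minor:
  assumes "k \<le> j" "q \<le> N"
  shows "smooth_pt (coords N j) x (\<lambda>x. upper_right_minor q (chain_mat N x k))"
  by (rule upper_right_minor_closed[OF smooth.function_algebra_axioms chain_mat_carrier assms(2)])
     (use assms in \<open>simp add: smooth_pt_coord\<close>)

lemma rational_det_chain_mat:
  "k \<le> j \<Longrightarrow> rational_function (coords N j) (\<lambda>x. det (chain_mat N x k))"
  by (rule det_chain_mat_closed[OF rational.function_algebra_axioms])
     (simp add: rational_function_polyfun polyfun_coord)

lemma smooth_det_chain_mat:
  "k \<le> j \<Longrightarrow> smooth_pt (coords N j) x (\<lambda>x. det (chain_mat N x k))"
  by (rule det_chain_mat_closed[OF smooth.function_algebra_axioms]) (simp add: smooth_pt_coord)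

lemma rational_S_upper_left_minor:
  "q \<le> N \<Longrightarrow> rational_function (coords N j) (\<lambda>x. upper_left_minor q (S_chain N x j))"
  by (rule upper_left_minor_closed[OF rational.function_algebra_axioms], assumption)
     (rule rational_S_chain_entry)

lemma smooth_S_upper_left_minor:
  assumes "q \<le> N" "\<And>k. k \<le> j \<Longrightarrow> det (chain_mat N x k) \<noteq> 0"
  shows "smooth_pt (coords N j) x (\<lambda>x. upper_left_minor q (S_chain N x j))"
  by (rule upper_left_minor_closed[OF smooth.function_algebra_axioms assms(1)])
     (rule smooth_S_chain_entry, use assms(2) in simp_all)

text \<open>The dimension of \<open>S_chain\<close> is unspecified when some \<open>B\<^sub>k\<close> is singular.\<close>

lemma rational_S_upper_right_minor:
  assumes "q \<le> N"
  shows "rational_function (coords N j) (\<lambda>x. upper_right_minor q (S_chain N x j))"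
proof (rule rational_function_cong)
  show "rational_function (coords N j) (\<lambda>x. upper_right_minor q (S_adj N x j))"
  proof (rule upper_right_minor_closed[OF rational.function_algebra_axioms S_adj_carrier assms])
    fix a b assume ab: "a < N" "b < N"
    show "rational_function (coords N j) (\<lambda>x. S_adj N x j $$ (a, b))"
      by (intro S_adj_entry_closed[OF rational.function_algebra_axioms] rational_function_inverse
          rational_det_chain_mat ab)
         (simp_all add: rational_function_polyfun polyfun_coord)
  qed
  show "generically (coords N j)
      (\<lambda>x. upper_right_minor q (S_chain N x j) = upper_right_minor q (S_adj N x j))"
  proof (rule generically_mono[OF generically_chain_nonsingular])
    fix x assume "\<forall>k\<in>{0..j}. det (chain_mat N x k) \<noteq> 0"
    then have "S_chain N x j = S_adj N x j" by (intro S_chain_eq_S_adj) auto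
    then show "upper_right_minor q (S_chain N x j) = upper_right_minor q (S_adj N x j)" by simp
  qed
qed

lemma smooth_S_upper_right_minor:
  assumes "q \<le> N" "\<And>k. k \<le> j \<Longrightarrow> det (chain_mat N x k) \<noteq> 0"
  shows "smooth_pt (coords N j) x (\<lambda>x. upper_right_minor q (S_chain N x j))"
proof -
  define e where "e y = (\<Prod>k=1..j. det (chain_mat N y k))" for y
  have e: "smooth_pt (coords N j) x e"
    unfolding e_def by (rule smooth.prod) (simp add: smooth_det_chain_mat)
  have ex: "e x \<noteq> 0" using assms(2) by (simp add: e_def)
  have S: "smooth_pt (coords N j) x (\<lambda>x. upper_right_minor q (S_adj N x j))"
  proof (rule upper_right_minor_closed[OF smooth.function_algebra_axioms S_adj_carrier assms(1)])
    fix a b assume ab: "a < N" "b < N"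
    show "smooth_pt (coords N j) x (\<lambda>x. S_adj N x j $$ (a, b))"
    proof (rule S_adj_entry_closed[OF smooth.function_algebra_axioms])
      show "smooth_pt (coords N j) x (\<lambda>x. inverse (det (chain_mat N x k)))" if "k \<in> {1..j}" for k
        by (rule smooth_pt_inverse[OF smooth_det_chain_mat]) (use that assms(2) in auto)
    qed (simp_all add: smooth_pt_coord ab)
  qed
  show ?thesis
  proof (rule smooth_pt_cong[OF S, OF e, OF ex])
    fix y assume y: "e y \<noteq> 0"
    have "det (chain_mat N y k) \<noteq> 0" if k: "k \<in> {1..j}" for k
      using y k by (simp add: e_def)
    then have "S_chain N y j = S_adj N y j" by (rule S_chain_eq_S_adj)
    then show "upper_right_minor q (S_chain N y j) = upper_right_minor q (S_adj N y j)" by simp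
  qed
qed

lemma smooth_X_even:
  assumes "p \<le> N" "\<And>k. k \<le> j \<Longrightarrow> det (chain_mat N x k) \<noteq> 0" "X_even N j p x \<noteq> 0"
  shows "smooth_pt (coords N j) x (X_even N j p)"
proof -
  have "smooth_pt (coords N j) x (\<lambda>x. (upper_right_minor p (S_chain N x j)
      * (\<Prod>k=1..j. upper_right_minor p (chain_mat N x k)))
      / (upper_right_minor (N - p) (S_chain N x j) * (\<Prod>k=1..j. upper_right_minor (N - p) (chain_mat N x k))))"
    using assms
    by (intro smooth_pt_divide smooth.mult smooth.prod smooth_upper_right_minor smooth_S_upper_right_minor)
       (auto simp: X_even_def Let_def)
  then show ?thesis unfolding X_even_def Let_def .
qed

lemma smooth_X_odd:
  assumes "odd j" "p \<le> N" "\<And>k. k \<le> j \<Longrightarrow> det (chain_mat N x k) \<noteq> 0" "X_odd N j p x \<noteq> 0"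
  shows "smooth_pt (coords N j) x (X_odd N j p)"
proof -
  define r where "r = (j - 1) div 2"
  have j: "j = 2 * r + 1" using assms(1) by (auto simp: r_def elim: oddE)
  show ?thesis
    unfolding X_odd_def Let_def r_def[symmetric]
    by (intro smooth_pt_divide smooth.mult smooth.prod smooth.power smooth_upper_right_minor
        smooth_S_upper_left_minor smooth_det_chain_mat)
       (use assms j in \<open>auto simp: X_odd_def Let_def r_def[symmetric]\<close>)
qed

theorem casimir_X_even:
  assumes "even j" "p \<le> N"
  shows "casimir N j (X_even N j p)"
proof (rule casimirI)
  have "rational_function (coords N j) (\<lambda>x. (upper_right_minor p (S_chain N x j)
      * (\<Prod>k=1..j. upper_right_minor p (chain_mat N x k)))
      / (upper_right_minor (N - p) (S_chain N x j) * (\<Prod>k=1..j. upper_right_minor (N - p) (chain_mat N x k))))"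
    using assms
    by (intro rational_function_divide rational.mult rational.prod rational_upper_right_minor
        rational_S_upper_right_minor) auto
  then show "rational_function (coords N j) (X_even N j p)" unfolding X_even_def Let_def .
  show "smooth_pt (coords N j) x (X_even N j p)"
    if "\<And>k. k \<le> j \<Longrightarrow> det (chain_mat N x k) \<noteq> 0" "X_even N j p x \<noteq> 0" for x
    by (rule smooth_X_even[OF assms(2) that])
  show "((\<lambda>t. X_even N j p (hamiltonian_field.flow N l c d x t)) has_field_derivative 0) (at 0)"
    if "hamiltonian_field N j l c d x" "X_even N j p x \<noteq> 0" for x l c d
    by (rule hamiltonian_field.X_even_flow[OF that(1) assms that(2)])
qed

theorem casimir_X_odd:
  assumes "odd j" "p \<le> N"
  shows "casimir N j (X_odd N j p)"
proof (rule casimirI)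
  define r where "r = (j - 1) div 2"
  have j: "j = 2 * r + 1" using assms(1) by (auto simp: r_def elim: oddE)
  show "rational_function (coords N j) (X_odd N j p)"
    unfolding X_odd_def Let_def r_def[symmetric]
    by (intro rational_function_divide rational.mult rational.prod rational.power
        rational_upper_right_minor rational_S_upper_left_minor rational_det_chain_mat)
       (use assms j in auto)
  show "smooth_pt (coords N j) x (X_odd N j p)"
    if "\<And>k. k \<le> j \<Longrightarrow> det (chain_mat N x k) \<noteq> 0" "X_odd N j p x \<noteq> 0" for x
    by (rule smooth_X_odd[OF assms that])
  show "((\<lambda>t. X_odd N j p (hamiltonian_field.flow N l c d x t)) has_field_derivative 0) (at 0)"
    if "hamiltonian_field N j l c d x" "X_odd N j p x \<noteq> 0" for x l c d
    by (rule hamiltonian_field.X_odd_flow[OF that(1) assms that(2)])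
qed

section \<open>The functions \<open>Y\<^sub>p\<close>\<close>

lemma poly_zero_off_origin:
  fixes p :: "complex poly"
  assumes "\<And>w. w \<noteq> 0 \<Longrightarrow> poly p w = 0"
  shows "p = 0"
proof -
  have "poly (pCons 0 p) w = 0" for w using assms[of w] by (cases "w = 0") simp_all
  then have "pCons 0 p = 0" using poly_all_0_iff_0 by blast
  then show ?thesis by simp
qed

text \<open>The prescribed right-hand side multiplied by \<lambda>\<open>^N\<close> and written in w
  = \<lambda>\<open>^2\<close>: a palindromic polynomial instead of a Laurent expression.\<close>

definition expansion :: "nat \<Rightarrow> (nat \<Rightarrow> complex) \<Rightarrow> complex \<Rightarrow> complex" where
  "expansion N y w = w ^ N + 1 + (\<Sum>p=1..N div 2. (w ^ (N - p) + w ^ p) * y p)"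

lemma lambda_expansion_pointwise:
  fixes A :: "complex mat"
  assumes A: "A \<in> carrier_mat N N" and d: "det A \<noteq> 0" and z: "z \<noteq> 0"
  shows "det (z \<cdot>\<^sub>m A + inverse z \<cdot>\<^sub>m transpose_mat A) / det A =
        (z powi int N + z powi (- int N)) +
        (\<Sum>p=1..N div 2. (z powi (int N - 2 * int p) + z powi (2 * int p - int N)) * y p)
    \<longleftrightarrow> det (z\<^sup>2 \<cdot>\<^sub>m A + transpose_mat A) = det A * expansion N y (z\<^sup>2)" (is "?l / _ = ?r \<longleftrightarrow> _")
proof -
  have "z \<cdot>\<^sub>m A + inverse z \<cdot>\<^sub>m transpose_mat A = inverse z \<cdot>\<^sub>m (z\<^sup>2 \<cdot>\<^sub>m A + transpose_mat A)"
    using A z by (intro eq_matI) (auto simp: power2_eq_square field_simps)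
  then have l: "z ^ N * ?l = det (z\<^sup>2 \<cdot>\<^sub>m A + transpose_mat A)"
    using A z by (simp add: power_inverse)
  have w: "z ^ N * (z powi (int N - 2 * int p) + z powi (2 * int p - int N)) = (z\<^sup>2) ^ (N - p) + (z\<^sup>2) ^ p"
    if "p \<le> N" for p
  proof -
    have add: "z ^ N * z powi m = z powi (int N + m)" for m
      using power_int_add[of z "int N" m] z by (simp only: power_int_of_nat) simp
    have "z ^ N * z powi (int N - 2 * int p) = z powi (int N + (int N - 2 * int p))"
      by (rule add)
    also have "int N + (int N - 2 * int p) = int (2 * (N - p))" using that by simp
    finally have 1: "z ^ N * z powi (int N - 2 * int p) = (z\<^sup>2) ^ (N - p)"
      by (simp only: power_int_of_nat power_mult)
    have "z ^ N * z powi (2 * int p - int N) = z powi (int N + (2 * int p - int N))"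
      by (rule add)
    also have "int N + (2 * int p - int N) = int (2 * p)" by simp
    finally have 2: "z ^ N * z powi (2 * int p - int N) = (z\<^sup>2) ^ p"
      by (simp only: power_int_of_nat power_mult)
    show ?thesis by (simp only: distrib_left 1 2)
  qed
  have "z ^ N * ?r = z ^ N * (z powi (int N - 2 * int 0) + z powi (2 * int 0 - int N))
      + (\<Sum>p=1..N div 2. z ^ N * (z powi (int N - 2 * int p) + z powi (2 * int p - int N)) * y p)"
    unfolding distrib_left[of "z ^ N" "z powi int N + z powi (- int N)"] sum_distrib_left mult.assoc
    by simp
  also have "\<dots> = expansion N y (z\<^sup>2)"
    unfolding expansion_def w[OF le0] by (intro arg_cong2[of _ _ _ _ plus] sum.cong) (auto simp: w)
  finally have r: "z ^ N * ?r = expansion N y (z\<^sup>2)" .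
  have "L / det A = R \<longleftrightarrow> z ^ N * L = det A * (z ^ N * R)" for L R
    using d z by (auto simp: field_simps)
  then show ?thesis by (simp only: l r)
qed

lemma lambda_expansion_iff:
  assumes A: "A \<in> carrier_mat N N" and d: "det A \<noteq> 0"
  shows "lambda_expansion N A y \<longleftrightarrow>
    (\<forall>w. w \<noteq> 0 \<longrightarrow> det (w \<cdot>\<^sub>m A + transpose_mat A) = det A * expansion N y w)"
proof
  assume l: "lambda_expansion N A y"
  show "\<forall>w. w \<noteq> 0 \<longrightarrow> det (w \<cdot>\<^sub>m A + transpose_mat A) = det A * expansion N y w"
  proof (intro allI impI)
    fix w :: complex assume "w \<noteq> 0"
    then have z: "csqrt w \<noteq> 0" by simp
    have "det ((csqrt w)\<^sup>2 \<cdot>\<^sub>m A + transpose_mat A) = det A * expansion N y ((csqrt w)\<^sup>2)"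
      by (rule iffD1[OF lambda_expansion_pointwise[OF A d z] l[unfolded lambda_expansion_def, rule_format, OF z]])
    then show "det (w \<cdot>\<^sub>m A + transpose_mat A) = det A * expansion N y w" by simp
  qed
next
  assume r: "\<forall>w. w \<noteq> 0 \<longrightarrow> det (w \<cdot>\<^sub>m A + transpose_mat A) = det A * expansion N y w"
  show "lambda_expansion N A y"
    unfolding lambda_expansion_def
  proof (intro allI impI)
    fix z :: complex assume z: "z \<noteq> 0"
    then have "z\<^sup>2 \<noteq> 0" by simp
    from r[rule_format, OF this]
    show "det (z \<cdot>\<^sub>m A + inverse z \<cdot>\<^sub>m transpose_mat A) / det A =
        (z powi int N + z powi (- int N)) +
        (\<Sum>p=1..N div 2. (z powi (int N - 2 * int p) + z powi (2 * int p - int N)) * y p)"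
      by (rule iffD2[OF lambda_expansion_pointwise[OF A d z]])
  qed
qed

text \<open>For p up to N/2 the exponents p and N - p lie in opposite halves and meet only for 2p =
  N; there the coefficient is doubled, so it still determines \<open>y p\<close>.\<close>

lemma expansion_unique:
  assumes "\<And>w. w \<noteq> 0 \<Longrightarrow> expansion N y w = expansion N y' w" and p: "p \<in> {1..N div 2}"
  shows "y p = y' p"
proof -
  define q where "q = (\<Sum>p=1..N div 2. monom (y p - y' p) (N - p) + monom (y p - y' p) p)"
  have "poly q w = expansion N y w - expansion N y' w" for w
    unfolding q_def expansion_def
    by (simp add: poly_sum poly_monom sum_subtractf[symmetric] algebra_simps)
  then have "q = 0" by (intro poly_zero_off_origin) (simp add: assms(1))
  then have "0 = coeff q p" by simp
  also have "\<dots> = (\<Sum>i=1..N div 2. if i = p then (y p - y' p) * (if 2 * p = N then 2 else 1) else 0)"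
    unfolding q_def coeff_sum coeff_add coeff_monom
  proof (intro sum.cong refl)
    fix i assume i: "i \<in> {1..N div 2}"
    then have "2 * i \<le> N" "2 * p \<le> N" using p by auto
    then have "N - i = p \<longleftrightarrow> i = p \<and> 2 * p = N" by linarith
    then show "(if N - i = p then y i - y' i else 0) + (if i = p then y i - y' i else 0)
        = (if i = p then (y p - y' p) * (if 2 * p = N then 2 else 1) else 0)"
      by simp
  qed
  also have "\<dots> = (y p - y' p) * (if 2 * p = N then 2 else 1)" using p by simp
  finally show ?thesis by (simp split: if_splits)
qed

lemma Y_fun_unique:
  assumes d: "det (chain_mat N x 0) \<noteq> 0"
    and y: "lambda_expansion N (chain_mat N x 0) y" and p: "p \<in> {1..N div 2}"
  shows "Y_fun N p x = y p"
proof -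
  define y0 where "y0 q = (if q \<in> {1..N div 2} then y q else 0)" for q
  note iff = lambda_expansion_iff[OF chain_mat_carrier d]
  have "expansion N y0 w = expansion N y w" for w
    unfolding expansion_def y0_def by simp
  then have y0: "lambda_expansion N (chain_mat N x 0) y0" using y unfolding iff by simp
  have "(THE y. lambda_expansion N (chain_mat N x 0) y \<and> (\<forall>q. q \<notin> {1..N div 2} \<longrightarrow> y q = 0)) = y0"
  proof (rule the_equality)
    show "lambda_expansion N (chain_mat N x 0) y0 \<and> (\<forall>q. q \<notin> {1..N div 2} \<longrightarrow> y0 q = 0)"
      using y0 by (auto simp: y0_def)
    fix y' assume y': "lambda_expansion N (chain_mat N x 0) y' \<and> (\<forall>q. q \<notin> {1..N div 2} \<longrightarrow> y' q = 0)"
    show "y' = y0"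
    proof
      fix q
      show "y' q = y0 q"
      proof (cases "q \<in> {1..N div 2}")
        case True
        show ?thesis
        proof (rule expansion_unique[OF _ True])
          fix w :: complex assume "w \<noteq> 0"
          with y' y0 have "det (chain_mat N x 0) * expansion N y' w = det (chain_mat N x 0) * expansion N y0 w"
            unfolding iff by metis
          then show "expansion N y' w = expansion N y0 w" using d by simp
        qed
      next
        case False
        then have "y' q = 0" using conjunct2[OF y'] by blast
        moreover have "y0 q = 0" using False by (simp only: y0_def if_False)
        ultimately show ?thesis by simp
      qed
    qed
  qed
  then show ?thesis using p by (simp add: Y_fun_def y0_def)
qed

text \<open>The polynomial in w whose value is the determinant of w A plus the transpose of
  A.\<close>

definition congruence_poly :: "nat \<Rightarrow> point \<Rightarrow> complex poly" where
  "congruence_poly N x = det (mat N N (\<lambda>(a, b). [:x (0, b, a), x (0, a, b):]))"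

text \<open>An explicit rational formula for the value selected by the description operator in
  \<open>Y_fun\<close>. The factor 2 reflects that for 2p = N both powers of \<lambda> multiplying
  Y_p are 1.\<close>

definition Y_rat :: "nat \<Rightarrow> nat \<Rightarrow> point \<Rightarrow> complex" where
  "Y_rat N p x = coeff (congruence_poly N x) p
    * inverse (det (chain_mat N x 0) * (if 2 * p = N then 2 else 1))"

lemma poly_congruence_poly:
  "poly (congruence_poly N x) w = det (w \<cdot>\<^sub>m chain_mat N x 0 + transpose_mat (chain_mat N x 0))"
  unfolding congruence_poly_def by (rule poly_det_cong[of _ N]) auto

lemma degree_congruence_poly: "degree (congruence_poly N x) \<le> N"
proof -
  have "degree (congruence_poly N x) \<le> 1 * N"
    unfolding congruence_poly_def by (rule degree_det_le) auto
  then show ?thesis by simp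
qed

lemma poly_eq_sum:
  fixes p :: "complex poly"
  assumes "degree p \<le> n"
  shows "poly p w = (\<Sum>i\<le>n. coeff p i * w ^ i)"
  using arg_cong[OF poly_as_sum_of_monoms'[OF assms], of "\<lambda>q. poly q w"]
  by (simp add: poly_sum poly_monom)

text \<open>Transposing w A + A^T and extracting w leaves the same expression at 1/w. So the
  polynomial C satisfies C(w) = w^N C(1/w), which reverses its coefficients.\<close>

lemma coeff_congruence_poly_sym:
  assumes "k \<le> N"
  shows "coeff (congruence_poly N x) (N - k) = coeff (congruence_poly N x) k"
proof -
  let ?A = "chain_mat N x 0" and ?C = "congruence_poly N x"
  define C' where "C' = (\<Sum>i\<le>N. monom (coeff ?C i) (N - i))"
  have "poly (?C - C') w = 0" if w: "w \<noteq> 0" for w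
  proof -
    have "w \<cdot>\<^sub>m ?A + transpose_mat ?A = transpose_mat (w \<cdot>\<^sub>m (inverse w \<cdot>\<^sub>m ?A + transpose_mat ?A))"
      using w by (intro eq_matI) (auto simp: algebra_simps)
    then have "poly ?C w = det (w \<cdot>\<^sub>m (inverse w \<cdot>\<^sub>m ?A + transpose_mat ?A))"
      unfolding poly_congruence_poly by (simp add: det_transpose[of _ N])
    also have "\<dots> = w ^ N * poly ?C (inverse w)"
      unfolding poly_congruence_poly by simp
    also have "poly ?C (inverse w) = (\<Sum>i\<le>N. coeff ?C i * inverse w ^ i)"
      by (rule poly_eq_sum) (rule degree_congruence_poly)
    also have "w ^ N * \<dots> = (\<Sum>i\<le>N. coeff ?C i * w ^ (N - i))"
      unfolding sum_distrib_left
      by (intro sum.cong refl) (use w in \<open>simp add: power_diff field_simps\<close>)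
    also have "\<dots> = poly C' w" by (simp add: C'_def poly_sum poly_monom)
    finally show ?thesis by simp
  qed
  then have "?C = C'" using poly_zero_off_origin[of "?C - C'"] by simp
  then have "coeff ?C k = coeff C' k" by simp
  also have "\<dots> = (\<Sum>i\<le>N. if i = N - k then coeff ?C (N - k) else 0)"
    unfolding C'_def coeff_sum coeff_monom
    by (intro sum.cong refl) (use assms in auto)
  also have "\<dots> = coeff ?C (N - k)" by simp
  finally show ?thesis ..
qed

lemma sum_palindromic:
  fixes c :: "nat \<Rightarrow> complex"
  assumes "N \<ge> 1" "\<And>k. k \<le> N \<Longrightarrow> c (N - k) = c k"
  shows "(\<Sum>i\<le>N. c i * w ^ i) = c 0 * (w ^ N + 1)
    + (\<Sum>p=1..N div 2. (w ^ (N - p) + w ^ p) * (c p * inverse (if 2 * p = N then 2 else 1)))"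
proof -
  let ?n = "N div 2"
  have "(\<Sum>i\<le>N. c i * w ^ i) = (\<Sum>i\<in>{..?n} \<union> {?n<..N}. c i * w ^ i)"
    by (intro sum.cong) auto
  also have "\<dots> = (\<Sum>i\<le>?n. c i * w ^ i) + (\<Sum>i\<in>{?n<..N}. c i * w ^ i)"
    by (rule sum.union_disjoint) auto
  also have "(\<Sum>i\<in>{?n<..N}. c i * w ^ i) = (\<Sum>p<N - ?n. c p * w ^ (N - p))"
    by (rule sum.reindex_bij_witness[of _ "\<lambda>p. N - p" "\<lambda>i. N - i"]) (auto simp: assms(2))
  also have "\<dots> = (\<Sum>p\<le>?n. if 2 * p = N then 0 else c p * w ^ (N - p))"
  proof -
    have "(\<Sum>p\<le>?n. if 2 * p = N then 0 else c p * w ^ (N - p))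
        = (\<Sum>p\<in>{p\<in>{..?n}. 2 * p \<noteq> N}. c p * w ^ (N - p))"
      by (subst sum.inter_filter) (auto intro!: sum.cong)
    also have "{p\<in>{..?n}. 2 * p \<noteq> N} = {..<N - ?n}" by auto
    finally show ?thesis by simp
  qed
  also have "(\<Sum>i\<le>?n. c i * w ^ i) + \<dots>
      = (\<Sum>p\<le>?n. (w ^ (N - p) + w ^ p) * (c p * inverse (if 2 * p = N then 2 else 1)))"
    unfolding sum.distrib[symmetric]
  proof (intro sum.cong refl)
    fix p
    show "c p * w ^ p + (if 2 * p = N then 0 else c p * w ^ (N - p))
        = (w ^ (N - p) + w ^ p) * (c p * inverse (if 2 * p = N then 2 else 1))"
    proof (cases "2 * p = N")
      case True
      then have "N - p = p" by simp
      with True show ?thesis by simp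
    next
      case False
      then show ?thesis by (simp add: algebra_simps)
    qed
  qed
  also have "{..?n} = insert 0 {1..?n}" by auto
  also have "(\<Sum>p\<in>insert 0 {1..?n}. (w ^ (N - p) + w ^ p) * (c p * inverse (if 2 * p = N then 2 else 1)))
      = c 0 * (w ^ N + 1) + (\<Sum>p=1..?n. (w ^ (N - p) + w ^ p) * (c p * inverse (if 2 * p = N then 2 else 1)))"
    using assms(1) by simp
  finally show ?thesis .
qed

lemma lambda_expansion_Y_rat:
  assumes "N \<ge> 1" and d: "det (chain_mat N x 0) \<noteq> 0"
  shows "lambda_expansion N (chain_mat N x 0) (\<lambda>p. Y_rat N p x)"
  unfolding lambda_expansion_iff[OF chain_mat_carrier d]
proof (intro allI impI)
  fix w :: complex
  let ?c = "coeff (congruence_poly N x)" and ?d = "det (chain_mat N x 0)"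
  have "?c 0 = poly (congruence_poly N x) 0" by (simp add: poly_0_coeff_0)
  also have "\<dots> = ?d"
  proof -
    have "0 \<cdot>\<^sub>m chain_mat N x 0 + transpose_mat (chain_mat N x 0) = transpose_mat (chain_mat N x 0)"
      by (intro eq_matI) auto
    then show ?thesis unfolding poly_congruence_poly by (simp add: det_transpose[OF chain_mat_carrier])
  qed
  finally have c0: "?c 0 = ?d" .
  have "det (w \<cdot>\<^sub>m chain_mat N x 0 + transpose_mat (chain_mat N x 0)) = (\<Sum>i\<le>N. ?c i * w ^ i)"
    unfolding poly_congruence_poly[symmetric] by (rule poly_eq_sum) (rule degree_congruence_poly)
  also have "\<dots> = ?c 0 * (w ^ N + 1)
      + (\<Sum>p=1..N div 2. (w ^ (N - p) + w ^ p) * (?c p * inverse (if 2 * p = N then 2 else 1)))"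
    by (rule sum_palindromic[OF assms(1)], rule coeff_congruence_poly_sym)
  also have "\<dots> = ?d * expansion N (\<lambda>p. Y_rat N p x) w"
  proof -
    have "?c p * inverse (if 2 * p = N then 2 else 1) = ?d * Y_rat N p x" for p
      using d by (simp add: Y_rat_def)
    then show ?thesis
      unfolding expansion_def distrib_left[of ?d "w ^ N + 1"] sum_distrib_left c0
      by (simp only: mult.left_commute[of ?d])
  qed
  finally show "det (w \<cdot>\<^sub>m chain_mat N x 0 + transpose_mat (chain_mat N x 0)) = \<dots>" .
qed

lemma Y_fun_eq_Y_rat:
  assumes "det (chain_mat N x 0) \<noteq> 0" "p \<in> {1..N div 2}"
  shows "Y_fun N p x = Y_rat N p x"
  by (rule Y_fun_unique[OF assms(1) lambda_expansion_Y_rat[OF _ assms(1)] assms(2)]) (use assms(2) in auto)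

theorem lambda_expansion_Y_fun:
  assumes "N \<ge> 1" "det (chain_mat N x 0) \<noteq> 0"
  shows "lambda_expansion N (chain_mat N x 0) (\<lambda>p. Y_fun N p x)"
proof -
  have "expansion N (\<lambda>p. Y_fun N p x) w = expansion N (\<lambda>p. Y_rat N p x) w" for w
    unfolding expansion_def using Y_fun_eq_Y_rat[OF assms(2)] by simp
  then show ?thesis
    using lambda_expansion_Y_rat[OF assms] unfolding lambda_expansion_iff[OF chain_mat_carrier assms(2)]
    by simp
qed

lemma polyfun_coeff_congruence_poly: "polyfun (coords N j) (\<lambda>x. coeff (congruence_poly N x) p)"
proof -
  have "\<forall>i. polyfun (coords N j) (\<lambda>x. coeff (congruence_poly N x) i)"
    unfolding congruence_poly_def
  proof (rule poly_coeff.det, rule allI)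
    fix a b i assume ab: "a < N" "b < N"
    have "(\<lambda>x :: point. coeff [:x (0, b, a), x (0, a, b):] i)
        = (\<lambda>x. if i = 0 then x (0, b, a) else if i = 1 then x (0, a, b) else 0)"
      by (auto simp: fun_eq_iff coeff_pCons split: nat.split)
    moreover have "polyfun (coords N j)
        (\<lambda>x. if i = 0 then x (0, b, a) else if i = 1 then x (0, a, b) else 0)"
      using ab by (cases "i = 0"; cases "i = 1") (simp_all add: polyfun_coord polyfun_const)
    ultimately show "polyfun (coords N j) (\<lambda>x. coeff [:x (0, b, a), x (0, a, b):] i)"
      by (simp only:)
  qed
  then show ?thesis ..
qed

lemma rational_Y_fun:
  assumes "p \<in> {1..N div 2}"
  shows "rational_function (coords N j) (Y_fun N p)"
proof (rule rational_function_cong)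
  show "rational_function (coords N j) (Y_rat N p)"
    unfolding Y_rat_def
    by (intro rational.mult rational_function_inverse rational_det_chain_mat rational.const
        rational_function_polyfun[OF polyfun_coeff_congruence_poly]) simp
  show "generically (coords N j) (\<lambda>x. Y_fun N p x = Y_rat N p x)"
    by (rule generically_mono[OF generically_chain_nonsingular[of N j]])
       (rule Y_fun_eq_Y_rat[OF _ assms], simp)
qed

lemma smooth_Y_fun:
  assumes "p \<in> {1..N div 2}" "det (chain_mat N x 0) \<noteq> 0"
  shows "smooth_pt (coords N j) x (Y_fun N p)"
proof (rule smooth_pt_cong[of _ _ "Y_rat N p" "\<lambda>x. det (chain_mat N x 0)"])
  have d: "smooth_pt (coords N j) x (\<lambda>x. det (chain_mat N x 0))"
    by (rule smooth_det_chain_mat) simp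
  then show "smooth_pt (coords N j) x (\<lambda>x. det (chain_mat N x 0))" .
  show "smooth_pt (coords N j) x (Y_rat N p)"
    unfolding Y_rat_def
    by (intro smooth.mult smooth_pt_inverse smooth.const d
        smooth_pt_polyfun[OF finite_coords polyfun_coeff_congruence_poly])
       (use assms(2) in simp)
qed (use assms Y_fun_eq_Y_rat in auto)

text \<open>Both the determinant of w A + A^T and det A gain the factor (det g)^2, so the old
  coefficients satisfy the new expansion, and uniqueness identifies them.\<close>

lemma Y_fun_congruence:
  assumes g: "g \<in> carrier_mat N N" "det g \<noteq> 0" and d: "det (chain_mat N x 0) \<noteq> 0"
    and y: "chain_mat N y 0 = g * chain_mat N x 0 * transpose_mat g"
    and p: "p \<in> {1..N div 2}"
  shows "Y_fun N p y = Y_fun N p x"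
proof -
  let ?A = "chain_mat N x 0" and ?A' = "chain_mat N y 0"
  have N: "N \<ge> 1" using p by auto
  have gA: "g * ?A \<in> carrier_mat N N" using g by simp
  have det: "det (g * M * transpose_mat g) = (det g)\<^sup>2 * det M" if "M \<in> carrier_mat N N" for M
  proof -
    have "det (g * M * transpose_mat g) = det (g * M) * det (transpose_mat g)"
      by (rule det_mult) (use g that in simp_all)
    also have "\<dots> = (det g * det M) * det g"
      using det_mult[OF g(1) that] det_transpose[OF g(1)] by simp
    finally show ?thesis by (simp add: power2_eq_square)
  qed
  have d': "det ?A' \<noteq> 0" using d g by (simp add: y det)
  have "w \<cdot>\<^sub>m ?A' + transpose_mat ?A' = g * (w \<cdot>\<^sub>m ?A + transpose_mat ?A) * transpose_mat g" for w
  proof -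
    have gT: "transpose_mat g \<in> carrier_mat N N" and AT: "transpose_mat ?A \<in> carrier_mat N N"
      and gAT: "g * transpose_mat ?A \<in> carrier_mat N N"
      using g by simp_all
    have "transpose_mat ?A' = g * transpose_mat (g * ?A)"
      unfolding y using transpose_mult[OF gA gT] by simp
    also have "\<dots> = g * (transpose_mat ?A * transpose_mat g)"
      using transpose_mult[OF g(1) chain_mat_carrier] by simp
    also have "\<dots> = g * transpose_mat ?A * transpose_mat g"
      using assoc_mult_mat[OF g(1) AT gT] by simp
    finally have t: "transpose_mat ?A' = g * transpose_mat ?A * transpose_mat g" .
    have "g * (w \<cdot>\<^sub>m ?A + transpose_mat ?A) = w \<cdot>\<^sub>m (g * ?A) + g * transpose_mat ?A"
      using mult_add_distrib_mat[OF g(1) smult_carrier_mat[OF chain_mat_carrier] AT, of w]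
        mult_smult_distrib[OF g(1) chain_mat_carrier] by simp
    then have "g * (w \<cdot>\<^sub>m ?A + transpose_mat ?A) * transpose_mat g
        = w \<cdot>\<^sub>m (g * ?A * transpose_mat g) + g * transpose_mat ?A * transpose_mat g"
      using add_mult_distrib_mat[OF smult_carrier_mat[OF gA] gAT gT, of w]
        mult_smult_assoc_mat[OF gA gT] by simp
    then show ?thesis unfolding t by (simp only: y)
  qed
  then have e: "det (w \<cdot>\<^sub>m ?A' + transpose_mat ?A') = (det g)\<^sup>2 * det (w \<cdot>\<^sub>m ?A + transpose_mat ?A)" for w
    by (simp add: det)
  have "lambda_expansion N ?A' (\<lambda>p. Y_fun N p x)"
    using lambda_expansion_Y_fun[OF N d]
    unfolding lambda_expansion_iff[OF chain_mat_carrier d] lambda_expansion_iff[OF chain_mat_carrier d'] e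
    unfolding y by (simp add: det)
  from Y_fun_unique[OF d' this p] show ?thesis .
qed

text \<open>The straight line \<open>flow\<close> need not stay in a congruence class; it is only
  tangent to one. The curve through congruences by 1 + tW has the same velocity, and Y_p is constant
  along it while 1 + tW is invertible.\<close>

lemma (in hamiltonian_field) Y_fun_flow:
  assumes p: "p \<in> {1..N div 2}"
  shows "((\<lambda>t. Y_fun N p (flow t)) has_field_derivative 0) (at 0)"
proof -
  have d: "det (B 0) \<noteq> 0" by (rule nonsingular) simp
  obtain g where g: "has_gradient (coords N j) (Y_fun N p) x g"
    using smooth_Y_fun[OF p d] by (rule smooth_ptE)
  obtain W where W: "W \<in> carrier_mat N N" "Xi 0 = W * B 0 + B 0 * transpose_mat W"
    using Xi_0_congruence by blast
  have flow: "((\<lambda>t. Y_fun N p (flow t)) has_field_derivative (\<Sum>u\<in>coords N j. g u * field u)) (at 0)"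
    by (rule has_gradientD[OF g, of flow field]) (simp_all add: flow_deriv)
  define h where "h t = 1\<^sub>m N + t \<cdot>\<^sub>m W" for t
  define G where "G t = h t * B 0 * transpose_mat (h t)" for t
  \<comment> \<open>Coordinates outside A keep following \<open>flow\<close>, since the velocities
    of the two curves have to agree in every coordinate.\<close>
  define \<gamma> where "\<gamma> t u = (case u of (k, a, b) \<Rightarrow> if k = 0 \<and> a < N \<and> b < N then G t $$ (a, b) else flow t u)" for t u
  have h: "h t \<in> carrier_mat N N" "h 0 = 1\<^sub>m N" for t
    using W(1) by (auto simp: h_def)
  have dh: "mat_deriv N h W"
    unfolding mat_deriv_def
  proof (intro allI impI)
    fix a b assume ab: "a < N" "b < N"
    have "(\<lambda>t. h t $$ (a, b)) = (\<lambda>t. 1\<^sub>m N $$ (a, b) + t * W $$ (a, b))"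
      using ab W(1) by (auto simp: h_def fun_eq_iff)
    then show "((\<lambda>t. h t $$ (a, b)) has_field_derivative W $$ (a, b)) (at 0)"
      by (auto intro!: derivative_eq_intros)
  qed
  have dB: "mat_deriv N (\<lambda>t. B 0) (0\<^sub>m N N)" by (simp add: mat_deriv_def)
  have hB: "h t * B 0 \<in> carrier_mat N N" for t using h(1)[of t] by simp
  have dhB: "mat_deriv N (\<lambda>t. h t * B 0) (W * B 0)"
    using mat_deriv_mult[OF h(1) chain_mat_carrier W(1) _ dh dB] W(1) by (simp add: h(2))
  have dG: "mat_deriv N G (Xi 0)"
    unfolding G_def W(2)
    using mat_deriv_mult[OF hB _ _ _ dhB mat_deriv_transpose[OF h(1) W(1) dh]] h W(1)
    by (simp add: h(2))
  have G0: "G 0 = B 0" by (simp add: G_def h(2) left_mult_one_mat[of _ N N] right_mult_one_mat[of _ N N])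
  have gamma0: "\<gamma> 0 = x" by (auto simp: \<gamma>_def G0 fun_eq_iff)
  have gamma: "((\<lambda>t. Y_fun N p (\<gamma> t)) has_field_derivative (\<Sum>u\<in>coords N j. g u * field u)) (at 0)"
  proof (rule has_gradientD[OF g, of \<gamma> field])
    show "\<gamma> 0 = x" by (rule gamma0)
    fix u :: coord
    obtain k a b where u: "u = (k, a, b)" by (cases u)
    show "((\<lambda>t. \<gamma> t u) has_field_derivative field u) (at 0)"
    proof (cases "k = 0 \<and> a < N \<and> b < N")
      case True
      have "(\<lambda>t. \<gamma> t u) = (\<lambda>t. G t $$ (a, b))" using True by (simp add: \<gamma>_def u)
      moreover have "Xi 0 $$ (a, b) = field u" using True by (simp add: Xi_def u)
      ultimately show ?thesis using mat_derivD[OF dG, of a b] True by simp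
    next
      case False
      then have "(\<lambda>t. \<gamma> t u) = (\<lambda>t. flow t u)" by (auto simp: \<gamma>_def u)
      then show ?thesis using flow_deriv by simp
    qed
  qed
  have cont: "isCont (\<lambda>t. det (h t)) 0"
  proof -
    have "smooth_pt ({..<N} \<times> {..<N}) (\<lambda>(a, b). 1\<^sub>m N $$ (a, b)) (\<lambda>y. det (mat N N (\<lambda>(a, b). y (a, b))))"
      by (rule smooth.det, rule smooth_pt_coord) auto
    then obtain g' where g': "has_gradient ({..<N} \<times> {..<N})
        (\<lambda>y. det (mat N N (\<lambda>(a, b). y (a, b)))) (\<lambda>(a, b). 1\<^sub>m N $$ (a, b)) g'" by (rule smooth_ptE)
    define \<eta> where "\<eta> t = (\<lambda>(a, b). 1\<^sub>m N $$ (a, b) + t * W $$ (a, b))" for t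
    have "((\<lambda>t. det (mat N N (\<lambda>(a, b). \<eta> t (a, b)))) has_field_derivative
        (\<Sum>u\<in>{..<N} \<times> {..<N}. g' u * W $$ u)) (at 0)"
    proof (rule has_gradientD[OF g', of \<eta>])
      show "\<eta> 0 = (\<lambda>(a, b). 1\<^sub>m N $$ (a, b))" by (auto simp: \<eta>_def)
      show "((\<lambda>t. \<eta> t u) has_field_derivative W $$ u) (at 0)" for u
        by (cases u) (auto simp: \<eta>_def intro!: derivative_eq_intros)
    qed
    moreover have "mat N N (\<lambda>(a, b). \<eta> t (a, b)) = h t" for t
      using W(1) by (intro eq_matI) (auto simp: \<eta>_def h_def)
    ultimately show ?thesis using DERIV_isCont by auto
  qed
  then have "((\<lambda>t. det (h t)) \<longlongrightarrow> det (h 0)) (nhds 0)"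
    unfolding isCont_def by (rule tendsto_at_iff_tendsto_nhds[of "\<lambda>t. det (h t)", THEN iffD1])
  then have "eventually (\<lambda>t. det (h t) \<noteq> 0) (nhds 0)"
    by (rule tendsto_imp_eventually_ne) (simp add: h(2))
  then have "eventually (\<lambda>t. Y_fun N p (\<gamma> t) = Y_fun N p x) (nhds 0)"
  proof (rule eventually_mono)
    fix t assume ht: "det (h t) \<noteq> 0"
    have "chain_mat N (\<gamma> t) 0 = G t"
      using h(1)[of t] by (intro eq_matI) (auto simp: \<gamma>_def G_def)
    then show "Y_fun N p (\<gamma> t) = Y_fun N p x"
      by (intro Y_fun_congruence[OF h(1) ht d _ p]) (simp add: G_def)
  qed
  then have "((\<lambda>t. Y_fun N p (\<gamma> t)) has_field_derivative 0) (at 0)"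
    using DERIV_cong_ev[OF refl _ refl, of "\<lambda>t. Y_fun N p (\<gamma> t)" "\<lambda>t. Y_fun N p x" 0 0] by simp
  from DERIV_unique[OF gamma this] flow show ?thesis by simp
qed

theorem casimir_Y_fun:
  assumes "p \<in> {1..N div 2}"
  shows "casimir N j (Y_fun N p)"
proof (rule casimirI)
  show "rational_function (coords N j) (Y_fun N p)" by (rule rational_Y_fun[OF assms])
  show "smooth_pt (coords N j) x (Y_fun N p)" if "\<And>k. k \<le> j \<Longrightarrow> det (chain_mat N x k) \<noteq> 0" for x
    by (rule smooth_Y_fun[OF assms that]) simp
  show "((\<lambda>t. Y_fun N p (hamiltonian_field.flow N l c d x t)) has_field_derivative 0) (at 0)"
    if "hamiltonian_field N j l c d x" for x l c d
    by (rule hamiltonian_field.Y_fun_flow[OF that assms])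
qed

section \<open>Algebraic independence\<close>

text \<open>A point x is chosen whose value tuple is not a zero of p. On the line from x to a point
  z off the exceptional set, a generic relation holds for all small nonzero parameters; smoothness
  at x makes the relation hold at x as well, a contradiction.\<close>

lemma algebraically_independentI:
  fixes F :: "'i \<Rightarrow> ('v \<Rightarrow> complex) \<Rightarrow> complex"
  assumes fin: "finite I"
    and surj: "\<And>y. (\<And>i. y i \<noteq> 0) \<Longrightarrow> \<exists>x. (\<forall>i\<in>I. F i x = y i) \<and> (\<forall>i\<in>I. smooth_pt V x (F i))"
  shows "algebraically_independent V I F"
  unfolding algebraically_independent_def
proof (intro allI impI, elim conjE)
  fix p :: "'i cpoly" assume p: "p \<noteq> 0" "cpoly_vars p \<subseteq> I"
  obtain y1 where y1: "cpoly_eval p y1 \<noteq> 0" using cpoly_nonzero_point[OF p(1)] ..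
  \<comment> \<open>Moving in the direction (1, ..., 1) excludes only finitely many t, and the tuple
    can be given nonzero coordinates while p stays nonzero.\<close>
  obtain r where r: "cpoly_eval p (\<lambda>i. y1 i + t * 1) = poly r t" for t
    using cpoly_eval_along_line[of p y1 "\<lambda>i. 1"] by auto
  have "poly r 0 \<noteq> 0" using r[of 0] y1 by simp
  then have "r \<noteq> 0" by auto
  then have "finite ({t. poly r t = 0} \<union> (\<lambda>i. - y1 i) ` I)" using fin poly_roots_finite by auto
  then obtain t where t: "t \<notin> {t. poly r t = 0} \<union> (\<lambda>i. - y1 i) ` I"
    using ex_new_if_finite[OF infinite_UNIV_char_0] by blast
  define y where "y i = (if i \<in> I then y1 i + t else 1)" for i
  have y0: "y i \<noteq> 0" for i
  proof (cases "i \<in> I")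
    case True
    then have "- y1 i \<noteq> t" using t by auto
    then have "y1 i + t \<noteq> 0" by (metis minus_unique)
    with True show ?thesis by (simp add: y_def)
  qed (simp add: y_def)
  have "cpoly_eval p y = cpoly_eval p (\<lambda>i. y1 i + t * 1)"
    by (rule cpoly_eval_cong) (use p(2) in \<open>auto simp: y_def\<close>)
  then have py: "cpoly_eval p y \<noteq> 0" using r[of t] t by simp
  have "\<exists>x. (\<forall>i\<in>I. F i x = y i) \<and> (\<forall>i\<in>I. smooth_pt V x (F i))"
    by (rule surj) (rule y0)
  then obtain x where x: "\<And>i. i \<in> I \<Longrightarrow> F i x = y i" "\<And>i. i \<in> I \<Longrightarrow> smooth_pt V x (F i)"
    by auto
  show "\<not> generically V (\<lambda>x. cpoly_eval p (\<lambda>i. F i x) = 0)"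
  proof
    assume "generically V (\<lambda>x. cpoly_eval p (\<lambda>i. F i x) = 0)"
    then obtain q where q: "q \<noteq> 0" "\<And>x. cpoly_eval q x \<noteq> 0 \<Longrightarrow> cpoly_eval p (\<lambda>i. F i x) = 0"
      unfolding generically_def by auto
    obtain z where z: "cpoly_eval q z \<noteq> 0" using cpoly_nonzero_point[OF q(1)] ..
    define \<gamma> where "\<gamma> t v = x v + t * (z v - x v)" for t v
    have ev0: "eventually (\<lambda>t. cpoly_eval p (\<lambda>i. F i (\<gamma> t)) = 0) (at 0)"
      using cpoly_eventually_nonzero[OF z, of x]
    proof (rule eventually_mono)
      fix t assume "cpoly_eval q (\<lambda>v. x v + t * (z v - x v)) \<noteq> 0"
      then have "cpoly_eval q (\<gamma> t) \<noteq> 0" unfolding \<gamma>_def[abs_def] .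
      then show "cpoly_eval p (\<lambda>i. F i (\<gamma> t)) = 0" by (rule q(2))
    qed
    have "smooth_pt V x (\<lambda>x. \<Sum>m\<in>Poly_Mapping.keys p. Poly_Mapping.lookup p m *
        (\<Prod>v\<in>Poly_Mapping.keys m. F v x ^ Poly_Mapping.lookup m v))"
    proof (intro smooth.sum smooth.mult smooth.const smooth.prod smooth.power)
      fix m v assume "m \<in> Poly_Mapping.keys p" "v \<in> Poly_Mapping.keys m"
      then have "v \<in> I" using p(2) by (auto simp: cpoly_vars_def)
      then show "smooth_pt V x (F v)" by (rule x(2))
    qed
    then have "smooth_pt V x (\<lambda>x. cpoly_eval p (\<lambda>i. F i x))"
      unfolding cpoly_eval_def .
    then obtain g where g: "has_gradient V (\<lambda>x. cpoly_eval p (\<lambda>i. F i x)) x g" by (rule smooth_ptE)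
    have "((\<lambda>t. cpoly_eval p (\<lambda>i. F i (\<gamma> t))) has_field_derivative (\<Sum>u\<in>V. g u * (z u - x u))) (at 0)"
    proof (rule has_gradientD[OF g, of \<gamma> "\<lambda>u. z u - x u"])
      show "\<gamma> 0 = x" by (simp add: \<gamma>_def fun_eq_iff)
      show "((\<lambda>t. \<gamma> t u) has_field_derivative z u - x u) (at 0)" for u
        unfolding \<gamma>_def by (auto intro!: derivative_eq_intros)
    qed
    then have "isCont (\<lambda>t. cpoly_eval p (\<lambda>i. F i (\<gamma> t))) 0" by (rule DERIV_isCont)
    then have lim: "((\<lambda>t. cpoly_eval p (\<lambda>i. F i (\<gamma> t))) \<longlongrightarrow> cpoly_eval p (\<lambda>i. F i (\<gamma> 0))) (at 0)"
      by (simp add: isCont_def)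
    have "\<gamma> 0 = x" by (simp add: \<gamma>_def fun_eq_iff)
    moreover have "cpoly_eval p (\<lambda>i. F i x) = cpoly_eval p y"
      by (rule cpoly_eval_cong) (use p(2) x(1) in auto)
    ultimately have "cpoly_eval p (\<lambda>i. F i (\<gamma> 0)) \<noteq> 0" using py by simp
    from tendsto_imp_eventually_ne[OF lim, OF this] ev0
    have "eventually (\<lambda>t::complex. False) (at 0)" by eventually_elim simp
    then show False by simp
  qed
qed

text \<open>Two equal members of the family would satisfy the linear relation y_i - y_i' = 0. This
  allows the final count to be one of functions rather than of indices.\<close>

lemma algebraically_independent_inj_on:
  fixes F :: "'i \<Rightarrow> ('v \<Rightarrow> complex) \<Rightarrow> complex"
  assumes "algebraically_independent V I F"
  shows "inj_on F I"
proof (rule inj_onI, rule ccontr)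
  fix i i' assume i: "i \<in> I" "i' \<in> I" "F i = F i'" "i \<noteq> i'"
  let ?m = "\<lambda>k. Poly_Mapping.single k 1 :: 'i \<Rightarrow>\<^sub>0 nat"
  define p where "p = Poly_Mapping.single (?m i) 1 + Poly_Mapping.single (?m i') (- 1 :: complex)"
  have eval: "cpoly_eval p y = y i - y i'" for y
    by (simp add: p_def cpoly_eval_add cpoly_eval_single monomial_eval_def)
  have "cpoly_eval p (\<lambda>k. if k = i then 1 else 0) \<noteq> 0" using i(4) by (simp add: eval)
  then have "p \<noteq> 0" by auto
  moreover have "cpoly_vars p \<subseteq> I"
  proof -
    have "cpoly_vars p \<subseteq> Poly_Mapping.keys (?m i) \<union> Poly_Mapping.keys (?m i')"
      unfolding p_def by (intro order_trans[OF cpoly_vars_add] Un_mono cpoly_vars_single)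
    then show ?thesis using i(1,2) by auto
  qed
  ultimately have "\<not> generically V (\<lambda>x. cpoly_eval p (\<lambda>k. F k x) = 0)"
    using assms unfolding algebraically_independent_def by simp
  moreover have "generically V (\<lambda>x. cpoly_eval p (\<lambda>k. F k x) = 0)"
    by (rule generically_mono[OF generically_True]) (simp add: eval i(3))
  ultimately show False by simp
qed

section \<open>Antidiagonal matrices\<close>

definition antidiag :: "nat \<Rightarrow> (nat \<Rightarrow> complex) \<Rightarrow> complex mat" where
  "antidiag N h = mat N N (\<lambda>(a, b). if Suc (a + b) = N then h a else 0)"

definition diag :: "nat \<Rightarrow> (nat \<Rightarrow> complex) \<Rightarrow> complex mat" where
  "diag N h = mat N N (\<lambda>(a, b). if a = b then h a else 0)"

text \<open>The sign of the order-reversing permutation, kept symbolic: it enters only through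
  nonzero constants.\<close>

definition eps :: "nat \<Rightarrow> complex" where
  "eps q = det (antidiag q (\<lambda>a. 1))"

lemma antidiag_carrier [simp]: "antidiag N h \<in> carrier_mat N N"
  by (simp add: antidiag_def)

lemma diag_carrier [simp]: "diag N h \<in> carrier_mat N N"
  by (simp add: diag_def)

lemma diag_cong: "(\<And>a. a < N \<Longrightarrow> f a = g a) \<Longrightarrow> diag N f = diag N g"
  by (rule eq_matI) (auto simp: diag_def)

lemma transpose_antidiag: "transpose_mat (antidiag N h) = antidiag N (\<lambda>a. h (N - Suc a))"
proof (rule eq_matI)
  fix a b assume "a < dim_row (antidiag N (\<lambda>a. h (N - Suc a)))" "b < dim_col (antidiag N (\<lambda>a. h (N - Suc a)))"
  then have ab: "a < N" "b < N" by (simp_all add: antidiag_def)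
  show "transpose_mat (antidiag N h) $$ (a, b) = antidiag N (\<lambda>a. h (N - Suc a)) $$ (a, b)"
  proof (cases "Suc (a + b) = N")
    case True
    then have "b = N - Suc a" "Suc (b + a) = N" by simp_all
    then show ?thesis using ab by (simp add: antidiag_def)
  next
    case False
    then show ?thesis using ab by (simp add: antidiag_def add.commute)
  qed
qed (simp_all add: antidiag_def)

lemma diag_mult:
  assumes "M \<in> carrier_mat N N"
  shows "diag N h * M = mat N N (\<lambda>(a, b). h a * M $$ (a, b))"
proof (rule eq_matI)
  fix a b assume "a < dim_row (mat N N (\<lambda>(a, b). h a * M $$ (a, b)))"
    "b < dim_col (mat N N (\<lambda>(a, b). h a * M $$ (a, b)))"
  then have ab: "a < N" "b < N" by simp_all
  have "(diag N h * M) $$ (a, b) = (\<Sum>e<N. if e = a then h a * M $$ (a, b) else 0)"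
    unfolding mult_mat_index[OF diag_carrier assms ab]
    by (intro sum.cong refl) (use ab in \<open>auto simp: diag_def\<close>)
  then show "(diag N h * M) $$ (a, b) = mat N N (\<lambda>(a, b). h a * M $$ (a, b)) $$ (a, b)"
    using ab by simp
qed (use assms in \<open>auto simp: diag_def\<close>)

lemma antidiag_mult:
  assumes "M \<in> carrier_mat N N"
  shows "antidiag N h * M = mat N N (\<lambda>(a, b). h a * M $$ (N - Suc a, b))"
proof (rule eq_matI)
  fix a b assume "a < dim_row (mat N N (\<lambda>(a, b). h a * M $$ (N - Suc a, b)))"
    "b < dim_col (mat N N (\<lambda>(a, b). h a * M $$ (N - Suc a, b)))"
  then have ab: "a < N" "b < N" by simp_all
  have "(antidiag N h * M) $$ (a, b) = (\<Sum>e<N. if e = N - Suc a then h a * M $$ (N - Suc a, b) else 0)"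
    unfolding mult_mat_index[OF antidiag_carrier assms ab]
  proof (intro sum.cong refl)
    fix e assume "e \<in> {..<N}"
    then have "Suc (a + e) = N \<longleftrightarrow> e = N - Suc a" using ab by auto
    then show "antidiag N h $$ (a, e) * M $$ (e, b) = (if e = N - Suc a then h a * M $$ (N - Suc a, b) else 0)"
      using ab \<open>e \<in> {..<N}\<close> by (simp add: antidiag_def)
  qed
  then show "(antidiag N h * M) $$ (a, b) = mat N N (\<lambda>(a, b). h a * M $$ (N - Suc a, b)) $$ (a, b)"
    using ab by simp
qed (use assms in \<open>auto simp: antidiag_def\<close>)

lemma diag_antidiag: "diag N h * antidiag N g = antidiag N (\<lambda>a. h a * g a)"
  unfolding diag_mult[OF antidiag_carrier] by (intro eq_matI) (auto simp: antidiag_def)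

lemma antidiag_antidiag: "antidiag N h * antidiag N g = diag N (\<lambda>a. h a * g (N - Suc a))"
proof (rule eq_matI)
  fix a b assume "a < dim_row (diag N (\<lambda>a. h a * g (N - Suc a)))" "b < dim_col (diag N (\<lambda>a. h a * g (N - Suc a)))"
  then have ab: "a < N" "b < N" by (simp_all add: diag_def)
  then have "Suc (N - Suc a + b) = N \<longleftrightarrow> a = b" by auto
  then show "(antidiag N h * antidiag N g) $$ (a, b) = diag N (\<lambda>a. h a * g (N - Suc a)) $$ (a, b)"
    unfolding antidiag_mult[OF antidiag_carrier] using ab by (simp add: antidiag_def diag_def)
qed (simp_all add: antidiag_def diag_def)

lemma diag_one: "diag N (\<lambda>a. 1) = 1\<^sub>m N"
  by (rule eq_matI) (auto simp: diag_def)

lemma det_diag: "det (diag N h) = (\<Prod>a<N. h a)"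
proof -
  have "det (diag N h) = (\<Prod>a<N. diag N h $$ (a, a))"
    by (rule det_lower_tri) (auto simp: lower_tri_def diag_def)
  then show ?thesis by (simp add: diag_def)
qed

lemma det_antidiag: "det (antidiag N h) = eps N * (\<Prod>a<N. h a)"
proof -
  have "antidiag N h = diag N h * antidiag N (\<lambda>a. 1)" by (simp add: diag_antidiag)
  then show ?thesis
    using det_mult[OF diag_carrier antidiag_carrier, of N h "\<lambda>a. 1"] by (simp add: det_diag eps_def mult.commute)
qed

lemma eps_nonzero: "eps N \<noteq> 0"
proof -
  have "antidiag N (\<lambda>a. 1) * antidiag N (\<lambda>a. 1) = 1\<^sub>m N"
    unfolding antidiag_antidiag by (simp add: diag_one)
  then have "det (antidiag N (\<lambda>a. 1)) * det (antidiag N (\<lambda>a. 1)) = 1"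
    using det_mult[OF antidiag_carrier antidiag_carrier, of N "\<lambda>a. 1" "\<lambda>a. 1"] by simp
  then show ?thesis by (auto simp: eps_def)
qed

lemma upper_right_minor_antidiag:
  assumes "q \<le> N"
  shows "upper_right_minor q (antidiag N h) = eps q * (\<Prod>a<q. h a)"
proof -
  have "mat q q (\<lambda>(a, b). antidiag N h $$ (a, dim_col (antidiag N h) - q + b)) = antidiag q h"
    using assms by (intro eq_matI) (auto simp: antidiag_def)
  then show ?thesis unfolding upper_right_minor_def by (simp add: det_antidiag)
qed

lemma upper_left_minor_diag:
  assumes "q \<le> N"
  shows "upper_left_minor q (diag N h) = (\<Prod>a<q. h a)"
proof -
  have "mat q q (\<lambda>(a, b). diag N h $$ (a, b)) = diag q h"
    using assms by (intro eq_matI) (auto simp: diag_def)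
  then show ?thesis unfolding upper_left_minor_def by (simp only: det_diag)
qed

lemma mat_inverse_unique:
  assumes A: "A \<in> carrier_mat n n" and C: "C \<in> carrier_mat n n" and AC: "A * C = 1\<^sub>m n"
  shows "the (mat_inverse A) = (C :: complex mat)"
proof -
  have "det A * det C = 1" using det_mult[OF A C] AC by simp
  then have d: "det A \<noteq> 0" by auto
  note inv = mat_inverse_nonsingular[OF A d]
  have "the (mat_inverse A) = the (mat_inverse A) * (A * C)" using inv(2) AC by simp
  also have "\<dots> = (the (mat_inverse A) * A) * C"
    using assoc_mult_mat[OF inv(2) A C] by simp
  also have "\<dots> = C" using inv(4) C by simp
  finally show ?thesis .
qed

lemma mat_inverse_antidiag:
  assumes "\<And>a. a < N \<Longrightarrow> h a \<noteq> 0"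
  shows "the (mat_inverse (antidiag N h)) = antidiag N (\<lambda>a. inverse (h (N - Suc a)))"
proof (rule mat_inverse_unique[OF antidiag_carrier antidiag_carrier])
  show "antidiag N h * antidiag N (\<lambda>a. inverse (h (N - Suc a))) = 1\<^sub>m N"
    unfolding antidiag_antidiag diag_one[symmetric]
    by (rule diag_cong) (use assms in simp)
qed

definition anti_point :: "nat \<Rightarrow> (nat \<Rightarrow> nat \<Rightarrow> complex) \<Rightarrow> point" where
  "anti_point N H = (\<lambda>(k, a, b). if Suc (a + b) = N then H k a else 0)"

lemma chain_mat_anti_point: "chain_mat N (anti_point N H) k = antidiag N (H k)"
  by (rule eq_matI) (auto simp: antidiag_def anti_point_def chain_mat_def)

lemma det_anti_point_nonzero:
  assumes "\<And>a. a < N \<Longrightarrow> H k a \<noteq> 0"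
  shows "det (chain_mat N (anti_point N H) k) \<noteq> 0"
  using assms by (simp add: chain_mat_anti_point det_antidiag eps_nonzero)

text \<open>The reversal matrix equals its own inverse and transpose, so each further factor just
  toggles between antidiagonal and diagonal form and carries along the entries of the transpose of
  A.\<close>

lemma S_chain_anti_point:
  assumes "\<And>i. i \<in> {1..k} \<Longrightarrow> H i = (\<lambda>a. 1)"
  shows "S_chain N (anti_point N H) k
    = (if even k then antidiag N (\<lambda>a. H 0 (N - Suc a)) else diag N (\<lambda>a. H 0 (N - Suc a)))"
  using assms
proof (induction k)
  case 0
  then show ?case by (simp add: chain_mat_anti_point transpose_antidiag)
next
  case (Suc k)
  have IH: "S_chain N (anti_point N H) k
      = (if even k then antidiag N (\<lambda>a. H 0 (N - Suc a)) else diag N (\<lambda>a. H 0 (N - Suc a)))"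
    by (rule Suc.IH) (use Suc.prems in simp)
  have "H (Suc k) = (\<lambda>a. 1)" by (rule Suc.prems) simp
  then have B: "chain_mat N (anti_point N H) (Suc k) = antidiag N (\<lambda>a. 1)"
    by (simp add: chain_mat_anti_point)
  show ?case
    by (cases "even k")
       (simp_all add: IH B mat_inverse_antidiag transpose_antidiag antidiag_antidiag diag_antidiag)
qed

section \<open>Prescribing the values of the functions\<close>

lemma prod_symmetric_pairs:
  fixes h :: "nat \<Rightarrow> complex"
  shows "(\<Prod>a<N. h a) = (\<Prod>a<N div 2. h a * h (N - Suc a)) * (if odd N then h (N div 2) else 1)"
proof -
  let ?n = "N div 2"
  have r: "(\<Prod>a\<in>{N - ?n..<N}. h a) = (\<Prod>a<?n. h (N - Suc a))"
    by (rule prod.reindex_bij_witness[of _ "\<lambda>a. N - Suc a" "\<lambda>a. N - Suc a"]) auto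
  have "(\<Prod>a<N. h a) = (\<Prod>a\<in>{..<N - ?n} \<union> {N - ?n..<N}. h a)"
    by (intro prod.cong) auto
  also have "\<dots> = (\<Prod>a<N - ?n. h a) * (\<Prod>a\<in>{N - ?n..<N}. h a)"
    by (rule prod.union_disjoint) auto
  also have "(\<Prod>a<N - ?n. h a) = (\<Prod>a<?n. h a) * (if odd N then h ?n else 1)"
  proof (cases "odd N")
    case True
    then have "N - ?n = Suc ?n" by (auto elim: oddE)
    then show ?thesis using True by simp
  next
    case False
    then have "N - ?n = ?n" by auto
    then show ?thesis using False by simp
  qed
  finally show ?thesis by (simp add: r prod.distrib mult_ac)
qed

text \<open>Chebyshev-like polynomials: \<open>w\<^sup>k (w + 1)\<^sup>o G\<^sub>k(w + 1/w) = w\<^sup>2\<^sup>k\<^sup>+\<^sup>o + 1\<close> for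
  the parity \<open>o\<close> of \<open>N\<close>.\<close>

fun cheb :: "bool \<Rightarrow> nat \<Rightarrow> complex poly" where
  "cheb o' 0 = (if o' then 1 else [:2:])"
| "cheb o' (Suc 0) = (if o' then [:-1, 1:] else [:0, 1:])"
| "cheb o' (Suc (Suc k)) = [:0, 1:] * cheb o' (Suc k) - cheb o' k"

lemma cheb_eval:
  assumes "w \<noteq> 0"
  shows "w ^ k * (if o' then w + 1 else 1) * poly (cheb o' k) (w + 1 / w) = w ^ (2 * k + of_bool o') + 1"
proof (induction o' k rule: cheb.induct)
  case (1 o')
  then show ?case by simp
next
  case (2 o')
  then show ?case
    using assms by (cases o') (simp_all add: field_simps power2_eq_square power3_eq_cube)
next
  case (3 o' k)
  let ?v = "w + 1 / w" and ?f = "if o' then w + 1 else 1"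
  have wv: "w * ?v = w\<^sup>2 + 1" using assms by (simp add: field_simps power2_eq_square)
  have "w ^ Suc (Suc k) * ?f * poly (cheb o' (Suc (Suc k))) ?v
      = (w * ?v) * (w ^ Suc k * ?f * poly (cheb o' (Suc k)) ?v) - w\<^sup>2 * (w ^ k * ?f * poly (cheb o' k) ?v)"
    by (simp add: power2_eq_square algebra_simps)
  also have "\<dots> = (w\<^sup>2 + 1) * (w ^ (2 * Suc k + of_bool o') + 1) - w\<^sup>2 * (w ^ (2 * k + of_bool o') + 1)"
    by (simp only: wv 3)
  also have "\<dots> = w ^ (2 * Suc (Suc k) + of_bool o') + 1"
    by (simp add: power2_eq_square algebra_simps)
  finally show ?case .
qed

text \<open>The exception is the constant 2 for k = 0 and even N, the counterpart of the doubled
  middle term of the expansion.\<close>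

lemma cheb_monic:
  "degree (cheb o' k) \<le> k \<and> (k > 0 \<or> o' \<longrightarrow> coeff (cheb o' k) k = 1)"
proof (induction o' k rule: cheb.induct)
  case (3 o' k)
  have "degree ([:0, 1:] * cheb o' (Suc k)) \<le> Suc (Suc k)"
    using degree_mult_le[of "[:0, 1:]" "cheb o' (Suc k)"] 3 by simp
  moreover have "degree (cheb o' k) \<le> Suc (Suc k)" using 3 by simp
  ultimately have "degree (cheb o' (Suc (Suc k))) \<le> Suc (Suc k)"
    unfolding cheb.simps by (rule degree_diff_le)
  moreover have "coeff (cheb o' (Suc (Suc k))) (Suc (Suc k)) = 1"
  proof -
    have "coeff (cheb o' k) (Suc (Suc k)) = 0" by (rule coeff_eq_0) (use 3 in simp)
    then show ?thesis using 3 by simp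
  qed
  ultimately show ?case by blast
qed auto

text \<open>With n = N div 2, dividing the palindromic expansion by w^n, and by w + 1 for odd N,
  leaves a monic polynomial g of degree n in w + 1/w. A root r of g contributes w (w + 1/w - r), a
  quadratic of the required shape with linear coefficient -r.\<close>

lemma expansion_factor:
  assumes "N \<ge> 1"
  shows "\<exists>u. \<forall>w. w \<noteq> 0 \<longrightarrow>
    expansion N y w = (\<Prod>a<N div 2. w\<^sup>2 + u a * w + 1) * (if odd N then w + 1 else 1)"
proof -
  let ?n = "N div 2" and ?o = "odd N"
  have N: "N = 2 * ?n + of_bool ?o" by (cases "odd N") (auto elim: oddE)
  define g where "g = cheb ?o ?n + (\<Sum>p=1..?n. smult (y p) (cheb ?o (?n - p)))"
  have deg: "degree (cheb ?o (?n - p)) \<le> ?n - p" for p using cheb_monic by blast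
  have "degree (\<Sum>p=1..?n. smult (y p) (cheb ?o (?n - p))) \<le> ?n"
    by (intro degree_sum_le order_trans[OF degree_smult_le] order_trans[OF deg]) auto
  then have dg: "degree g \<le> ?n"
    unfolding g_def using cheb_monic[of ?o ?n] by (intro degree_add_le) auto
  have cg: "coeff g ?n = 1"
  proof -
    have "coeff (cheb ?o (?n - p)) ?n = 0" if "p \<in> {1..?n}" for p
      by (rule coeff_eq_0, rule le_less_trans[OF deg]) (use that in auto)
    \<comment> \<open>\<open>N \<ge> 1\<close> rules out the non-monic case, in which n = 0 and N is
      even.\<close>
    moreover have "coeff (cheb ?o ?n) ?n = 1"
      using cheb_monic[of ?o ?n] assms N by (cases "?n > 0") auto
    ultimately show ?thesis by (simp add: g_def coeff_sum)
  qed
  then have dg': "degree g = ?n" using dg le_degree[of g ?n] by simp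
  obtain as where as: "smult (coeff g (degree g)) (\<Prod>a\<leftarrow>as. [:- a, 1:]) = g" "length as = degree g"
    using fundamental_theorem_algebra_factorized[of g] by blast
  have "g = (\<Prod>i<?n. [:- (as ! i), 1:])"
    using as unfolding dg' cg by (simp add: prod.list_conv_set_nth atLeast0LessThan)
  then have pg: "poly g v = (\<Prod>i<?n. v - as ! i)" for v by (simp add: poly_prod)
  have "expansion N y w = (\<Prod>a<?n. w\<^sup>2 + (- (as ! a)) * w + 1) * (if ?o then w + 1 else 1)"
    if w: "w \<noteq> 0" for w
  proof -
    let ?v = "w + 1 / w" and ?f = "if ?o then w + 1 else 1"
    have pair: "w ^ (N - p) + w ^ p = w ^ ?n * ?f * poly (cheb ?o (?n - p)) ?v" if "p \<le> ?n" for p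
    proof -
      have "w ^ ?n * ?f * poly (cheb ?o (?n - p)) ?v
          = w ^ p * (w ^ (?n - p) * ?f * poly (cheb ?o (?n - p)) ?v)"
        using that by (simp add: power_add[symmetric] mult.assoc[symmetric])
      also have "\<dots> = w ^ p * (w ^ (2 * (?n - p) + of_bool ?o) + 1)"
        by (simp only: cheb_eval[OF w])
      also have "\<dots> = w ^ (p + (2 * (?n - p) + of_bool ?o)) + w ^ p"
        by (simp only: distrib_left power_add mult_1_right)
      also have "p + (2 * (?n - p) + of_bool ?o) = N - p" using that N by linarith
      finally show ?thesis ..
    qed
    have "expansion N y w = (w ^ (N - 0) + w ^ 0) + (\<Sum>p=1..?n. (w ^ (N - p) + w ^ p) * y p)"
      by (simp add: expansion_def)
    also have "(\<Sum>p=1..?n. (w ^ (N - p) + w ^ p) * y p)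
        = (\<Sum>p=1..?n. w ^ ?n * ?f * poly (cheb ?o (?n - p)) ?v * y p)"
      by (intro sum.cong refl) (simp only: pair atLeastAtMost_iff)
    also have "w ^ (N - 0) + w ^ 0 = w ^ ?n * ?f * poly (cheb ?o (?n - 0)) ?v" by (rule pair) simp
    also have "w ^ ?n * ?f * poly (cheb ?o (?n - 0)) ?v
        + (\<Sum>p=1..?n. w ^ ?n * ?f * poly (cheb ?o (?n - p)) ?v * y p) = w ^ ?n * ?f * poly g ?v"
    proof -
      have "poly g ?v = poly (cheb ?o ?n) ?v + (\<Sum>p=1..?n. poly (cheb ?o (?n - p)) ?v * y p)"
        by (simp add: g_def poly_sum mult.commute)
      then show ?thesis by (simp only: distrib_left sum_distrib_left mult.assoc diff_zero)
    qed
    also have "\<dots> = (\<Prod>a<?n. w * (?v - as ! a)) * ?f"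
      by (simp add: pg prod.distrib)
    also have "(\<Prod>a<?n. w * (?v - as ! a)) = (\<Prod>a<?n. w\<^sup>2 + (- (as ! a)) * w + 1)"
      by (intro prod.cong refl) (use w in \<open>simp add: field_simps power2_eq_square\<close>)
    finally show ?thesis .
  qed
  then show ?thesis by (intro exI[of _ "\<lambda>a. - (as ! a)"]) blast
qed

text \<open>The number and its inverse are the two roots of z^2 - u z + 1, whose product is
  1.\<close>

lemma ratio_exists:
  fixes u :: complex
  shows "\<exists>r. r \<noteq> 0 \<and> r + inverse r = u"
proof -
  define s where "s = csqrt (u\<^sup>2 - 4)"
  have s: "s\<^sup>2 = u\<^sup>2 - 4" by (simp add: s_def)
  have p: "((u + s) / 2) * ((u - s) / 2) = 1"
    using s by (simp add: field_simps power2_eq_square)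
  then have "(u + s) / 2 \<noteq> 0" by auto
  moreover have "(u + s) / 2 + inverse ((u + s) / 2) = u"
    unfolding inverse_unique[OF p] by (simp add: field_simps)
  ultimately show ?thesis by (intro exI[of _ "(u + s) / 2"]) simp
qed

text \<open>The values of the \<open>Y\<^sub>p\<close> at an antidiagonal \<open>\<bbbA>\<close> depend only on the ratios of opposite entries.\<close>

lemma Y_fun_prescribed:
  assumes "N \<ge> 1"
  shows "\<exists>\<rho>. (\<forall>a. \<rho> a \<noteq> 0) \<and>
    (\<forall>H. (\<forall>a<N. H 0 a \<noteq> 0) \<longrightarrow> (\<forall>a<N div 2. H 0 (N - Suc a) = \<rho> a * H 0 a) \<longrightarrow>
      (\<forall>p\<in>{1..N div 2}. Y_fun N p (anti_point N H) = y p))"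
proof -
  from expansion_factor[OF assms, of y] obtain u where "\<forall>w. w \<noteq> 0 \<longrightarrow>
      expansion N y w = (\<Prod>a<N div 2. w\<^sup>2 + u a * w + 1) * (if odd N then w + 1 else 1)"
    by (rule exE)
  note u = this[rule_format]
  have "\<exists>\<rho>. \<forall>a. \<rho> a \<noteq> 0 \<and> \<rho> a + inverse (\<rho> a) = u a"
    by (rule choice) (rule allI, rule ratio_exists)
  then obtain \<rho> where "\<forall>a. \<rho> a \<noteq> 0 \<and> \<rho> a + inverse (\<rho> a) = u a" by (rule exE)
  then have rho: "\<And>a. \<rho> a \<noteq> 0" "\<And>a. \<rho> a + inverse (\<rho> a) = u a" by simp_all
  have "Y_fun N p (anti_point N H) = y p"
    if H: "\<And>a. a < N \<Longrightarrow> H 0 a \<noteq> 0" "\<And>a. a < N div 2 \<Longrightarrow> H 0 (N - Suc a) = \<rho> a * H 0 a"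
      and p: "p \<in> {1..N div 2}" for H p
  proof (rule Y_fun_unique[OF _ _ p])
    let ?A = "chain_mat N (anti_point N H) 0" and ?h = "H 0"
    show d: "det ?A \<noteq> 0" by (rule det_anti_point_nonzero) (rule H(1))
    show "lambda_expansion N ?A y"
      unfolding lambda_expansion_iff[OF chain_mat_carrier d]
    proof (intro allI impI)
      fix w :: complex assume w: "w \<noteq> 0"
      have "w \<cdot>\<^sub>m ?A + transpose_mat ?A = antidiag N (\<lambda>a. w * ?h a + ?h (N - Suc a))"
        unfolding chain_mat_anti_point transpose_antidiag by (intro eq_matI) (auto simp: antidiag_def)
      then have "det (w \<cdot>\<^sub>m ?A + transpose_mat ?A) = eps N * (\<Prod>a<N. w * ?h a + ?h (N - Suc a))"
        by (simp only: det_antidiag)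
      also have "(\<Prod>a<N. w * ?h a + ?h (N - Suc a))
          = (\<Prod>a<N div 2. (w * ?h a + ?h (N - Suc a)) * (w * ?h (N - Suc a) + ?h (N - Suc (N - Suc a))))
            * (if odd N then w * ?h (N div 2) + ?h (N - Suc (N div 2)) else 1)"
        by (rule prod_symmetric_pairs)
      also have "(\<Prod>a<N div 2. (w * ?h a + ?h (N - Suc a)) * (w * ?h (N - Suc a) + ?h (N - Suc (N - Suc a))))
          = (\<Prod>a<N div 2. (?h a * ?h (N - Suc a)) * (w\<^sup>2 + u a * w + 1))"
      proof (intro prod.cong refl)
        fix a assume "a \<in> {..<N div 2}"
        then have a: "a < N div 2" "N - Suc (N - Suc a) = a" by auto
        have "u a * \<rho> a = (\<rho> a)\<^sup>2 + 1"
          using rho(1)[of a] by (simp add: rho(2)[symmetric] power2_eq_square field_simps)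
        \<comment> \<open>Each pair of opposite entries contributes one quadratic factor; its linear
          coefficient is the ratio of the two entries plus the inverse of that ratio, while their
          product only scales it.\<close>
        then have "(w * ?h a + \<rho> a * ?h a) * (w * (\<rho> a * ?h a) + ?h a)
            = (?h a * (\<rho> a * ?h a)) * (w\<^sup>2 + 1) + ?h a * ?h a * w * (u a * \<rho> a)"
          by (simp add: power2_eq_square algebra_simps)
        then show "(w * ?h a + ?h (N - Suc a)) * (w * ?h (N - Suc a) + ?h (N - Suc (N - Suc a)))
            = (?h a * ?h (N - Suc a)) * (w\<^sup>2 + u a * w + 1)"
          by (simp add: a(2) H(2)[OF a(1)] algebra_simps)
      qed
      also have "(if odd N then w * ?h (N div 2) + ?h (N - Suc (N div 2)) else 1)
          = (if odd N then ?h (N div 2) else 1) * (if odd N then w + 1 else 1)"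
      proof (cases "odd N")
        case True
        then have "N - Suc (N div 2) = N div 2" by (auto elim: oddE)
        then show ?thesis using True by (simp add: algebra_simps)
      qed simp
      finally have "det (w \<cdot>\<^sub>m ?A + transpose_mat ?A)
          = eps N * ((\<Prod>a<N div 2. ?h a * ?h (N - Suc a)) * (if odd N then ?h (N div 2) else 1))
            * ((\<Prod>a<N div 2. w\<^sup>2 + u a * w + 1) * (if odd N then w + 1 else 1))"
        unfolding prod.distrib by (simp only: mult_ac)
      also have "\<dots> = det ?A * expansion N y w"
        by (simp only: chain_mat_anti_point det_antidiag prod_symmetric_pairs[of ?h N] u[OF w])
      finally show "det (w \<cdot>\<^sub>m ?A + transpose_mat ?A) = det ?A * expansion N y w" .
    qed
  qed
  then show ?thesis using rho(1) by blast
qed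

text \<open>Induction from the centre outwards: passing from p + 1 to p multiplies the product by
  the pair of entries at p and N - 1 - p. Only products of opposite entries occur, which stay free
  once their ratios are fixed.\<close>

lemma prod_symmetric_range:
  fixes e \<tau> :: "nat \<Rightarrow> complex"
  assumes base: "odd N \<Longrightarrow> e (N div 2) = \<tau> (N div 2)" "even N \<Longrightarrow> \<tau> (N div 2) = 1"
    and step: "\<And>a. a < N div 2 \<Longrightarrow> e a * e (N - Suc a) * \<tau> (Suc a) = \<tau> a"
    and p: "p \<le> N div 2"
  shows "(\<Prod>a=p..<N - p. e a) = \<tau> p"
  using p
proof (induction p rule: inc_induct)
  case base
  show ?case
  proof (cases "odd N")
    case True
    then have "N - N div 2 = Suc (N div 2)" by (auto elim: oddE)
    then show ?thesis using assms(1)[OF True] by simp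
  next
    case False
    then have "N - N div 2 = N div 2" by auto
    then show ?thesis using assms(2) False by simp
  qed
next
  case (step p)
  then have p: "p < N div 2" by simp
  then have r: "N - p = Suc (N - Suc p)" "Suc p \<le> N - Suc p" by auto
  have "(\<Prod>a=p..<N - p. e a) = e p * (\<Prod>a=Suc p..<N - p. e a)"
    by (rule prod.atLeast_Suc_lessThan) (use p in simp)
  also have "(\<Prod>a=Suc p..<N - p. e a) = (\<Prod>a=Suc p..<N - Suc p. e a) * e (N - Suc p)"
    unfolding r(1) using r(2) by simp
  finally show ?case using step assms(3)[OF p] by (simp add: mult_ac)
qed

text \<open>Opposite entries of A offer two independent data: their ratios are spent on the Y_p and
  their products on the X_p, with every B_k the reversal matrix. For odd N the middle entry supplies
  the one additional X_p.\<close>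

theorem algebraically_independent_even:
  assumes N: "N \<ge> 1" and j: "even j"
  shows "algebraically_independent (coords N j) ({1..N div 2} <+> {0..<(N + 1) div 2})
    (case_sum (Y_fun N) (X_even N j))"
proof (rule algebraically_independentI)
  fix y :: "nat + nat \<Rightarrow> complex" assume y: "\<And>i. y i \<noteq> 0"
  let ?n = "N div 2" and ?m = "(N + 1) div 2"
  from Y_fun_prescribed[OF N, of "\<lambda>p. y (Inl p)"] obtain \<rho> where R: "(\<forall>a. \<rho> a \<noteq> 0) \<and>
      (\<forall>H. (\<forall>a<N. H 0 a \<noteq> 0) \<longrightarrow> (\<forall>a<N div 2. H 0 (N - Suc a) = \<rho> a * H 0 a) \<longrightarrow>
        (\<forall>p\<in>{1..N div 2}. Y_fun N p (anti_point N H) = y (Inl p)))"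
    by (rule exE)
  have rho: "\<rho> a \<noteq> 0" for a
    using conjunct1[OF R, THEN spec, of a] .
  note Y = conjunct2[OF R, THEN spec, THEN mp, THEN mp, THEN bspec]
  \<comment> \<open>The signs left over in X_p: at the point constructed here it equals
    \<open>\<kappa> p\<close> divided by the product of \<open>e\<close> over the range from p to N
    - p - 1.\<close>
  define \<kappa> where "\<kappa> p = eps p ^ Suc j / eps (N - p) ^ Suc j" for p
  \<comment> \<open>The value this product must take for X_p to be as prescribed. The default 1 is
    the empty product at p = N/2 for even N and ends the recursion behind the middle entry for odd
    N.\<close>
  define \<tau> where "\<tau> p = (if p < ?m then \<kappa> p / y (Inr p) else 1)" for p
  define s where "s a = \<tau> a / \<tau> (Suc a)" for a
  \<comment> \<open>From the ratio \<open>\<rho>\<close> and the product \<open>s\<close> of two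
    opposite entries, the one in the first half is a square root of their quotient s/\<rho>. The
    middle entry of odd N is \<open>s\<close> itself.\<close>
  define h where "h a = (if a < ?n then csqrt (s a / \<rho> a) else if a < N - ?n then s a
    else \<rho> (N - Suc a) * csqrt (s (N - Suc a) / \<rho> (N - Suc a)))" for a
  define H where "H k = (if k = 0 then h else (\<lambda>a. 1))" for k :: nat
  define x where "x = anti_point N H"
  have k0: "\<kappa> p \<noteq> 0" for p by (simp add: \<kappa>_def eps_nonzero)
  have t0: "\<tau> p \<noteq> 0" for p using k0 y by (simp add: \<tau>_def)
  have s0: "s p \<noteq> 0" for p using t0 by (simp add: s_def)
  have h0: "h a \<noteq> 0" for a using s0 rho by (simp add: h_def)
  have H0: "H k a \<noteq> 0" for k a using h0 by (simp add: H_def)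
  have ratio: "h (N - Suc a) = \<rho> a * h a" if "a < ?n" for a
  proof -
    have "\<not> N - Suc a < ?n" "\<not> N - Suc a < N - ?n" "N - Suc (N - Suc a) = a" using that by auto
    then show ?thesis using that by (simp add: h_def)
  qed
  have pair: "h a * h (N - Suc a) = s a" if "a < ?n" for a
  proof -
    have "h a * h (N - Suc a) = \<rho> a * (csqrt (s a / \<rho> a))\<^sup>2"
      unfolding ratio[OF that] using that by (simp add: h_def power2_eq_square)
    then show ?thesis using rho[of a] by simp
  qed
  have Yx: "Y_fun N p x = y (Inl p)" if "p \<in> {1..?n}" for p
    unfolding x_def by (rule Y[OF _ _ that]) (simp_all add: H_def h0 ratio)
  define e where "e a = h (N - Suc a)" for a
  have range: "(\<Prod>a=p..<N - p. e a) = \<tau> p" if "p \<le> ?n" for p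
  proof (rule prod_symmetric_range[OF _ _ _ that])
    show "e ?n = \<tau> ?n" if odd: "odd N"
    proof -
      have "N - Suc ?n = ?n" "?n < N - ?n" "\<not> Suc ?n < ?m" using odd by (auto elim: oddE)
      then show ?thesis by (simp add: e_def h_def s_def \<tau>_def)
    qed
    show "\<tau> ?n = 1" if "even N"
    proof -
      have "\<not> ?n < ?m" using that by (auto elim: evenE)
      then show ?thesis by (simp add: \<tau>_def)
    qed
    show "e a * e (N - Suc a) * \<tau> (Suc a) = \<tau> a" if a: "a < ?n" for a
    proof -
      have "N - Suc (N - Suc a) = a" using a by auto
      then have "e a * e (N - Suc a) = s a" using pair[OF a] by (simp add: e_def mult.commute)
      then show ?thesis using t0[of "Suc a"] by (simp add: s_def)
    qed
  qed
  have ns: "det (chain_mat N x k) \<noteq> 0" for k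
    unfolding x_def by (rule det_anti_point_nonzero) (rule H0)
  have S: "S_chain N x j = antidiag N e"
    unfolding x_def using S_chain_anti_point[of j H N] j by (simp add: H_def e_def[abs_def])
  have B: "chain_mat N x k = antidiag N (\<lambda>a. 1)" if "k \<in> {1..j}" for k
    unfolding x_def chain_mat_anti_point using that by (simp add: H_def)
  have Xx: "X_even N j p x = y (Inr p)" if p: "p \<in> {0..<?m}" for p
  proof -
    have p': "p \<le> ?n" "p \<le> N" "p \<le> N - p" "p < ?m" using p by auto
    have num: "upper_right_minor q (S_chain N x j) * (\<Prod>k=1..j. upper_right_minor q (chain_mat N x k))
        = eps q ^ Suc j * (\<Prod>a<q. e a)" if "q \<le> N" for q
    proof -
      have "(\<Prod>k=1..j. upper_right_minor q (chain_mat N x k)) = (\<Prod>k=1..j. eps q)"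
        by (intro prod.cong refl) (simp add: B upper_right_minor_antidiag that)
      then show ?thesis by (simp add: S upper_right_minor_antidiag that)
    qed
    have "(\<Prod>a<N - p. e a) = (\<Prod>a<p. e a) * (\<Prod>a=p..<N - p. e a)"
      using prod.atLeastLessThan_concat[of 0 p "N - p" e] p'(3) by (simp add: atLeast0LessThan)
    also have "\<dots> = (\<Prod>a<p. e a) * \<tau> p" by (simp only: range[OF p'(1)])
    finally have P: "(\<Prod>a<N - p. e a) = (\<Prod>a<p. e a) * \<tau> p" .
    have P0: "(\<Prod>a<p. e a) \<noteq> 0" using h0 by (simp add: e_def)
    have "X_even N j p x = (eps p ^ Suc j * (\<Prod>a<p. e a)) / (eps (N - p) ^ Suc j * ((\<Prod>a<p. e a) * \<tau> p))"
      unfolding X_even_def Let_def num[OF p'(2)] num[OF diff_le_self] P ..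
    also have "\<dots> = \<kappa> p / \<tau> p"
      using P0 t0[of p] by (simp add: \<kappa>_def)
    also have "\<dots> = y (Inr p)" using p'(4) k0[of p] y[of "Inr p"] by (simp add: \<tau>_def)
    finally show ?thesis .
  qed
  show "\<exists>x. (\<forall>i\<in>{1..?n} <+> {0..<?m}. case_sum (Y_fun N) (X_even N j) i x = y i) \<and>
      (\<forall>i\<in>{1..?n} <+> {0..<?m}. smooth_pt (coords N j) x (case_sum (Y_fun N) (X_even N j) i))"
  proof (intro exI[of _ x] conjI ballI)
    fix i assume "i \<in> {1..?n} <+> {0..<?m}"
    then consider p where "i = Inl p" "p \<in> {1..?n}" | p where "i = Inr p" "p \<in> {0..<?m}" by (rule PlusE)
    then show "case_sum (Y_fun N) (X_even N j) i x = y i"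
      by cases (simp_all only: sum.case Yx Xx)
  next
    fix i assume "i \<in> {1..?n} <+> {0..<?m}"
    then consider p where "i = Inl p" "p \<in> {1..?n}" | p where "i = Inr p" "p \<in> {0..<?m}" by (rule PlusE)
    then show "smooth_pt (coords N j) x (case_sum (Y_fun N) (X_even N j) i)"
    proof cases
      case (1 p)
      then show ?thesis using smooth_Y_fun[OF 1(2) ns] by simp
    next
      case (2 p)
      have "X_even N j p x \<noteq> 0" using Xx[OF 2(2)] y by simp
      then have "smooth_pt (coords N j) x (X_even N j p)"
        by (intro smooth_X_even ns) (use 2(2) in auto)
      then show ?thesis using 2(1) by simp
    qed
  qed
qed simp

text \<open>If every B_k were the reversal matrix, an antidiagonal A would enter X_p only through
  ratios of opposite entries, and these are already used up by the Y_p. The freedom for the X_p is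
  therefore put into the last matrix B_j.\<close>

theorem algebraically_independent_odd:
  assumes N: "N \<ge> 1" and j: "odd j"
  shows "algebraically_independent (coords N j) ({1..N div 2} <+> {1..N div 2})
    (case_sum (Y_fun N) (X_odd N j))"
proof (rule algebraically_independentI)
  fix y :: "nat + nat \<Rightarrow> complex" assume y: "\<And>i. y i \<noteq> 0"
  let ?n = "N div 2"
  define r where "r = (j - 1) div 2"
  have jr: "j = 2 * r + 1" using j by (auto simp: r_def elim: oddE)
  from Y_fun_prescribed[OF N, of "\<lambda>p. y (Inl p)"] obtain \<rho> where R: "(\<forall>a. \<rho> a \<noteq> 0) \<and>
      (\<forall>H. (\<forall>a<N. H 0 a \<noteq> 0) \<longrightarrow> (\<forall>a<N div 2. H 0 (N - Suc a) = \<rho> a * H 0 a) \<longrightarrow>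
        (\<forall>p\<in>{1..N div 2}. Y_fun N p (anti_point N H) = y (Inl p)))"
    by (rule exE)
  have rho: "\<rho> a \<noteq> 0" for a
    using conjunct1[OF R, THEN spec, of a] .
  note Y = conjunct2[OF R, THEN spec, THEN mp, THEN mp, THEN bspec]
  define h where "h a = (if a < N - ?n then 1 else \<rho> (N - Suc a))" for a
  define e where "e a = h (N - Suc a)" for a
  define E where "E q = (\<Prod>a<q. e a)" for q
  \<comment> \<open>The value of X_p if B_j were the reversal matrix as well; the products
    \<open>E\<close> involve A alone.\<close>
  define \<kappa> where "\<kappa> p = E p * E (N - p) * eps N / (eps p * eps (N - p) * E N)" for p
  \<comment> \<open>The partial products intended for the entries \<open>d\<close> of B_j. The
    minors of S and those of B_j each put one factor t_p into the denominator, so X_p becomes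
    \<open>\<kappa> p\<close> over t_p squared.\<close>
  define t where "t p = (if p = 0 then 1 else csqrt (\<kappa> p / y (Inr p)))" for p
  \<comment> \<open>Trivial from N div 2 on, so that the products over N - p and over N entries are
    both \<open>t (N div 2)\<close>; these powers cancel against the squared determinant of
    B_j.\<close>
  define d where "d a = (if a < ?n then t (Suc a) / t a else 1)" for a
  define H where "H k = (if k = 0 then h else if k = j then d else (\<lambda>a. 1))" for k :: nat
  define x where "x = anti_point N H"
  have h0: "h a \<noteq> 0" for a using rho by (simp add: h_def)
  have E0: "E q \<noteq> 0" for q using h0 by (simp add: E_def e_def)
  have k0: "\<kappa> p \<noteq> 0" for p by (simp add: \<kappa>_def eps_nonzero E0)
  have t0: "t p \<noteq> 0" for p using k0 y by (simp add: t_def)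
  have d0: "d a \<noteq> 0" for a using t0 by (simp add: d_def)
  have H0: "H k a \<noteq> 0" for k a using h0 d0 by (simp add: H_def)
  have ratio: "h (N - Suc a) = \<rho> a * h a" if "a < ?n" for a
  proof -
    have "\<not> N - Suc a < N - ?n" "N - Suc (N - Suc a) = a" "a < N - ?n" using that by auto
    then show ?thesis by (simp add: h_def)
  qed
  have Yx: "Y_fun N p x = y (Inl p)" if "p \<in> {1..?n}" for p
    unfolding x_def by (rule Y[OF _ _ that]) (simp_all add: H_def h0 ratio)
  have ns: "det (chain_mat N x k) \<noteq> 0" for k
    unfolding x_def by (rule det_anti_point_nonzero) (rule H0)
  have j0: "j \<noteq> 0" using jr by simp
  have S: "S_chain N x j = diag N (\<lambda>a. e a / d a)"
  proof -
    have ev: "even (2 * r)" by simp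
    have "S_chain N x (2 * r) = antidiag N e"
      unfolding x_def using S_chain_anti_point[of "2 * r" H N] jr by (simp add: H_def e_def[abs_def])
    moreover have "the (mat_inverse (chain_mat N x j)) = antidiag N (\<lambda>a. inverse (d (N - Suc a)))"
      unfolding x_def chain_mat_anti_point using mat_inverse_antidiag[of N d] d0 j0 by (simp add: H_def)
    moreover have "S_chain N x j = S_chain N x (2 * r) * the (mat_inverse (chain_mat N x j))"
      unfolding jr by simp
    ultimately have "S_chain N x j = diag N (\<lambda>a. e a * inverse (d (N - Suc (N - Suc a))))"
      by (simp add: antidiag_antidiag)
    also have "\<dots> = diag N (\<lambda>a. e a / d a)"
      by (rule diag_cong) (simp add: divide_inverse Suc_diff_Suc)
    finally show ?thesis .
  qed
  have Bj: "chain_mat N x j = antidiag N d"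
    unfolding x_def chain_mat_anti_point using j0 by (simp add: H_def)
  have B: "chain_mat N x k = antidiag N (\<lambda>a. 1)" if "0 < k" "k < j" for k
    unfolding x_def chain_mat_anti_point using that by (simp add: H_def)
  have D: "(\<Prod>a<q. d a) = t q" if "q \<le> ?n" for q
    using that
  proof (induction q)
    case 0
    then show ?case by (simp add: t_def)
  next
    case (Suc q)
    then show ?case using t0[of q] by (simp add: d_def)
  qed
  have D': "(\<Prod>a<q. d a) = t ?n" if "?n \<le> q" for q
  proof -
    have "(\<Prod>a<q. d a) = (\<Prod>a<?n. d a)"
      by (rule prod.mono_neutral_right) (use that in \<open>auto simp: d_def\<close>)
    then show ?thesis by (simp add: D)
  qed
  have detA: "det (chain_mat N x 0) = eps N * E N"
  proof -
    have "(\<Prod>a<N. h a) = (\<Prod>a<N. e a)"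
      by (rule prod.reindex_bij_witness[of _ "\<lambda>a. N - Suc a" "\<lambda>a. N - Suc a"]) (auto simp: e_def)
    then show ?thesis
      unfolding x_def chain_mat_anti_point det_antidiag by (simp add: H_def E_def)
  qed
  have Xx: "X_odd N j p x = y (Inr p)" if p: "p \<in> {1..?n}" for p
  proof -
    have p': "p \<le> ?n" "?n \<le> N - p" "p \<le> N" "?n \<le> N" "p \<noteq> 0" using p by auto
    have S1: "upper_left_minor p (S_chain N x j) = E p / t p"
      unfolding S upper_left_minor_diag[OF p'(3)] prod_dividef D[OF p'(1)] E_def ..
    have S2: "upper_left_minor (N - p) (S_chain N x j) = E (N - p) / t ?n"
      unfolding S upper_left_minor_diag[OF diff_le_self] prod_dividef D'[OF p'(2)] E_def ..
    define c where "c = eps p * eps (N - p)"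
    have c0: "c \<noteq> 0" by (simp add: c_def eps_nonzero)
    have m: "upper_right_minor p (chain_mat N x k) * upper_right_minor (N - p) (chain_mat N x k) = c"
      if "0 < k" "k < j" for k
      using p'(3) by (simp add: B[OF that] upper_right_minor_antidiag c_def)
    have mj: "upper_right_minor p (chain_mat N x j) * upper_right_minor (N - p) (chain_mat N x j)
        = c * (t p * t ?n)"
      using p'(3) by (simp add: Bj upper_right_minor_antidiag c_def D[OF p'(1)] D'[OF p'(2)])
    have 1: "(\<Prod>k=1..r. upper_right_minor p (chain_mat N x (2 * k)) * upper_right_minor (N - p) (chain_mat N x (2 * k)))
        = c ^ r"
    proof -
      have "(\<Prod>k=1..r. upper_right_minor p (chain_mat N x (2 * k)) * upper_right_minor (N - p) (chain_mat N x (2 * k)))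
          = (\<Prod>k=1..r. c)"
        by (rule prod.cong[OF refl], rule m) (auto simp: jr)
      then show ?thesis by simp
    qed
    have 2: "(\<Prod>k=1..r+1. upper_right_minor p (chain_mat N x (2 * k - 1)) * upper_right_minor (N - p) (chain_mat N x (2 * k - 1)))
        = c ^ r * (c * (t p * t ?n))"
    proof -
      have "(\<Prod>k=1..r. upper_right_minor p (chain_mat N x (2 * k - 1)) * upper_right_minor (N - p) (chain_mat N x (2 * k - 1)))
          = (\<Prod>k=1..r. c)"
        by (rule prod.cong[OF refl], rule m) (auto simp: jr)
      then show ?thesis using mj by (simp add: jr)
    qed
    have dB: "det (chain_mat N x k) = eps N" if "0 < k" "k < j" for k
      by (simp add: B[OF that] det_antidiag)
    have dBj: "det (chain_mat N x j) = eps N * t ?n"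
      by (simp add: Bj det_antidiag D'[OF p'(4)])
    have 3: "(\<Prod>k=1..r. (det (chain_mat N x (2 * k)))\<^sup>2) = ((eps N)\<^sup>2) ^ r"
    proof -
      have "(\<Prod>k=1..r. (det (chain_mat N x (2 * k)))\<^sup>2) = (\<Prod>k=1..r. (eps N)\<^sup>2)"
        by (rule prod.cong[OF refl], rule arg_cong[of _ _ "\<lambda>z. z\<^sup>2"], rule dB) (auto simp: jr)
      then show ?thesis by simp
    qed
    have 4: "(\<Prod>k=1..r+1. (det (chain_mat N x (2 * k - 1)))\<^sup>2) = ((eps N)\<^sup>2) ^ r * (eps N * t ?n)\<^sup>2"
    proof -
      have "(\<Prod>k=1..r. (det (chain_mat N x (2 * k - 1)))\<^sup>2) = (\<Prod>k=1..r. (eps N)\<^sup>2)"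
        by (rule prod.cong[OF refl], rule arg_cong[of _ _ "\<lambda>z. z\<^sup>2"], rule dB) (auto simp: jr)
      then show ?thesis using dBj by (simp add: jr)
    qed
    have "X_odd N j p x = (E p / t p * (E (N - p) / t ?n) * c ^ r) / (c ^ r * (c * (t p * t ?n)))
        * ((((eps N)\<^sup>2) ^ r * (eps N * t ?n)\<^sup>2) / (eps N * E N * ((eps N)\<^sup>2) ^ r))"
      unfolding X_odd_def Let_def r_def[symmetric] S1 S2 1 2 3 4 detA ..
    also have "\<dots> = E p * E (N - p) * eps N / (c * E N) / (t p)\<^sup>2"
      using c0 t0[of p] t0[of ?n] eps_nonzero[of N] E0[of N]
      by (simp add: power2_eq_square mult_ac)
    also have "\<dots> = \<kappa> p / (t p)\<^sup>2" by (simp add: \<kappa>_def c_def)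
    also have "\<dots> = y (Inr p)" using p'(5) k0[of p] y[of "Inr p"] by (simp add: t_def)
    finally show ?thesis .
  qed
  show "\<exists>x. (\<forall>i\<in>{1..?n} <+> {1..?n}. case_sum (Y_fun N) (X_odd N j) i x = y i) \<and>
      (\<forall>i\<in>{1..?n} <+> {1..?n}. smooth_pt (coords N j) x (case_sum (Y_fun N) (X_odd N j) i))"
  proof (intro exI[of _ x] conjI ballI)
    fix i assume "i \<in> {1..?n} <+> {1..?n}"
    then consider p where "i = Inl p" "p \<in> {1..?n}" | p where "i = Inr p" "p \<in> {1..?n}" by (rule PlusE)
    then show "case_sum (Y_fun N) (X_odd N j) i x = y i"
      by cases (simp_all only: sum.case Yx Xx)
  next
    fix i assume "i \<in> {1..?n} <+> {1..?n}"
    then consider p where "i = Inl p" "p \<in> {1..?n}" | p where "i = Inr p" "p \<in> {1..?n}" by (rule PlusE)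
    then show "smooth_pt (coords N j) x (case_sum (Y_fun N) (X_odd N j) i)"
    proof cases
      case (1 p)
      then show ?thesis using smooth_Y_fun[OF 1(2) ns] by simp
    next
      case (2 p)
      have "X_odd N j p x \<noteq> 0" using Xx[OF 2(2)] y by simp
      then have "smooth_pt (coords N j) x (X_odd N j p)"
        by (intro smooth_X_odd ns j) (use 2(2) in auto)
      then show ?thesis using 2(1) by simp
    qed
  qed
qed simp

theorem theorem6p7:
  fixes N j :: nat
  assumes "N \<ge> 1"
  shows
    "(\<forall>x. det (chain_mat N x 0) \<noteq> 0 \<longrightarrow>
        lambda_expansion N (chain_mat N x 0) (\<lambda>p. Y_fun N p x)) \<and>
     (\<forall>p\<in>{1..N div 2}. casimir N j (Y_fun N p)) \<and>
     (even j \<longrightarrow>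
        (\<forall>p\<in>{0..<(N + 1) div 2}. casimir N j (X_even N j p)) \<and>
        algebraically_independent (coords N j)
          ({1..N div 2} <+> {0..<(N + 1) div 2}) (case_sum (Y_fun N) (X_even N j)) \<and>
        card (case_sum (Y_fun N) (X_even N j) ` ({1..N div 2} <+> {0..<(N + 1) div 2})) = N) \<and>
     (odd j \<longrightarrow>
        (\<forall>p\<in>{1..N div 2}. casimir N j (X_odd N j p)) \<and>
        algebraically_independent (coords N j)
          ({1..N div 2} <+> {1..N div 2}) (case_sum (Y_fun N) (X_odd N j)) \<and>
        card (case_sum (Y_fun N) (X_odd N j) ` ({1..N div 2} <+> {1..N div 2}))
          = 2 * (N div 2))"
proof (intro conjI allI ballI impI)
  show "lambda_expansion N (chain_mat N x 0) (\<lambda>p. Y_fun N p x)" if "det (chain_mat N x 0) \<noteq> 0" for x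
    by (rule lambda_expansion_Y_fun[OF assms that])
  show "casimir N j (Y_fun N p)" if "p \<in> {1..N div 2}" for p
    by (rule casimir_Y_fun[OF that])
  show "casimir N j (X_even N j p)" if "even j" "p \<in> {0..<(N + 1) div 2}" for p
    by (rule casimir_X_even[OF that(1)]) (use that(2) in auto)
  show "casimir N j (X_odd N j p)" if "odd j" "p \<in> {1..N div 2}" for p
    by (rule casimir_X_odd[OF that(1)]) (use that(2) in auto)
  show even: "algebraically_independent (coords N j)
      ({1..N div 2} <+> {0..<(N + 1) div 2}) (case_sum (Y_fun N) (X_even N j))" if "even j"
    by (rule algebraically_independent_even[OF assms that])
  show odd: "algebraically_independent (coords N j)
      ({1..N div 2} <+> {1..N div 2}) (case_sum (Y_fun N) (X_odd N j))" if "odd j"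
    by (rule algebraically_independent_odd[OF assms that])
  show "card (case_sum (Y_fun N) (X_even N j) ` ({1..N div 2} <+> {0..<(N + 1) div 2})) = N" if "even j"
  proof -
    have "N div 2 + (N + 1) div 2 = N" by linarith
    then show ?thesis
      using card_image[OF algebraically_independent_inj_on[OF even[OF that]]] by (simp add: card_Plus)
  qed
  show "card (case_sum (Y_fun N) (X_odd N j) ` ({1..N div 2} <+> {1..N div 2})) = 2 * (N div 2)" if "odd j"
    using card_image[OF algebraically_independent_inj_on[OF odd[OF that]]] by (simp add: card_Plus)
qed

end
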